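(* Let $V\in L^1_{\rm loc}(\mathbb{R}^d)$ with $V\ge0$, let $(X_t)_{t\ge0}$ be a $d$-dimensional Cauchy process, and define $$(T_tf)(x)=\mathbb{E}^x\left[e^{-\int_0^tV(X_s)\,ds}f(X_t)\right],\qquad f\in L^2(\mathbb{R}^d),\ x\in\mathbb{R}^d,\ t\ge0.$$ Then $\{T_t:t\ge0\}$ is a strongly continuous symmetric semigroup on $L^2(\mathbb{R}^d)$. In particular, there exists a self-adjoint operator $K$ on $L^2(\mathbb{R}^d)$, bounded from below, such that $e^{-tK}=T_t$ for all $t\ge0$.
   Context: The $d$-dimensional Cauchy process is the Lévy process on $\mathbb{R}^d$ with càdlàg paths and $\mathbb{E}^0[e^{i\xi\cdot X_t}]=e^{-t|\xi|}$, $\xi\in\mathbb{R}^d$; $\mathbb{E}^x$ denotes expectation for the process started at $x$. "Symmetric" means that each $T_t$ is a bounded operator on $L^2(\mathbb{R}^d)$ with $T_t^*=T_t$. *)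

theory Defs
  imports "HOL-Probability.Probability"
begin

section \<open>Complex inner product spaces and operators on them\<close>

text \<open>The topology, the norm and the real inner product come from \<^class>\<open>real_inner\<close>; the complex
  inner product is conjugate linear in its first argument.\<close>

class complex_inner = real_inner +
  fixes scaleC :: "complex \<Rightarrow> 'a \<Rightarrow> 'a" (infixr "*\<^sub>C" 75)
    and cinner :: "'a \<Rightarrow> 'a \<Rightarrow> complex"
  assumes scaleC_add_right: "c *\<^sub>C (f + g) = c *\<^sub>C f + c *\<^sub>C g"
    and scaleC_add_left: "(b + c) *\<^sub>C f = b *\<^sub>C f + c *\<^sub>C f"
    and scaleC_scaleC: "b *\<^sub>C (c *\<^sub>C f) = (b * c) *\<^sub>C f"
    and scaleC_of_real: "complex_of_real r *\<^sub>C f = r *\<^sub>R f"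
    and cinner_commute: "cinner f g = cnj (cinner g f)"
    and cinner_add_right: "cinner f (g + h) = cinner f g + cinner f h"
    and cinner_scaleC_right: "cinner f (c *\<^sub>C g) = c * cinner f g"
    and Re_cinner: "Re (cinner f g) = inner f g"

definition csubspace :: "'h::complex_inner set \<Rightarrow> bool" where
  "csubspace D \<longleftrightarrow> 0 \<in> D \<and> (\<forall>f\<in>D. \<forall>g\<in>D. f + g \<in> D) \<and> (\<forall>c. \<forall>f\<in>D. c *\<^sub>C f \<in> D)"

definition clinear_on :: "'h::complex_inner set \<Rightarrow> ('h \<Rightarrow> 'h) \<Rightarrow> bool" where
  "clinear_on D A \<longleftrightarrow>
     (\<forall>f\<in>D. \<forall>g\<in>D. A (f + g) = A f + A g) \<and> (\<forall>c. \<forall>f\<in>D. A (c *\<^sub>C f) = c *\<^sub>C A f)"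

definition bounded_clinear :: "('h::complex_inner \<Rightarrow> 'h) \<Rightarrow> bool" where
  "bounded_clinear A \<longleftrightarrow> bounded_linear A \<and> clinear_on UNIV A"

text \<open>An unbounded operator is given by its domain \<open>D\<close> and a function \<open>A\<close> whose values outside
  \<open>D\<close> are irrelevant.  The pair \<open>(g, h)\<close> lies in the graph of the adjoint iff
  \<open>g\<close> is in the domain of the adjoint and is mapped to \<open>h\<close>.\<close>

definition adjoint_graph :: "'h::complex_inner set \<Rightarrow> ('h \<Rightarrow> 'h) \<Rightarrow> ('h \<times> 'h) set" where
  "adjoint_graph D A = {(g, h). \<forall>f\<in>D. cinner (A f) g = cinner f h}"

definition self_adjoint_on :: "'h::complex_inner set \<Rightarrow> ('h \<Rightarrow> 'h) \<Rightarrow> bool" where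
  "self_adjoint_on D A \<longleftrightarrow>
     csubspace D \<and> closure D = UNIV \<and> clinear_on D A \<and>
     adjoint_graph D A = (\<lambda>f. (f, A f)) ` D"

definition bounded_from_below_on :: "'h::complex_inner set \<Rightarrow> ('h \<Rightarrow> 'h) \<Rightarrow> bool" where
  "bounded_from_below_on D A \<longleftrightarrow> (\<exists>c. \<forall>f\<in>D. c * (norm f)\<^sup>2 \<le> Re (cinner f (A f)))"


section \<open>Functional calculus\<close>

definition orthogonal_projection :: "('h::complex_inner \<Rightarrow> 'h) \<Rightarrow> bool" where
  "orthogonal_projection P \<longleftrightarrow>
     bounded_clinear P \<and> P \<circ> P = P \<and> adjoint_graph UNIV P = range (\<lambda>f. (f, P f))"

definition projection_valued_measure :: "(real set \<Rightarrow> 'h::complex_inner \<Rightarrow> 'h) \<Rightarrow> bool" where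
  "projection_valued_measure E \<longleftrightarrow>
     (\<forall>B\<in>sets borel. orthogonal_projection (E B)) \<and>
     E {} = (\<lambda>f. 0) \<and> E UNIV = id \<and>
     (\<forall>A\<in>sets borel. \<forall>B\<in>sets borel. E (A \<inter> B) = E A \<circ> E B) \<and>
     (\<forall>B f. range B \<subseteq> sets borel \<longrightarrow> disjoint_family B \<longrightarrow>
        (\<lambda>n::nat. E (B n) f) sums E (\<Union>n. B n) f)"

definition spectral_distribution ::
    "(real set \<Rightarrow> 'h::complex_inner \<Rightarrow> 'h) \<Rightarrow> 'h \<Rightarrow> real measure" where
  "spectral_distribution E f =
     measure_of UNIV (sets borel) (\<lambda>B. ennreal (Re (cinner f (E B f))))"

lemma emeasure_spectral_distribution:
  assumes E: "projection_valued_measure E" and B: "B \<in> sets borel"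
  shows "emeasure (spectral_distribution E f) B = ennreal (Re (cinner f (E B f)))"
  unfolding spectral_distribution_def
proof (rule emeasure_measure_of_sigma)
  have sq: "Re (cinner f (E A f)) = (norm (E A f))\<^sup>2" if A: "A \<in> sets borel" for A
  proof -
    have P: "E A \<circ> E A = E A" "adjoint_graph UNIV (E A) = range (\<lambda>f. (f, E A f))"
      using E A by (auto simp: projection_valued_measure_def orthogonal_projection_def)
    then have "(E A f, E A (E A f)) \<in> adjoint_graph UNIV (E A)"
      by auto
    then have "cinner (E A f) (E A f) = cinner f (E A (E A f))"
      by (auto simp: adjoint_graph_def)
    then show ?thesis
      using P(1) by (metis Re_cinner comp_apply power2_norm_eq_inner)
  qed
  show "sigma_algebra UNIV (sets (borel :: real measure))"
    using sets.sigma_algebra_axioms[of "borel :: real measure"] by simp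
  show "positive (sets borel) (\<lambda>B. ennreal (Re (cinner f (E B f))))"
    using E by (simp add: positive_def projection_valued_measure_def Re_cinner)
  show "countably_additive (sets borel) (\<lambda>B. ennreal (Re (cinner f (E B f))))"
  proof (rule countably_additiveI)
    fix A :: "nat \<Rightarrow> real set"
    assume A: "range A \<subseteq> sets borel" "disjoint_family A"
    then have "(\<lambda>n. E (A n) f) sums E (\<Union>n. A n) f"
      using E by (auto simp: projection_valued_measure_def)
    then have "(\<lambda>n. inner f (E (A n) f)) sums inner f (E (\<Union>n. A n) f)"
      by (rule bounded_linear.sums[OF bounded_linear_inner_right])
    moreover have "0 \<le> inner f (E (A n) f)" for n
      using sq[of "A n"] A(1) by (auto simp: Re_cinner)
    ultimately show "(\<Sum>n. ennreal (Re (cinner f (E (A n) f))))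
        = ennreal (Re (cinner f (E (\<Union>n. A n) f)))"
      unfolding Re_cinner by (metis suminf_ennreal_eq)
  qed
qed (rule B)

text \<open>\<open>A\<close>, with domain \<open>D\<close>, is the integral of \<open>\<phi>\<close> with respect to \<open>E\<close>.  A linear
  operator on a dense domain is determined by its quadratic form, by polarization, so it is enough
  to integrate against the measures \<open>B \<mapsto> \<langle>f, E(B) f\<rangle>\<close>.\<close>

definition has_spectral_integral ::
    "(real set \<Rightarrow> 'h::complex_inner \<Rightarrow> 'h) \<Rightarrow> (real \<Rightarrow> real) \<Rightarrow> 'h set \<Rightarrow> ('h \<Rightarrow> 'h) \<Rightarrow> bool" where
  "has_spectral_integral E \<phi> D A \<longleftrightarrow>
     D = {f. integrable (spectral_distribution E f) (\<lambda>x. (\<phi> x)\<^sup>2)} \<and>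
     clinear_on D A \<and>
     (\<forall>f\<in>D. cinner f (A f) = complex_of_real (\<integral>x. \<phi> x \<partial>spectral_distribution E f))"

text \<open>\<open>A\<close>, with domain \<open>D'\<close>, is \<open>\<phi>(K)\<close>.  The spectral theorem says that each self-adjoint
  \<open>K\<close> has exactly one spectral measure \<open>E\<close>.\<close>

definition is_function_of_operator ::
    "(real \<Rightarrow> real) \<Rightarrow> 'h::complex_inner set \<Rightarrow> ('h \<Rightarrow> 'h) \<Rightarrow> 'h set \<Rightarrow> ('h \<Rightarrow> 'h) \<Rightarrow> bool" where
  "is_function_of_operator \<phi> D K D' A \<longleftrightarrow>
     (\<exists>E. projection_valued_measure E \<and>
          has_spectral_integral E (\<lambda>x. x) D K \<and> has_spectral_integral E \<phi> D' A)"


section \<open>Semigroups\<close>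

definition strongly_continuous_semigroup :: "(real \<Rightarrow> 'h::complex_inner \<Rightarrow> 'h) \<Rightarrow> bool" where
  "strongly_continuous_semigroup T \<longleftrightarrow>
     (\<forall>t\<ge>0. bounded_clinear (T t)) \<and> T 0 = id \<and>
     (\<forall>s\<ge>0. \<forall>t\<ge>0. T (s + t) = T s \<circ> T t) \<and>
     (\<forall>f. continuous_on {0..} (\<lambda>t. T t f))"

definition symmetric_family :: "(real \<Rightarrow> 'h::complex_inner \<Rightarrow> 'h) \<Rightarrow> bool" where
  "symmetric_family T \<longleftrightarrow>
     (\<forall>t\<ge>0. bounded_clinear (T t) \<and> adjoint_graph UNIV (T t) = range (\<lambda>f. (f, T t f)))"


section \<open>The complex Hilbert space of square integrable functions\<close>

definition square_integrable :: "('a::euclidean_space \<Rightarrow> complex) set" where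
  "square_integrable =
     {f. f \<in> borel_measurable borel \<and> integrable lborel (\<lambda>x. (cmod (f x))\<^sup>2)}"

lemma integrable_cnj_mult:
  assumes "f \<in> square_integrable" "g \<in> square_integrable"
  shows "integrable lborel (\<lambda>x. cnj (f x) * g x)"
proof (rule Bochner_Integration.integrable_bound)
  show "integrable lborel (\<lambda>x. (cmod (f x))\<^sup>2 + (cmod (g x))\<^sup>2)"
    using assms by (auto simp: square_integrable_def)
  have [measurable]: "f \<in> borel_measurable borel" "g \<in> borel_measurable borel"
    using assms by (auto simp: square_integrable_def)
  have [measurable]: "cnj \<in> borel_measurable borel"
    by (intro borel_measurable_continuous_onI continuous_intros)
  show "(\<lambda>x. cnj (f x) * g x) \<in> borel_measurable lborel"
    by measurable
  have "a * b \<le> a\<^sup>2 + b\<^sup>2" if "0 \<le> a" "0 \<le> b" for a b :: real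
    using sum_squares_bound[of a b] mult_nonneg_nonneg[OF that] by linarith
  then show "AE x in lborel. norm (cnj (f x) * g x) \<le> norm ((cmod (f x))\<^sup>2 + (cmod (g x))\<^sup>2)"
    by (auto simp: norm_mult)
qed

lemma square_integrable_zero: "(\<lambda>x. 0) \<in> square_integrable"
  by (simp add: square_integrable_def)

lemma square_integrable_add:
  assumes "f \<in> square_integrable" "g \<in> square_integrable"
  shows "(\<lambda>x. f x + g x) \<in> square_integrable"
  unfolding square_integrable_def
proof (intro CollectI conjI)
  have [measurable]: "f \<in> borel_measurable borel" "g \<in> borel_measurable borel"
    using assms by (auto simp: square_integrable_def)
  show "(\<lambda>x. f x + g x) \<in> borel_measurable borel"
    by measurable
  show "integrable lborel (\<lambda>x. (cmod (f x + g x))\<^sup>2)"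
  proof (rule Bochner_Integration.integrable_bound)
    show "integrable lborel (\<lambda>x. 2 * (cmod (f x))\<^sup>2 + 2 * (cmod (g x))\<^sup>2)"
      using assms by (auto simp: square_integrable_def)
    have "(cmod (a + b))\<^sup>2 \<le> 2 * (cmod a)\<^sup>2 + 2 * (cmod b)\<^sup>2" for a b
    proof -
      have "(cmod (a + b))\<^sup>2 \<le> (cmod a + cmod b)\<^sup>2"
        by (intro power_mono norm_triangle_ineq) auto
      also have "\<dots> \<le> 2 * (cmod a)\<^sup>2 + 2 * (cmod b)\<^sup>2"
        using sum_squares_bound[of "cmod a" "cmod b"] by (simp add: power2_sum)
      finally show ?thesis .
    qed
    then show "AE x in lborel. norm ((cmod (f x + g x))\<^sup>2)
        \<le> norm (2 * (cmod (f x))\<^sup>2 + 2 * (cmod (g x))\<^sup>2)"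
      by (intro AE_I2) (simp add: abs_of_nonneg)
  qed measurable
qed

lemma square_integrable_scale:
  "f \<in> square_integrable \<Longrightarrow> (\<lambda>x. c * f x) \<in> square_integrable"
  by (auto simp: square_integrable_def norm_mult power_mult_distrib)

definition L2_rel :: "('a::euclidean_space \<Rightarrow> complex) \<Rightarrow> ('a \<Rightarrow> complex) \<Rightarrow> bool" where
  "L2_rel f g \<longleftrightarrow>
     f \<in> square_integrable \<and> g \<in> square_integrable \<and> (AE x in lborel. f x = g x)"

quotient_type (overloaded) 'a L2 = "'a::euclidean_space \<Rightarrow> complex" / partial: L2_rel
  morphisms rep_L2 L2_class
proof (rule part_equivpI)
  show "\<exists>f::'a \<Rightarrow> complex. L2_rel f f"
    using square_integrable_zero by (auto simp: L2_rel_def)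
  show "symp (L2_rel :: ('a \<Rightarrow> complex) \<Rightarrow> _)"
    by (auto intro!: sympI simp: L2_rel_def elim: AE_mp)
  show "transp (L2_rel :: ('a \<Rightarrow> complex) \<Rightarrow> _)"
    by (rule transpI) (auto simp: L2_rel_def)
qed

lemma L2_rel_integral_cong:
  assumes "L2_rel f f'" "L2_rel g g'"
  shows "(\<integral>x. cnj (f x) * g x \<partial>lborel) = (\<integral>x. cnj (f' x) * g' x \<partial>lborel)"
proof (rule integral_cong_AE)
  have m: "f \<in> square_integrable" "f' \<in> square_integrable"
    "g \<in> square_integrable" "g' \<in> square_integrable"
    using assms by (auto simp: L2_rel_def)
  show "(\<lambda>x. cnj (f x) * g x) \<in> borel_measurable lborel"
    "(\<lambda>x. cnj (f' x) * g' x) \<in> borel_measurable lborel"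
    using integrable_cnj_mult[OF m(1,3)] integrable_cnj_mult[OF m(2,4)] by auto
  have "AE x in lborel. f x = f' x" "AE x in lborel. g x = g' x"
    using assms by (auto simp: L2_rel_def)
  then show "AE x in lborel. cnj (f x) * g x = cnj (f' x) * g' x"
    by eventually_elim simp
qed

instantiation L2 :: (euclidean_space) complex_inner
begin

lift_definition zero_L2 :: "'a L2" is "\<lambda>x. 0"
  using square_integrable_zero by (auto simp: L2_rel_def)

lift_definition plus_L2 :: "'a L2 \<Rightarrow> 'a L2 \<Rightarrow> 'a L2" is "\<lambda>f g x. f x + g x"
  by (auto simp: L2_rel_def square_integrable_add)

lift_definition scaleC_L2 :: "complex \<Rightarrow> 'a L2 \<Rightarrow> 'a L2" is "\<lambda>c f x. c * f x"
  by (auto simp: L2_rel_def square_integrable_scale)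

lift_definition cinner_L2 :: "'a L2 \<Rightarrow> 'a L2 \<Rightarrow> complex" is
  "\<lambda>f g. \<integral>x. cnj (f x) * g x \<partial>lborel"
  by (rule L2_rel_integral_cong)

definition scaleR_L2 :: "real \<Rightarrow> 'a L2 \<Rightarrow> 'a L2" where
  "scaleR_L2 r f = complex_of_real r *\<^sub>C f"

definition uminus_L2 :: "'a L2 \<Rightarrow> 'a L2" where
  "uminus_L2 f = (-1) *\<^sub>C f"

definition minus_L2 :: "'a L2 \<Rightarrow> 'a L2 \<Rightarrow> 'a L2" where
  "minus_L2 f g = f + (- g)"

definition inner_L2 :: "'a L2 \<Rightarrow> 'a L2 \<Rightarrow> real" where
  "inner_L2 f g = Re (cinner f g)"

definition norm_L2 :: "'a L2 \<Rightarrow> real" where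
  "norm_L2 f = sqrt (inner f f)"

definition dist_L2 :: "'a L2 \<Rightarrow> 'a L2 \<Rightarrow> real" where
  "dist_L2 f g = norm (f - g)"

definition sgn_L2 :: "'a L2 \<Rightarrow> 'a L2" where
  "sgn_L2 f = inverse (norm f) *\<^sub>R f"

definition uniformity_L2 :: "('a L2 \<times> 'a L2) filter" where
  "uniformity_L2 = (INF e\<in>{0<..}. principal {(f, g). dist f g < e})"

definition open_L2 :: "'a L2 set \<Rightarrow> bool" where
  "open_L2 U \<longleftrightarrow> (\<forall>f\<in>U. eventually (\<lambda>(f', g). f' = f \<longrightarrow> g \<in> U) uniformity)"

instance
proof
  fix f g h :: "'a L2" and b c :: complex and r s :: real
  show "f + g + h = f + (g + h)"
    by transfer (auto simp: L2_rel_def square_integrable_add add.assoc)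
  show "f + g = g + f"
    by transfer (auto simp: L2_rel_def square_integrable_add add.commute)
  show "0 + f = f"
    by transfer (auto simp: L2_rel_def)
  show "- f + f = 0"
    unfolding uminus_L2_def
    by transfer (auto simp: L2_rel_def square_integrable_add square_integrable_zero
        square_integrable_scale intro!: square_integrable_add)
  show "f - g = f + - g"
    by (simp add: minus_L2_def)
  show C1: "c *\<^sub>C (f + g) = c *\<^sub>C f + c *\<^sub>C g" for c and f g :: "'a L2"
    by transfer (auto simp: L2_rel_def square_integrable_add square_integrable_scale algebra_simps
        intro!: square_integrable_add)
  show C2: "(b + c) *\<^sub>C f = b *\<^sub>C f + c *\<^sub>C f" for b c
    by transfer (auto simp: L2_rel_def square_integrable_scale algebra_simps
        intro!: square_integrable_add)
  show C3: "b *\<^sub>C c *\<^sub>C f = (b * c) *\<^sub>C f" for b c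
    by transfer (auto simp: L2_rel_def square_integrable_scale mult.assoc)
  show "complex_of_real r *\<^sub>C f = r *\<^sub>R f"
    by (simp add: scaleR_L2_def)
  show "r *\<^sub>R (f + g) = r *\<^sub>R f + r *\<^sub>R g"
    by (simp add: scaleR_L2_def C1)
  show "(r + s) *\<^sub>R f = r *\<^sub>R f + s *\<^sub>R f"
    by (simp add: scaleR_L2_def C2)
  show "r *\<^sub>R s *\<^sub>R f = (r * s) *\<^sub>R f"
    by (simp add: scaleR_L2_def C3)
  show "1 *\<^sub>R f = f"
    unfolding scaleR_L2_def by transfer (auto simp: L2_rel_def)
  show "sgn f = inverse (norm f) *\<^sub>R f"
    by (simp add: sgn_L2_def)
  show "dist f g = norm (f - g)"
    by (simp add: dist_L2_def)
  show "uniformity = (INF e\<in>{0<..}. principal {(x, y :: 'a L2). dist x y < e})"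
    by (simp add: uniformity_L2_def)
  show "open U \<longleftrightarrow> (\<forall>x\<in>U. eventually (\<lambda>(x', y). x' = x \<longrightarrow> y \<in> U) uniformity)"
    for U :: "'a L2 set"
    by (simp add: open_L2_def)
  show cc: "cinner f g = cnj (cinner g f)" for f g :: "'a L2"
  proof transfer
    fix f g :: "'a \<Rightarrow> complex"
    have "(\<integral>x. cnj (cnj (g x) * f x) \<partial>lborel) = cnj (\<integral>x. cnj (g x) * f x \<partial>lborel)"
      by (rule Bochner_Integration.integral_cnj)
    then show "(\<integral>x. cnj (f x) * g x \<partial>lborel) = cnj (\<integral>x. cnj (g x) * f x \<partial>lborel)"
      by (simp add: mult.commute)
  qed
  show ca: "cinner f (g + h) = cinner f g + cinner f h" for f g h :: "'a L2"
  proof transfer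
    fix f g h :: "'a \<Rightarrow> complex"
    assume "L2_rel f f" "L2_rel g g" "L2_rel h h"
    then have "integrable lborel (\<lambda>x. cnj (f x) * g x)" "integrable lborel (\<lambda>x. cnj (f x) * h x)"
      by (auto simp: L2_rel_def intro!: integrable_cnj_mult)
    then show "(\<integral>x. cnj (f x) * (g x + h x) \<partial>lborel) =
        (\<integral>x. cnj (f x) * g x \<partial>lborel) + (\<integral>x. cnj (f x) * h x \<partial>lborel)"
      by (simp add: distrib_left)
  qed
  show cs: "cinner f (c *\<^sub>C g) = c * cinner f g" for c and f g :: "'a L2"
    by transfer (simp add: mult.left_commute)
  show "Re (cinner f g) = inner f g"
    by (simp add: inner_L2_def)
  show ic: "inner f g = inner g f" for f g :: "'a L2"
    unfolding inner_L2_def by (subst cc) simp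
  have "inner h (f + g) = inner h f + inner h g"
    by (simp add: inner_L2_def ca)
  then show "inner (f + g) h = inner f h + inner g h"
    by (simp only: ic[of _ h])
  have "inner g (r *\<^sub>R f) = r * inner g f"
    by (simp add: inner_L2_def scaleR_L2_def cs)
  then show "inner (r *\<^sub>R f) g = r * inner f g"
    by (simp only: ic[of _ g])
  have cmod_sq: "cnj z * z = complex_of_real ((cmod z)\<^sup>2)" for z
    by (metis complex_norm_square mult.commute of_real_power)
  have nonneg_iff: "0 \<le> inner f f \<and> (inner f f = 0 \<longleftrightarrow> f = 0)"
    unfolding inner_L2_def
  proof transfer
    fix f :: "'a \<Rightarrow> complex"
    assume "L2_rel f f"
    then have f: "f \<in> square_integrable"
      by (simp add: L2_rel_def)
    have eq: "Re (\<integral>x. cnj (f x) * f x \<partial>lborel) = (\<integral>x. (cmod (f x))\<^sup>2 \<partial>lborel)"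
      unfolding cmod_sq by (simp only: integral_complex_of_real Re_complex_of_real)
    have "(\<integral>x. (cmod (f x))\<^sup>2 \<partial>lborel) = 0 \<longleftrightarrow> (AE x in lborel. (cmod (f x))\<^sup>2 = 0)"
      using f by (intro integral_nonneg_eq_0_iff_AE) (auto simp: square_integrable_def)
    also have "\<dots> \<longleftrightarrow> L2_rel f (\<lambda>x. 0)"
      using f square_integrable_zero by (auto simp: L2_rel_def)
    finally show "0 \<le> Re (\<integral>x. cnj (f x) * f x \<partial>lborel) \<and>
        (Re (\<integral>x. cnj (f x) * f x \<partial>lborel) = 0 \<longleftrightarrow> L2_rel f (\<lambda>x. 0))"
      unfolding eq by simp
  qed
  then show "0 \<le> inner f f" "inner f f = 0 \<longleftrightarrow> f = 0"
    by auto
  show "norm f = sqrt (inner f f)"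
    by (simp add: norm_L2_def)
qed

end


section \<open>The Cauchy process and the Feynman-Kac operators\<close>

definition cadlag :: "(real \<Rightarrow> 'a::euclidean_space) \<Rightarrow> bool" where
  "cadlag y \<longleftrightarrow>
     (\<forall>t\<ge>0. (y \<longlongrightarrow> y t) (at_right t)) \<and> (\<forall>t>0. \<exists>l. (y \<longlongrightarrow> l) (at_left t))"

definition levy_process :: "'w measure \<Rightarrow> (real \<Rightarrow> 'w \<Rightarrow> 'a::euclidean_space) \<Rightarrow> bool" where
  "levy_process M X \<longleftrightarrow>
     prob_space M \<and> (\<forall>t\<ge>0. X t \<in> borel_measurable M) \<and>
     (AE \<omega> in M. X 0 \<omega> = 0) \<and>
     (\<forall>n (t :: nat \<Rightarrow> real). 0 \<le> t 0 \<longrightarrow> (\<forall>i<n. t i < t (Suc i)) \<longrightarrow>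
        prob_space.indep_vars M (\<lambda>_. borel) (\<lambda>i \<omega>. X (t (Suc i)) \<omega> - X (t i) \<omega>) {..<n}) \<and>
     (\<forall>s\<ge>0. \<forall>h\<ge>0. distr M borel (\<lambda>\<omega>. X (s + h) \<omega> - X s \<omega>) =
        distr M borel (\<lambda>\<omega>. X h \<omega> - X 0 \<omega>)) \<and>
     (\<forall>\<omega>\<in>space M. cadlag (\<lambda>t. X t \<omega>))"

text \<open>The process under the measure for the starting point \<open>0\<close>; under the measure for the starting
  point \<open>x\<close> the process has the law of \<open>x + X\<close> under the former.\<close>

definition cauchy_process :: "'w measure \<Rightarrow> (real \<Rightarrow> 'w \<Rightarrow> 'a::euclidean_space) \<Rightarrow> bool" where
  "cauchy_process M X \<longleftrightarrow>
     levy_process M X \<and>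
     (\<forall>t\<ge>0. \<forall>\<xi>. (\<integral>\<omega>. iexp (\<xi> \<bullet> X t \<omega>) \<partial>M) = complex_of_real (exp (- t * norm \<xi>)))"

definition locally_integrable :: "('a::euclidean_space \<Rightarrow> real) set" where
  "locally_integrable =
     {V. V \<in> borel_measurable borel \<and> (\<forall>C. compact C \<longrightarrow> set_integrable lborel C V)}"

text \<open>For a nonnegative potential, a path along which \<open>V\<close> is not integrable has
  \<open>\<integral>\<^sub>0\<^sup>t V(y(s)) ds = \<infinity>\<close>, so its weight \<open>exp (- \<infinity>)\<close> is \<open>0\<close>; the
  Bochner integral alone would give the weight \<open>1\<close>.\<close>

definition feynman_kac_weight :: "('a::euclidean_space \<Rightarrow> real) \<Rightarrow> real \<Rightarrow> (real \<Rightarrow> 'a) \<Rightarrow> real" where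
  "feynman_kac_weight V t y =
     (if set_integrable lborel {0..t} (\<lambda>s. V (y s))
      then exp (- (LINT s:{0..t}|lborel. V (y s))) else 0)"

definition feynman_kac_integrand ::
    "(real \<Rightarrow> 'w \<Rightarrow> 'a::euclidean_space) \<Rightarrow> ('a \<Rightarrow> real) \<Rightarrow> real \<Rightarrow> ('a \<Rightarrow> complex) \<Rightarrow>
     'a \<Rightarrow> 'w \<Rightarrow> complex" where
  "feynman_kac_integrand X V t f x \<omega> =
     complex_of_real (feynman_kac_weight V t (\<lambda>s. x + X s \<omega>)) * f (x + X t \<omega>)"

text \<open>\<open>T\<close> is the family of operators induced on \<open>L2\<close> by
  \<open>f \<mapsto> (x \<mapsto> E\<^sup>x[exp (- \<integral>\<^sub>0\<^sup>t V(X\<^sub>s) ds) f(X\<^sub>t)])\<close>.  It is part of this that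
  the expectations exist, give a square integrable function of \<open>x\<close>, and respect equality almost
  everywhere of \<open>f\<close> (the last because \<open>T\<close> acts on classes).\<close>

definition feynman_kac_operators ::
    "'w measure \<Rightarrow> (real \<Rightarrow> 'w \<Rightarrow> 'a::euclidean_space) \<Rightarrow> ('a \<Rightarrow> real) \<Rightarrow>
     (real \<Rightarrow> 'a L2 \<Rightarrow> 'a L2) \<Rightarrow> bool" where
  "feynman_kac_operators M X V T \<longleftrightarrow>
     (\<forall>t\<ge>0. \<forall>f\<in>square_integrable.
        (AE x in lborel. integrable M (feynman_kac_integrand X V t f x)) \<and>
        (\<lambda>x. \<integral>\<omega>. feynman_kac_integrand X V t f x \<omega> \<partial>M) \<in> square_integrable \<and>
        T t (L2_class f) = L2_class (\<lambda>x. \<integral>\<omega>. feynman_kac_integrand X V t f x \<omega> \<partial>M))"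

end

theory Submission
  imports Defs
begin

text \<open>The analytic half is the spectral theorem for a symmetric contraction semigroup \<open>T\<close>.  For each
  vector \<open>f\<close> the function \<open>t \<mapsto> \<langle>f, T\<^sub>t f\<rangle>\<close> is completely monotone in the sense of
  finite differences, so by Bernstein's theorem it is the Laplace transform of a measure \<open>\<nu> f\<close> on the
  half line.  The projection of a half line is a strong limit of polynomials in \<open>T\<^sub>1\<close>, and the Borel sets
  possessing a projection form a Dynkin system.  The generator is the limit of the difference quotients
  \<open>n (f - T\<^bsub>1/n\<^esub> f)\<close> on the vectors with \<open>\<integral>x\<^sup>2 d\<nu> f < \<infinity>\<close>.

  The probabilistic half is the semigroup property and the symmetry of the Feynman-Kac operators.  For
  bounded continuous \<open>V\<close> the weight is a limit of Riemann products, so by independence of the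
  increments the operators are strong limits of \<open>(P\<^sub>h e\<^sup>-\<^sup>h\<^sup>V)\<^sup>n\<close> and also of the
  palindromes \<open>(P\<^sub>h e\<^sup>-\<^sup>h\<^sup>V)\<^sup>n P\<^sub>h\<close>, with \<open>P\<^sub>h\<close> symmetric because \<open>X\<^sub>h\<close> and \<open>- X\<^sub>h\<close> have
  the same characteristic function.  General \<open>V\<close> follows by a.e. approximation and truncation.
  Local integrability enters only in the strong continuity at \<open>0\<close>: it makes \<open>\<integral>\<^sub>0\<^sup>t V(x + X\<^sub>s) ds\<close>
  finite for small \<open>t\<close>, for almost every \<open>x\<close>.\<close>

section \<open>Completely monotone functions\<close>

text \<open>The measures \<open>\<nu> f\<close> come one vector at a time, and nothing says at first
  how \<open>\<nu> (f + g)\<close> is related to \<open>\<nu> f\<close> and \<open>\<nu> g\<close>.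
  So the projections are not assembled from the measures by polarization and a representation
  theorem: they are limits of operators that are linear and symmetric from the start, with
  \<open>inner f (P f) = measure (\<nu> f) B\<close> as the link. For the same reason membership in
  the domain of the generator is tested by boundedness of the difference quotients, a condition that
  survives sums.

  The semigroup law is not argued by a Markov property of whole paths. Only finitely many increments
  enter at a time, and strong limits of contractions carry the identities over. With P the shift and
  M the multiplication, (P M)^n has the adjoint (M P)^n, a different operator; hence the
  palindromes.

  For unbounded V the integral along a path can be infinite. The weight 0 is then the continuous
  extension of the exponential, which lets truncations of V converge. Exceptional null sets in space
  are harmless because, for almost every starting point, the path spends no time in them.\<close>

fun fdiff :: "(nat \<Rightarrow> real) \<Rightarrow> nat \<Rightarrow> nat \<Rightarrow> real" where
  "fdiff a 0 k = a k"
| "fdiff a (Suc r) k = fdiff a r k - fdiff a r (Suc k)"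

text \<open>If \<open>a i\<close> is the moment \<integral> u^i of a measure on [0,1], then
  \<open>fdiff a r k\<close> is the integral of u^k (1 - u)^r, and the identity is the binomial
  expansion of u^m (u + (1 - u))^n. For arbitrary \<open>a\<close> it follows from Pascal's rule and
  \<open>fdiff a r k = fdiff a r (Suc k) + fdiff a (Suc r) k\<close>.\<close>

lemma sum_choose_fdiff: "(\<Sum>j\<le>n. real (n choose j) * fdiff a (n - j) (m + j)) = a m"
proof (induction n arbitrary: m)
  case 0
  show ?case by simp
next
  case (Suc n)
  have "(\<Sum>j\<le>Suc n. real (Suc n choose j) * fdiff a (Suc n - j) (m + j))
      = fdiff a (Suc n) m + (\<Sum>j\<le>n. real (Suc n choose Suc j) * fdiff a (n - j) (m + Suc j))"
    by (subst sum.atMost_Suc_shift) simp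
  also have "(\<Sum>j\<le>n. real (Suc n choose Suc j) * fdiff a (n - j) (m + Suc j))
      = (\<Sum>j\<le>n. real (n choose j) * fdiff a (n - j) (Suc m + j)) +
        (\<Sum>j\<le>n. real (n choose Suc j) * fdiff a (n - j) (m + Suc j))"
    by (simp add: sum.distrib algebra_simps)
  also have "(\<Sum>j\<le>n. real (n choose Suc j) * fdiff a (n - j) (m + Suc j)) =
      (\<Sum>j\<le>n. real (n choose j) * fdiff a (Suc n - j) (m + j)) - fdiff a (Suc n) m"
  proof -
    have "(\<Sum>j\<le>Suc n. real (n choose j) * fdiff a (Suc n - j) (m + j))
       = fdiff a (Suc n) m + (\<Sum>j\<le>n. real (n choose Suc j) * fdiff a (n - j) (m + Suc j))"
      by (subst sum.atMost_Suc_shift) simp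
    moreover have "(\<Sum>j\<le>Suc n. real (n choose j) * fdiff a (Suc n - j) (m + j))
       = (\<Sum>j\<le>n. real (n choose j) * fdiff a (Suc n - j) (m + j))"
      by simp
    ultimately show ?thesis by linarith
  qed
  finally have "(\<Sum>j\<le>Suc n. real (Suc n choose j) * fdiff a (Suc n - j) (m + j))
    = (\<Sum>j\<le>n. real (n choose j) * (fdiff a (n - j) (Suc m + j) + fdiff a (Suc n - j) (m + j)))"
    by (simp add: sum.distrib algebra_simps)
  also have "\<dots> = (\<Sum>j\<le>n. real (n choose j) * fdiff a (n - j) (m + j))"
    by (intro sum.cong) (auto simp: Suc_diff_le)
  finally show ?case using Suc.IH by simp
qed

text \<open>Each factor of the product lowers both entries of the binomial coefficient by one. For k
  < m the factor with i = k is zero. With this, factorial moments of Hausdorff's weights can be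
  computed exactly.\<close>

lemma choose_falling_ratio:
  assumes "m \<le> n" "k \<le> n"
  shows "real (n choose k) * (\<Prod>i<m. real (k - i) / real (n - i))
       = (if m \<le> k then real ((n - m) choose (k - m)) else 0)"
  using assms
proof (induction m arbitrary: n k)
  case 0
  then show ?case by simp
next
  case (Suc m)
  show ?case
  proof (cases k)
    case 0
    then show ?thesis by (simp add: prod.lessThan_Suc_shift)
  next
    case (Suc k')
    obtain n' where n: "n = Suc n'" using Suc.prems by (cases n) auto
    have "real (n choose k) * (real k / real n) = real (n' choose k')"
      using Suc_times_binomial_eq[of n' k'] unfolding n Suc
      by (simp add: field_simps flip: of_nat_mult)
    then have "real (n choose k) * (\<Prod>i<Suc m. real (k - i) / real (n - i))
      = real (n' choose k') * (\<Prod>i<m. real (k' - i) / real (n' - i))"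
      unfolding prod.lessThan_Suc_shift
      by (simp only: n Suc mult.assoc[symmetric] diff_zero diff_Suc_Suc)
    then show ?thesis
      using Suc.IH[of n' k'] Suc.prems by (simp add: n Suc)
  qed
qed

text \<open>All factors lie in [0,1], so the products differ by at most the sum of the differences
  of the factors, and each of the m differences is at most m/n.\<close>

lemma falling_ratio_approx:
  assumes "m \<le> n" "k \<le> n" "0 < n"
  shows "\<bar>(\<Prod>i<m. real (k - i) / real (n - i)) - (real k / real n) ^ m\<bar> \<le> (real m)\<^sup>2 / real n"
proof -
  have "norm ((\<Prod>i<m. real (k - i) / real (n - i)) - (\<Prod>i<m. real k / real n))
     \<le> (\<Sum>i<m. norm (real (k - i) / real (n - i) - real k / real n))"
    using assms by (intro norm_prod_diff) (auto simp: divide_simps)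
  also have "\<dots> \<le> (\<Sum>i<m. real m / real n)"
  proof (intro sum_mono)
    fix i assume i: "i \<in> {..<m}"
    have "norm (real (k - i) / real (n - i) - real k / real n) \<le> real i / real n"
    proof (cases "i \<le> k")
      case True
      have "real k / real n - real (k - i) / real (n - i) = real i * real (n - k) / (real n * real (n - i))"
        using True i assms by (simp add: field_simps of_nat_diff)
      moreover have "real (n - k) \<le> real (n - i)" using True by simp
      moreover have "real (n - i) > 0" using i assms by simp
      ultimately have "0 \<le> real k / real n - real (k - i) / real (n - i)"
        "real k / real n - real (k - i) / real (n - i) \<le> real i / real n"
        using assms by (auto simp: divide_simps mult_left_mono)
      then show ?thesis by simp
    next
      case False
      then show ?thesis using assms by (simp add: divide_right_mono)
    qed
    also have "\<dots> \<le> real m / real n" using i by (simp add: divide_right_mono)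
    finally show "norm (real (k - i) / real (n - i) - real k / real n) \<le> real m / real n" .
  qed
  finally show ?thesis by (simp add: power2_eq_square)
qed

text \<open>Hausdorff's approximating measure puts the mass
  \<open>(n choose k) * fdiff a (n - k) k\<close> at the point k/n. Its falling factorial moments
  are exactly \<open>a m\<close>; passing to ordinary moments costs the error m^2/n. The total mass
  is \<open>a 0\<close>.\<close>

lemma hausdorff_discrete:
  assumes a0: "a 0 = 1" and pos: "\<And>r k. 0 \<le> fdiff a r k" and n: "0 < n"
  obtains p :: "nat pmf" where "set_pmf p \<subseteq> {..n}"
    "\<And>m. m \<le> n \<Longrightarrow> \<bar>measure_pmf.expectation p (\<lambda>k. (real k / real n) ^ m) - a m\<bar> \<le> (real m)\<^sup>2 / real n"
proof -
  define w where "w k = (if k \<le> n then real (n choose k) * fdiff a (n - k) k else 0)" for k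
  have w0: "0 \<le> w k" for k using pos by (simp add: w_def)
  have sw: "(\<Sum>k\<le>n. w k) = 1"
    using sum_choose_fdiff[of n a 0] a0 by (simp add: w_def)
  have "(\<integral>\<^sup>+ x. ennreal (w x) \<partial>count_space UNIV) = (\<Sum>x\<le>n. ennreal (w x))"
    by (rule nn_integral_count_space') (auto simp: w_def)
  also have "\<dots> = 1" using sw w0 by (subst sum_ennreal) auto
  finally have nn: "(\<integral>\<^sup>+ x. ennreal (w x) \<partial>count_space UNIV) = 1" .
  define p where "p = embed_pmf w"
  have pp: "pmf p k = w k" for k unfolding p_def by (rule pmf_embed_pmf[OF w0 nn])
  have sp: "set_pmf p \<subseteq> {..n}" by (auto simp: set_pmf_iff pp w_def split: if_splits)
  have E: "measure_pmf.expectation p f = (\<Sum>k\<le>n. w k * f k)" for f :: "nat \<Rightarrow> real"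
    using sp by (subst integral_measure_pmf[of "{..n}"]) (auto simp: pp)
  have am: "(\<Sum>k\<le>n. w k * (\<Prod>i<m. real (k - i) / real (n - i))) = a m" if m: "m \<le> n" for m
  proof -
    have "(\<Sum>k\<le>n. w k * (\<Prod>i<m. real (k - i) / real (n - i)))
       = (\<Sum>k\<le>n. (if m \<le> k then real ((n - m) choose (k - m)) else 0) * fdiff a (n - k) k)"
      by (intro sum.cong refl) (simp add: w_def choose_falling_ratio[OF m, symmetric])
    also have "\<dots> = (\<Sum>k\<in>{m..n}. real ((n - m) choose (k - m)) * fdiff a (n - k) k)"
      by (rule sum.mono_neutral_cong_right) auto
    also have "\<dots> = (\<Sum>j\<le>n - m. real ((n - m) choose j) * fdiff a ((n - m) - j) (m + j))"
      using m by (intro sum.reindex_bij_witness[of _ "\<lambda>j. m + j" "\<lambda>k. k - m"]) auto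
    also have "\<dots> = a m" by (rule sum_choose_fdiff)
    finally show ?thesis .
  qed
  have "\<bar>measure_pmf.expectation p (\<lambda>k. (real k / real n) ^ m) - a m\<bar> \<le> (real m)\<^sup>2 / real n"
    if m: "m \<le> n" for m
  proof -
    have "measure_pmf.expectation p (\<lambda>k. (real k / real n) ^ m) - a m
       = (\<Sum>k\<le>n. w k * ((real k / real n) ^ m - (\<Prod>i<m. real (k - i) / real (n - i))))"
      unfolding E am[OF m, symmetric] by (simp add: sum_subtractf algebra_simps)
    also have "\<bar>\<dots>\<bar> \<le> (\<Sum>k\<le>n. \<bar>w k * ((real k / real n) ^ m - (\<Prod>i<m. real (k - i) / real (n - i)))\<bar>)"
      by (rule sum_abs)
    also have "\<dots> \<le> (\<Sum>k\<le>n. w k * ((real m)\<^sup>2 / real n))"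
    proof (rule sum_mono)
      fix k assume "k \<in> {..n}"
      then have "\<bar>(real k / real n) ^ m - (\<Prod>i<m. real (k - i) / real (n - i))\<bar> \<le> (real m)\<^sup>2 / real n"
        using falling_ratio_approx[OF m _ n, of k] by (subst abs_minus_commute) simp
      then show "\<bar>w k * ((real k / real n) ^ m - (\<Prod>i<m. real (k - i) / real (n - i)))\<bar>
          \<le> w k * ((real m)\<^sup>2 / real n)"
        unfolding abs_mult abs_of_nonneg[OF w0] by (rule mult_left_mono[OF _ w0])
    qed
    also have "\<dots> = (real m)\<^sup>2 / real n" by (simp only: sw mult_1 flip: sum_distrib_right)
    finally show ?thesis .
  qed
  with sp show ?thesis by (rule that)
qed

section \<open>From moments to Laplace transforms: Bernstein's theorem\<close>

lemma dyadic_powr: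
  fixes y :: real
  assumes "0 \<le> y" "0 < j" "M \<le> N"
  shows "(y ^ (2 ^ N)) powr (real j / 2 ^ M) = y ^ (j * 2 ^ (N - M))"
proof (cases "y = 0")
  case True
  then show ?thesis using assms by (simp add: power_0_left)
next
  case False
  then have y: "0 < y" using assms by simp
  have "2 ^ N * (real j / 2 ^ M) = real (j * 2 ^ (N - M))"
  proof -
    obtain d where "N = M + d" using assms(3) le_Suc_ex by blast
    then show ?thesis by (simp add: power_add)
  qed
  moreover have "y ^ (2 ^ N) = y powr (2 ^ N)"
    using y powr_realpow[of y "2 ^ N"] by simp
  ultimately show ?thesis
    using y by (simp only: powr_powr powr_realpow)
qed

lemma isCont_clamp_powr:
  fixes x :: real
  assumes "0 < t"
  shows "isCont (\<lambda>x. max 0 (min 1 x) powr t) x"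
proof -
  have "continuous_on UNIV (\<lambda>x::real. max 0 (min 1 x) powr t)"
    using assms by (intro continuous_on_powr' continuous_intros) auto
  then show ?thesis by (simp add: continuous_on_eq_continuous_at)
qed

lemma dyadic_approx:
  fixes t :: real
  assumes "0 < t"
  obtains j :: "nat \<Rightarrow> nat" where "\<And>n. 0 < j n" "(\<lambda>n. real (j n) / 2 ^ n) \<longlonglongrightarrow> t"
proof -
  \<comment> \<open>Adding 1 keeps the numerators positive, as required for the dyadic times at
    which the moments will be known.\<close>
  define j where "j n = nat \<lfloor>t * 2 ^ n\<rfloor> + 1" for n :: nat
  have j: "real (j n) = of_int \<lfloor>t * 2 ^ n\<rfloor> + 1" for n
    using assms by (simp add: j_def)
  have "(\<lambda>n. real (j n) / 2 ^ n) \<longlonglongrightarrow> t"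
  proof (rule tendsto_sandwich)
    show "\<forall>\<^sub>F n in sequentially. t \<le> real (j n) / 2 ^ n"
      unfolding j by (intro always_eventually allI) (simp add: pos_le_divide_eq)
    have "real (j n) / 2 ^ n \<le> t + (1/2) ^ n" for n
    proof -
      have "real (j n) \<le> t * 2 ^ n + 1" unfolding j by simp
      then have "real (j n) / 2 ^ n \<le> (t * 2 ^ n + 1) / 2 ^ n" by (simp add: divide_right_mono)
      then show ?thesis by (simp add: field_simps)
    qed
    then show "\<forall>\<^sub>F n in sequentially. real (j n) / 2 ^ n \<le> t + (1/2) ^ n" by simp
    have "(\<lambda>n. t + (1/2) ^ n) \<longlonglongrightarrow> t + 0"
      by (intro tendsto_intros LIMSEQ_realpow_zero) auto
    then show "(\<lambda>n. t + (1/2) ^ n) \<longlonglongrightarrow> t" by simp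
  qed simp
  then show ?thesis by (intro that[of j]) (simp_all add: j_def)
qed

text \<open>Under u = exp (- x) the Laplace transform at t becomes the moment of order t of a
  measure on [0,1]. The Hausdorff approximations live on [0,1] and are therefore tight; a weak limit
  has the right moments at dyadic t > 0, and continuity of \<open>\<phi>\<close> gives them at all t
  > 0. Continuity at 0 excludes an atom at u = 0, which would be mass at x = \<infinity>.\<close>

theorem bernstein_representation:
  fixes \<phi> :: "real \<Rightarrow> real"
  assumes \<phi>0: "\<phi> 0 = 1" and cont: "continuous_on {0..} \<phi>"
    and cm: "\<And>h r k. 0 < h \<Longrightarrow> 0 \<le> fdiff (\<lambda>i. \<phi> (real i * h)) r k"
  obtains \<nu> where "real_distribution \<nu>" "AE x in \<nu>. 0 \<le> x"
    "\<And>t. 0 \<le> t \<Longrightarrow> (\<integral>x. exp (- t * x) \<partial>\<nu>) = \<phi> t"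
proof -
  \<comment> \<open>Clamping to [0,1] turns fractional powers into bounded continuous functions on
    the whole line, as weak convergence requires.\<close>
  define c :: "real \<Rightarrow> real" where "c x = max 0 (min 1 x)" for x
  have c01: "0 \<le> c x" "c x \<le> 1" for x by (auto simp: c_def)
  have [measurable]: "c \<in> borel_measurable borel" unfolding c_def by measurable
  have "\<forall>N. \<exists>p :: nat pmf. set_pmf p \<subseteq> {..8 ^ N} \<and> (\<forall>m\<le>8 ^ N.
      \<bar>measure_pmf.expectation p (\<lambda>k. (real k / real (8 ^ N)) ^ m) - \<phi> (real m * (1 / 2 ^ N))\<bar>
      \<le> (real m)\<^sup>2 / real (8 ^ N))"
  proof
    fix N :: nat
    show "\<exists>p :: nat pmf. set_pmf p \<subseteq> {..8 ^ N} \<and> (\<forall>m\<le>8 ^ N.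
      \<bar>measure_pmf.expectation p (\<lambda>k. (real k / real (8 ^ N)) ^ m) - \<phi> (real m * (1 / 2 ^ N))\<bar>
      \<le> (real m)\<^sup>2 / real (8 ^ N))"
      by (rule hausdorff_discrete[of "\<lambda>i. \<phi> (real i * (1 / 2 ^ N))" "8 ^ N"])
        (use \<phi>0 cm[of "1 / 2 ^ N"] in auto)
  qed
  then obtain p :: "nat \<Rightarrow> nat pmf" where sp: "\<And>N. set_pmf (p N) \<subseteq> {..8 ^ N}"
    and pm: "\<And>N m. m \<le> 8 ^ N \<Longrightarrow>
      \<bar>measure_pmf.expectation (p N) (\<lambda>k. (real k / real (8 ^ N)) ^ m) - \<phi> (real m * (1 / 2 ^ N))\<bar>
      \<le> (real m)\<^sup>2 / real (8 ^ N)"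
    by metis
  \<comment> \<open>The power \<open>2\<^sup>N\<close> turns the time step \<open>2\<^sup>-\<^sup>N\<close> into \<open>1\<close>, so that one limit measure serves all dyadic
    times; the grid of mesh \<open>8\<^sup>-\<^sup>N\<close> is fine enough for moments of order \<open>j 2\<^sup>N\<close>, since \<open>(j 2\<^sup>N)\<^sup>2 / 8\<^sup>N\<close> vanishes.\<close>
  define e where "e N k = (real k / real (8 ^ N)) ^ (2 ^ N)" for N k :: nat
  define \<mu> where "\<mu> N = distr (measure_pmf (p N)) borel (e N)" for N
  have rd: "real_distribution (\<mu> N)" for N
    unfolding \<mu>_def by (rule prob_space.real_distribution_distr[OF measure_pmf.prob_space_axioms]) simp
  have e01: "0 \<le> e N k \<and> e N k \<le> 1" if "k \<in> set_pmf (p N)" for N k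
    using sp[of N] that by (auto simp: e_def intro!: power_le_one)
  have ce: "AE k in measure_pmf (p N). c (e N k) = e N k" for N
    using e01[of _ N] by (intro AE_pmfI) (auto simp: c_def)
  have "tight \<mu>"
    unfolding tight_def
  proof (intro conjI allI impI rd)
    fix \<epsilon> :: real assume "0 < \<epsilon>"
    show "\<exists>a b. a < b \<and> (\<forall>n. 1 - \<epsilon> < measure (\<mu> n) {a<..b})"
    proof (rule exI[of _ "-1"], rule exI[of _ 1], intro conjI allI)
      fix N
      interpret real_distribution "\<mu> N" by (rule rd)
      have "AE x in \<mu> N. x \<in> {-1<..1}"
        unfolding \<mu>_def using e01[of _ N] by (subst AE_distr_iff) (auto intro!: AE_pmfI simp: order_less_le_trans[of "-1" 0])
      then have "measure (\<mu> N) {-1<..1} = 1"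
        by (intro prob_eq_1[THEN iffD2]) auto
      then show "1 - \<epsilon> < measure (\<mu> N) {-1<..1}" using \<open>0 < \<epsilon>\<close> by simp
    qed simp
  qed
  from tight_imp_convergent_subsubsequence[OF this strict_mono_id]
  obtain r m where r: "strict_mono r" and m: "real_distribution m" and w: "weak_conv_m (\<mu> \<circ> r) m"
    by auto
  interpret m: real_distribution m by (rule m)
  have lim: "(\<lambda>N. \<integral>x. f x \<partial>\<mu> (r N)) \<longlonglongrightarrow> (\<integral>x. f x \<partial>m)"
    if "\<And>x. isCont f x" "\<And>x. norm (f x) \<le> B" for f :: "real \<Rightarrow> real" and B
    using weak_conv_imp_integral_bdd_continuous_conv[of "\<mu> \<circ> r" m f B] rd m w that by (simp add: comp_def)
  \<comment> \<open>That the limit is carried by [0,1] is expressed by the vanishing integral of a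
    bounded continuous function whose zero set is [0,1], and this passes to the limit.\<close>
  have supp: "AE x in m. c x = x"
  proof -
    have eq0: "(\<integral>x. min 1 \<bar>x - c x\<bar> \<partial>\<mu> N) = 0" for N
    proof -
      have "(\<integral>x. min 1 \<bar>x - c x\<bar> \<partial>\<mu> N) = (\<integral>k. min 1 \<bar>e N k - c (e N k)\<bar> \<partial>measure_pmf (p N))"
        unfolding \<mu>_def by (rule integral_distr) auto
      also have "\<dots> = (\<integral>k. 0 \<partial>measure_pmf (p N))"
      proof (rule integral_cong_AE)
        show "AE k in measure_pmf (p N). min 1 \<bar>e N k - c (e N k)\<bar> = 0"
          using ce[of N] by eventually_elim simp
      qed auto
      finally show ?thesis by simp
    qed
    have "(\<lambda>N. \<integral>x. min 1 \<bar>x - c x\<bar> \<partial>\<mu> (r N)) \<longlonglongrightarrow> (\<integral>x. min 1 \<bar>x - c x\<bar> \<partial>m)"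
      by (rule lim[of _ 1]) (auto simp: c_def intro!: continuous_intros)
    then have "(\<integral>x. min 1 \<bar>x - c x\<bar> \<partial>m) = 0"
      unfolding eq0 by (simp add: LIMSEQ_const_iff)
    moreover have "integrable m (\<lambda>x. min 1 \<bar>x - c x\<bar>)"
      by (rule m.integrable_const_bound[of _ 1]) auto
    ultimately have "AE x in m. min 1 \<bar>x - c x\<bar> = 0"
      by (subst (asm) integral_nonneg_eq_0_iff_AE) auto
    then show ?thesis by eventually_elim (auto simp: min_def split: if_splits)
  qed
  have dy: "(\<integral>x. c x powr (real j / 2 ^ M) \<partial>m) = \<phi> (real j / 2 ^ M)" if j: "0 < j" for j M :: nat
  proof (rule LIMSEQ_unique)
    let ?t = "real j / 2 ^ M"
    have t: "0 < ?t" using j by simp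
    show "(\<lambda>N. \<integral>x. c x powr ?t \<partial>\<mu> (r N)) \<longlonglongrightarrow> (\<integral>x. c x powr ?t \<partial>m)"
    proof (rule lim[of _ 1])
      show "isCont (\<lambda>x. c x powr ?t) x" for x unfolding c_def by (rule isCont_clamp_powr[OF t])
      show "norm (c x powr ?t) \<le> 1" for x using c01[of x] t by (simp add: powr_le1)
    qed
    have bd: "\<bar>(\<integral>x. c x powr ?t \<partial>\<mu> N) - \<phi> ?t\<bar> \<le> (real j)\<^sup>2 * (1/2) ^ N" if N: "M \<le> N" "j \<le> 2 ^ N" for N
    proof -
      have eq: "(\<integral>x. c x powr ?t \<partial>\<mu> N)
          = measure_pmf.expectation (p N) (\<lambda>k. (real k / real (8 ^ N)) ^ (j * 2 ^ (N - M)))"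
      proof -
        have "(\<integral>x. c x powr ?t \<partial>\<mu> N) = (\<integral>k. c (e N k) powr ?t \<partial>measure_pmf (p N))"
          unfolding \<mu>_def by (rule integral_distr) auto
        also have "\<dots> = (\<integral>k. (real k / real (8 ^ N)) ^ (j * 2 ^ (N - M)) \<partial>measure_pmf (p N))"
        proof (rule integral_cong_AE)
          show "AE k in measure_pmf (p N). c (e N k) powr ?t = (real k / real (8 ^ N)) ^ (j * 2 ^ (N - M))"
            using ce[of N]
          proof eventually_elim
            case (elim k)
            then show ?case
              using dyadic_powr[of "real k / real (8 ^ N)" j M N] j N by (simp add: e_def)
          qed
        qed auto
        finally show ?thesis .
      qed
      \<comment> \<open>The moment bound of the discrete measure covers only orders up to 8^N; for
        \<open>j \<le> 2 ^ N\<close> the order is at most 4^N.\<close>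
      have "j * 2 ^ (N - M) \<le> 2 ^ N * 2 ^ N"
        using N by (intro mult_mono power_increasing) auto
      also have "\<dots> \<le> (8::nat) ^ N"
        unfolding power_mult_distrib[symmetric] by (intro power_mono) auto
      finally have le: "j * 2 ^ (N - M) \<le> 8 ^ N" .
      have tt: "real (j * 2 ^ (N - M)) * (1 / 2 ^ N) = ?t"
      proof -
        obtain d where "N = M + d" using N(1) le_Suc_ex by blast
        then show ?thesis by (simp add: power_add)
      qed
      have "(real (j * 2 ^ (N - M)))\<^sup>2 / real (8 ^ N) \<le> (real j)\<^sup>2 * (2 ^ N)\<^sup>2 / real (8 ^ N)"
        using N by (auto intro!: divide_right_mono mult_left_mono power_mono power_increasing simp: power_mult_distrib)
      also have "\<dots> = (real j)\<^sup>2 * ((2 ^ N)\<^sup>2 / 8 ^ N)" by simp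
      also have "(2 ^ N)\<^sup>2 / 8 ^ N = (1/2 :: real) ^ N"
        by (simp add: power2_eq_square flip: power_mult_distrib power_divide)
      finally show ?thesis using pm[OF le] unfolding eq tt by linarith
    qed
    have "(\<lambda>N. \<integral>x. c x powr ?t \<partial>\<mu> N) \<longlonglongrightarrow> \<phi> ?t"
    proof (rule LIM_zero_cancel, rule Lim_null_comparison)
      have "\<forall>\<^sub>F N in sequentially. M \<le> N \<and> j \<le> 2 ^ N"
        unfolding eventually_sequentially
      proof (intro exI[of _ "M + j"] allI impI conjI)
        fix N assume "M + j \<le> N"
        then show "M \<le> N" by simp
        show "j \<le> 2 ^ N" using \<open>M + j \<le> N\<close> less_exp[of N] by linarith
      qed
      then show "\<forall>\<^sub>F N in sequentially. norm ((\<integral>x. c x powr ?t \<partial>\<mu> N) - \<phi> ?t) \<le> (real j)\<^sup>2 * (1/2) ^ N"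
        by eventually_elim (simp add: bd)
      have "(\<lambda>N. (real j)\<^sup>2 * (1/2) ^ N) \<longlonglongrightarrow> (real j)\<^sup>2 * 0"
        by (intro tendsto_intros LIMSEQ_realpow_zero) auto
      then show "(\<lambda>N. (real j)\<^sup>2 * (1/2) ^ N) \<longlonglongrightarrow> 0" by simp
    qed
    then show "(\<lambda>N. \<integral>x. c x powr ?t \<partial>\<mu> (r N)) \<longlonglongrightarrow> \<phi> ?t"
      using LIMSEQ_subseq_LIMSEQ[OF _ r] by (auto simp: comp_def)
  qed
  have all: "(\<integral>x. c x powr t \<partial>m) = \<phi> t" if t: "0 < t" for t
  proof -
    obtain j where j: "\<And>n. 0 < j n" "(\<lambda>n. real (j n) / 2 ^ n) \<longlonglongrightarrow> t"
      using dyadic_approx[OF t] by metis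
    have "(\<lambda>n. \<integral>x. c x powr (real (j n) / 2 ^ n) \<partial>m) \<longlonglongrightarrow> (\<integral>x. c x powr t \<partial>m)"
    proof (rule integral_dominated_convergence[where w = "\<lambda>_. 1"])
      show "AE x in m. (\<lambda>n. c x powr (real (j n) / 2 ^ n)) \<longlonglongrightarrow> c x powr t"
      proof (rule AE_I2)
        fix x
        show "(\<lambda>n. c x powr (real (j n) / 2 ^ n)) \<longlonglongrightarrow> c x powr t"
          by (cases "c x = 0") (auto intro!: tendsto_powr j tendsto_const)
      qed
      show "AE x in m. norm (c x powr (real (j n) / 2 ^ n)) \<le> 1" for n
        using c01 by (auto simp: powr_le1)
    qed auto
    moreover have "(\<lambda>n. \<phi> (real (j n) / 2 ^ n)) \<longlonglongrightarrow> \<phi> t"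
      using t by (intro continuous_on_tendsto_compose[OF cont j(2)]) auto
    ultimately show ?thesis
      unfolding dy[OF j(1)] by (rule LIMSEQ_unique)
  qed
  \<comment> \<open>As the exponent 2^(-n) tends to 0, the powers tend to the indicator of
    \<open>0 < c x\<close>, whose integral is therefore \<open>\<phi> 0\<close>, that is, the full
    mass.\<close>
  have pos: "AE x in m. 0 < c x"
  proof -
    have p2: "(\<lambda>n. 1 / 2 ^ n :: real) \<longlonglongrightarrow> 0"
      using LIMSEQ_realpow_zero[of "1/2::real"] by (simp add: power_divide)
    have "(\<lambda>n. \<integral>x. c x powr (1 / 2 ^ n) \<partial>m) \<longlonglongrightarrow> (\<integral>x. indicator {x. 0 < c x} x \<partial>m)"
    proof (rule integral_dominated_convergence[where w = "\<lambda>_. 1"])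
      show "AE x in m. (\<lambda>n. c x powr (1 / 2 ^ n)) \<longlonglongrightarrow> (indicator {x. 0 < c x} x :: real)"
      proof (rule AE_I2)
        fix x
        have "(\<lambda>n. c x powr (1 / 2 ^ n)) \<longlonglongrightarrow> c x powr 0" if "c x \<noteq> 0"
          using that by (intro tendsto_powr p2 tendsto_const)
        then show "(\<lambda>n. c x powr (1 / 2 ^ n)) \<longlonglongrightarrow> (indicator {x. 0 < c x} x :: real)"
          using c01[of x] by (cases "c x = 0") auto
      qed
      show "AE x in m. norm (c x powr (1 / 2 ^ n)) \<le> 1" for n
        using c01 by (auto simp: powr_le1)
    qed auto
    moreover have "(\<lambda>n. \<phi> (1 / 2 ^ n)) \<longlonglongrightarrow> \<phi> 0"
      by (intro continuous_on_tendsto_compose[OF cont p2]) auto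
    ultimately have "(\<integral>x. indicator {x. 0 < c x} x \<partial>m) = \<phi> 0"
      using LIMSEQ_unique by (simp add: all)
    then have "m.prob {x. 0 < c x} = 1" by (simp add: \<phi>0)
    then show ?thesis by (subst (asm) m.prob_eq_1) auto
  qed
  define \<nu> where "\<nu> = distr m borel (\<lambda>x. - ln x)"
  have ae: "AE x in m. 0 < x \<and> x \<le> 1 \<and> c x = x"
    using supp pos by eventually_elim (metis c01(2))
  show thesis
  proof (rule that)
    show "real_distribution \<nu>" unfolding \<nu>_def by (rule m.real_distribution_distr) simp
    show "AE x in \<nu>. 0 \<le> x"
    proof -
      have "AE x in m. 0 \<le> - ln x" using ae by eventually_elim simp
      then show ?thesis unfolding \<nu>_def by (subst AE_distr_iff) auto
    qed
    fix t :: real assume "0 \<le> t"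
    show "(\<integral>x. exp (- t * x) \<partial>\<nu>) = \<phi> t"
    proof (cases "t = 0")
      case True
      interpret n: real_distribution \<nu> unfolding \<nu>_def by (rule m.real_distribution_distr) simp
      show ?thesis using True \<phi>0 n.prob_space by simp
    next
      case False
      have "(\<integral>x. exp (- t * x) \<partial>\<nu>) = (\<integral>x. exp (- t * - ln x) \<partial>m)"
        unfolding \<nu>_def by (rule integral_distr) auto
      also have "\<dots> = (\<integral>x. c x powr t \<partial>m)"
      proof (rule integral_cong_AE)
        show "AE x in m. exp (- t * - ln x) = c x powr t"
          using ae by eventually_elim (simp add: powr_def)
      qed auto
      finally show ?thesis using all False \<open>0 \<le> t\<close> by simp
    qed
  qed
qed

section \<open>Spectral theory of symmetric contraction semigroups\<close>

lemma cinner_scaleC_left: "cinner (c *\<^sub>C f) g = cnj c * cinner f g"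
  by (metis cinner_commute cinner_scaleC_right complex_cnj_cnj complex_cnj_mult)

text \<open>The imaginary part, too, is a real inner product, with one argument multiplied by \<i>.
  A complex linear map that is symmetric for \<open>inner\<close> is therefore symmetric for
  \<open>cinner\<close>, so most of the work can be done with \<open>inner\<close>.\<close>

lemma cinner_eq_Complex: "cinner f g = Complex (inner f g) (- inner f (\<i> *\<^sub>C g))"
  by (rule complex_eqI) (simp_all add: Re_cinner cinner_scaleC_right flip: Re_cinner)

lemma norm_scaleC: "norm (c *\<^sub>C f) = cmod c * norm f"
proof -
  have "cnj c * c = complex_of_real ((cmod c)\<^sup>2)"
    by (metis complex_norm_square mult.commute of_real_power)
  then have "cinner (c *\<^sub>C f) (c *\<^sub>C f) = complex_of_real ((cmod c)\<^sup>2) * cinner f f"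
    by (simp add: cinner_scaleC_left cinner_scaleC_right mult.assoc[symmetric] mult.commute[of c])
  then have "Re (cinner (c *\<^sub>C f) (c *\<^sub>C f)) = (cmod c)\<^sup>2 * Re (cinner f f)"
    by (simp only: Re_complex_of_real times_complex.sel Im_complex_of_real)
  then have "(norm (c *\<^sub>C f))\<^sup>2 = (cmod c * norm f)\<^sup>2"
    by (simp add: power_mult_distrib power2_norm_eq_inner Re_cinner)
  then show ?thesis by (simp add: power2_eq_iff_nonneg)
qed

lemma scaleC_0_right: "c *\<^sub>C 0 = 0"
  using norm_scaleC[of c 0] by simp

lemma scaleC_minus: "c *\<^sub>C (- f) = - (c *\<^sub>C f)"
  by (metis add.inverse_unique ab_left_minus add.commute scaleC_add_right norm_scaleC mult_zero_right norm_eq_zero norm_zero)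

lemma scaleC_diff: "c *\<^sub>C (f - g) = c *\<^sub>C f - c *\<^sub>C g"
  using scaleC_add_right[of c f "- g"] by (simp add: scaleC_minus)

lemma scaleC_scaleR: "c *\<^sub>C (r *\<^sub>R f) = r *\<^sub>R (c *\<^sub>C f)"
  by (simp add: scaleC_scaleC mult.commute flip: scaleC_of_real)

lemma tendsto_scaleC:
  assumes "(u \<longlongrightarrow> l) F"
  shows "((\<lambda>n. c *\<^sub>C u n) \<longlongrightarrow> c *\<^sub>C l) F"
proof -
  have "((\<lambda>n. cmod c * norm (u n - l)) \<longlongrightarrow> cmod c * 0) F"
    by (intro tendsto_intros tendsto_norm_zero LIM_zero assms)
  then have "((\<lambda>n. norm (c *\<^sub>C u n - c *\<^sub>C l)) \<longlongrightarrow> 0) F"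
    by (simp add: norm_scaleC flip: scaleC_diff)
  then show ?thesis by (simp add: LIM_zero_iff tendsto_norm_zero_iff)
qed

definition sym_op :: "('h::complex_inner \<Rightarrow> 'h) \<Rightarrow> bool" where
  "sym_op P \<longleftrightarrow> (\<forall>f g. P (f + g) = P f + P g) \<and> (\<forall>c f. P (c *\<^sub>C f) = c *\<^sub>C P f) \<and>
     (\<forall>f g. inner (P f) g = inner f (P g))"

lemma sym_opD:
  assumes "sym_op P"
  shows "P (f + g) = P f + P g" "P (c *\<^sub>C f) = c *\<^sub>C P f" "inner (P f) g = inner f (P g)"
    "P (r *\<^sub>R f) = r *\<^sub>R P f" "P (f - g) = P f - P g" "P 0 = 0"
proof -
  show 1: "P (f + g) = P f + P g" "P (c *\<^sub>C f) = c *\<^sub>C P f" "inner (P f) g = inner f (P g)" for f g c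
    using assms by (auto simp: sym_op_def)
  show 2: "P (r *\<^sub>R f) = r *\<^sub>R P f" for r f using 1(2)[of "of_real r"] by (simp add: scaleC_of_real)
  show "P 0 = 0" using 2[of 0 0] by simp
  show "P (f - g) = P f - P g" using 1(1)[of f "-1 *\<^sub>R g"] 2[of "-1" g] by simp
qed

text \<open>Polarization: by symmetry, \<open>2 * inner f (P g)\<close> is the quadratic form at f +
  g minus its values at f and at g.\<close>

lemma sym_op_eqI:
  assumes P: "sym_op P" and Q: "sym_op Q" and eq: "\<And>f. inner f (P f) = inner f (Q f)"
  shows "P = Q"
proof (rule ext)
  fix g
  have 2: "inner f (P g) = inner f (Q g)" for f
  proof -
    have "2 * inner f (P g) = inner (f + g) (P (f + g)) - inner f (P f) - inner g (P g)"
      by (simp add: sym_opD(1)[OF P] inner_add_left inner_add_right sym_opD(3)[OF P, of g f, symmetric] inner_commute)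
    also have "\<dots> = 2 * inner f (Q g)"
      unfolding eq
      by (simp add: sym_opD(1)[OF Q] inner_add_left inner_add_right sym_opD(3)[OF Q, of g f, symmetric] inner_commute)
    finally show ?thesis by simp
  qed
  then have "inner (P g - Q g) (P g - Q g) = 0"
    using 2[of "P g - Q g"] by (simp add: inner_diff_right)
  then show "P g = Q g" by simp
qed

lemma sym_op_cinner:
  assumes "sym_op P"
  shows "cinner (P f) g = cinner f (P g)"
  by (simp add: cinner_eq_Complex sym_opD(3)[OF assms] sym_opD(2)[OF assms])

lemma sym_op_cinner_self:
  assumes "sym_op P"
  shows "cinner f (P f) = complex_of_real (inner f (P f))"
proof -
  have "cinner f (P f) = cnj (cinner f (P f))"
    using cinner_commute[of f "P f"] by (simp add: sym_op_cinner[OF assms])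
  then have "Im (cinner f (P f)) = 0" by (metis complex_cnj_cancel_iff complex_cnj complex_eq_iff equal_neg_zero cnj.simps(2) neg_equal_zero)
  then show ?thesis by (simp add: complex_eq_iff Re_cinner)
qed

lemma cinner_nondeg:
  assumes "\<And>f. cinner f g = cinner f h"
  shows "g = h"
proof -
  have "inner f g = inner f h" for f using assms[of f] by (metis Re_cinner)
  then have "inner (g - h) (g - h) = 0" by (simp add: inner_diff_right)
  then show ?thesis by simp
qed

lemma sym_op_adjoint_graph:
  assumes "sym_op P"
  shows "adjoint_graph UNIV P = range (\<lambda>f. (f, P f))"
proof -
  have "h = P g" if "\<forall>f. cinner f (P g) = cinner f h" for g h
    using cinner_nondeg[of "P g" h] that by simp
  then show ?thesis by (auto simp: adjoint_graph_def sym_op_cinner[OF assms])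
qed

definition sym_proj :: "('h::complex_inner \<Rightarrow> 'h) \<Rightarrow> bool" where
  "sym_proj P \<longleftrightarrow> sym_op P \<and> (\<forall>f. P (P f) = P f)"

lemma sym_proj_norm:
  assumes "sym_proj P"
  shows "inner f (P f) = (norm (P f))\<^sup>2" "norm (P f) \<le> norm f"
proof -
  show 1: "inner f (P f) = (norm (P f))\<^sup>2"
    using assms sym_opD(3)[of P f "P f"] by (simp add: sym_proj_def power2_norm_eq_inner)
  have "norm (P f) * norm (P f) \<le> norm f * norm (P f)"
    using norm_cauchy_schwarz[of f "P f"] by (simp add: 1 power2_eq_square)
  then show "norm (P f) \<le> norm f"
    by (cases "norm (P f) = 0") (auto simp: mult_le_cancel_right)
qed

lemma sym_op_bounded_clinear:
  assumes P: "sym_op P" and "\<And>f. norm (P f) \<le> norm f"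
  shows "bounded_clinear P"
  unfolding bounded_clinear_def clinear_on_def
  using assms(2) sym_opD[OF P] by (auto intro!: bounded_linear_intro[where K = 1])

lemma sym_proj_orthogonal_projection:
  assumes "sym_proj P"
  shows "orthogonal_projection P"
  using assms sym_proj_norm[OF assms] sym_op_bounded_clinear[of P] sym_op_adjoint_graph[of P]
  by (auto simp: sym_proj_def orthogonal_projection_def)

text \<open>By symmetry the norm square is \<open>inner f (P (P f))\<close>, so P and its square are
  symmetric operators with the same quadratic form.\<close>

lemma sym_projI:
  assumes "sym_op P" "\<And>f. inner f (P f) = (norm (P f))\<^sup>2"
  shows "sym_proj P"
proof -
  have "P \<circ> P = P"
    using assms(1) by (rule sym_op_eqI[rotated])
      (use assms in \<open>auto simp: sym_op_def power2_norm_eq_inner\<close>)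
  then show ?thesis using assms(1) by (auto simp: sym_proj_def fun_eq_iff)
qed

lemma sym_op_limit:
  assumes "\<And>n. sym_op (S n)" "\<And>f. (\<lambda>n. S n f) \<longlonglongrightarrow> P f"
  shows "sym_op P"
  unfolding sym_op_def
proof (intro conjI allI)
  fix f g c
  have "(\<lambda>n. S n f + S n g) \<longlonglongrightarrow> P f + P g" by (intro tendsto_add assms)
  then have "(\<lambda>n. S n (f + g)) \<longlonglongrightarrow> P f + P g" by (simp add: sym_opD(1)[OF assms(1)])
  then show "P (f + g) = P f + P g" using assms(2)[of "f + g"] LIMSEQ_unique by blast
  have "(\<lambda>n. c *\<^sub>C S n f) \<longlonglongrightarrow> c *\<^sub>C P f" by (intro tendsto_scaleC assms)
  then have "(\<lambda>n. S n (c *\<^sub>C f)) \<longlonglongrightarrow> c *\<^sub>C P f" by (simp add: sym_opD(2)[OF assms(1)])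
  then show "P (c *\<^sub>C f) = c *\<^sub>C P f" using assms(2)[of "c *\<^sub>C f"] LIMSEQ_unique by blast
  have "(\<lambda>n. inner (S n f) g) \<longlonglongrightarrow> inner (P f) g" "(\<lambda>n. inner f (S n g)) \<longlonglongrightarrow> inner f (P g)"
    by (intro tendsto_intros assms)+
  then show "inner (P f) g = inner f (P g)"
    using LIMSEQ_unique by (simp add: sym_opD(3)[OF assms(1)])
qed

lemma sym_op_sum:
  assumes "finite I" "\<And>i. i \<in> I \<Longrightarrow> sym_op (S i)"
  shows "sym_op (\<lambda>f. \<Sum>i\<in>I. a i *\<^sub>R S i f)"
proof -
  have c: "c *\<^sub>C (\<Sum>i\<in>I. u i) = (\<Sum>i\<in>I. c *\<^sub>C u i)" for c and u :: "_ \<Rightarrow> 'b::complex_inner"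
    using assms(1) by (induction I) (simp_all add: scaleC_add_right norm_scaleC flip: norm_eq_zero)
  show ?thesis
    using sym_opD[OF assms(2)]
    by (auto simp: sym_op_def inner_sum_left inner_sum_right sum.distrib algebra_simps c scaleC_scaleR
        intro!: sum.cong)
qed

text \<open>\<open>J n\<close> stands for the squared distance from \<open>u n\<close> to a limit
  not yet known to exist as a vector. In the uses it is a distance in L2 of a spectral measure, or
  the mass of a tail; the factor 2 is that of (a + b)^2 \<le> 2 (a^2 + b^2).\<close>

lemma convergent_of_square_bound:
  fixes u :: "nat \<Rightarrow> 'h::{real_inner,complete_space}"
  assumes J: "J \<longlonglongrightarrow> 0" and le: "\<And>m n. (norm (u m - u n))\<^sup>2 \<le> 2 * (J m + J n)"
  shows "convergent u"
proof (rule Cauchy_convergent, rule CauchyI)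
  fix e :: real assume e: "0 < e"
  then have "0 < e\<^sup>2 / 4" by simp
  with J obtain N where N: "\<And>n. N \<le> n \<Longrightarrow> norm (J n - 0) < e\<^sup>2 / 4"
    unfolding LIMSEQ_iff by blast
  show "\<exists>M. \<forall>m\<ge>M. \<forall>n\<ge>M. norm (u m - u n) < e"
  proof (intro exI[of _ N] allI impI)
    fix m n assume "N \<le> m" "N \<le> n"
    then have "J m < e\<^sup>2 / 4" "J n < e\<^sup>2 / 4" using N[of m] N[of n] by auto
    then have "2 * (J m + J n) < e\<^sup>2" by argo
    then have "(norm (u m - u n))\<^sup>2 < e\<^sup>2" using le[of m n] by (rule le_less_trans[rotated])
    then show "norm (u m - u n) < e" using e by (simp add: power_less_imp_less_base)
  qed
qed

section \<open>Spectral measures of single vectors\<close>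

lemma fdiff_shift: "fdiff a r (k + m) = fdiff (\<lambda>i. a (k + i)) r m"
  by (induction r arbitrary: m) (simp_all flip: add_Suc_right)

lemma fdiff_diff: "fdiff (\<lambda>i. a i - a (Suc i)) r k = fdiff a (Suc r) k"
  by (induction r arbitrary: k) simp_all

locale symmetric_contraction_semigroup =
  fixes T :: "real \<Rightarrow> 'h::{complex_inner,complete_space} \<Rightarrow> 'h"
  assumes sym: "\<And>t. 0 \<le> t \<Longrightarrow> sym_op (T t)"
    and contr: "\<And>t f. 0 \<le> t \<Longrightarrow> norm (T t f) \<le> norm f"
    and T_0: "T 0 f = f"
    and T_add: "0 \<le> s \<Longrightarrow> 0 \<le> t \<Longrightarrow> T s (T t f) = T (s + t) f"
    and cont: "continuous_on {0..} (\<lambda>t. T t f)"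
begin

lemma inner_T: "0 \<le> s \<Longrightarrow> 0 \<le> t \<Longrightarrow> inner (T s f) (T t g) = inner f (T (s + t) g)"
  by (simp add: sym_opD(3)[OF sym] T_add)

text \<open>The difference is the quadratic form at f of T_{kh} (1 - T_h)^r. Replacing f by T_{kh/2}
  f reduces to k = 0, and replacing f by f - T_h f lowers r by two, so the induction carries two
  consecutive orders. The base cases are \<open>inner g g\<close> and
  \<open>inner g g - inner g (T h g)\<close>; the latter is nonnegative because T_h is the square of
  the symmetric contraction T_{h/2}.\<close>

lemma fdiff_semigroup_nonneg:
  assumes h: "0 < h"
  shows "0 \<le> fdiff (\<lambda>i. inner f (T (real i * h) f)) r k"
proof -
  have Q: "0 \<le> fdiff (\<lambda>i. inner g (T (real i * h) g)) r 0 \<and>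
      0 \<le> fdiff (\<lambda>i. inner g (T (real i * h) g)) (Suc r) 0" for g r
  proof (induction r arbitrary: g)
    case 0
    have "inner g (T h g) = (norm (T (h/2) g))\<^sup>2"
      using inner_T[of "h/2" "h/2" g g] h by (simp add: power2_norm_eq_inner)
    also have "\<dots> \<le> (norm g)\<^sup>2" using contr[of "h/2" g] h by (intro power_mono) auto
    finally show ?case by (simp add: T_0 power2_norm_eq_inner)
  next
    case (Suc r)
    define u where "u = g - T h g"
    define a where "a i = inner g (T (real i * h) g)" for i
    have b: "inner u (T (real i * h) u) = (a i - a (Suc i)) - (a (Suc i) - a (Suc (Suc i)))" for i
      using h inner_T[of h "real i * h" g g] inner_T[of h "h + real i * h" g g]
      by (simp add: u_def a_def sym_opD[OF sym] inner_diff_left inner_diff_right T_add algebra_simps)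
    have "fdiff (\<lambda>i. inner u (T (real i * h) u)) r 0 = fdiff a (Suc (Suc r)) 0"
      unfolding b fdiff_diff[of "\<lambda>i. a i - a (Suc i)"] by (simp only: fdiff.simps fdiff_diff)
    then have "0 \<le> fdiff a (Suc (Suc r)) 0" using Suc.IH[of u] by metis
    then show ?case using Suc.IH[of g] unfolding a_def by blast
  qed
  define g where "g = T (real k * h / 2) f"
  have "inner f (T (real (k + i) * h) f) = inner g (T (real i * h) g)" for i
    using h inner_T[of "real k * h / 2" "real i * h + real k * h / 2" f f]
    by (simp add: g_def T_add algebra_simps)
  then show ?thesis using Q[of g r] fdiff_shift[of _ r k 0] by simp
qed

lemma spectral_measure_exists:
  "\<exists>\<nu>. finite_measure \<nu> \<and> sets \<nu> = sets borel \<and> (AE x in \<nu>. 0 \<le> x) \<and>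
     (\<forall>t\<ge>0. (\<integral>x. exp (- t * x) \<partial>\<nu>) = inner f (T t f))"
proof (cases "f = 0")
  case True
  have "finite_measure (null_measure (borel :: real measure))" by (intro finite_measureI) simp
  moreover have "AE x in null_measure (borel :: real measure). 0 \<le> x"
    by (rule AE_I[of _ _ UNIV]) auto
  ultimately show ?thesis using True by (intro exI[of _ "null_measure borel"]) simp
next
  case False
  define g where "g = f /\<^sub>R norm f"
  have f: "f = norm f *\<^sub>R g" using False by (simp add: g_def)
  have g: "inner g g = 1" using False by (simp add: g_def dot_square_norm power2_eq_square)
  obtain \<nu> where \<nu>: "real_distribution \<nu>" "AE x in \<nu>. 0 \<le> x"
    "\<And>t. 0 \<le> t \<Longrightarrow> (\<integral>x. exp (- t * x) \<partial>\<nu>) = inner g (T t g)"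
  proof (rule bernstein_representation[of "\<lambda>t. inner g (T t g)"])
    show "inner g (T 0 g) = 1" by (simp add: T_0 g)
    show "continuous_on {0..} (\<lambda>t. inner g (T t g))" by (intro continuous_intros cont)
  qed (auto intro: fdiff_semigroup_nonneg)
  interpret \<nu>: real_distribution \<nu> by (rule \<nu>(1))
  show ?thesis
  proof (intro exI[of _ "density \<nu> (\<lambda>_. ennreal ((norm f)\<^sup>2))"] conjI allI impI)
    show "finite_measure (density \<nu> (\<lambda>_. ennreal ((norm f)\<^sup>2)))"
      by (intro finite_measureI) (simp add: emeasure_density_const ennreal_mult_eq_top_iff)
    show "AE x in density \<nu> (\<lambda>_. ennreal ((norm f)\<^sup>2)). 0 \<le> x"
      using \<nu>(2) by (subst AE_density) (auto elim: AE_mp)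
    fix t :: real assume t: "0 \<le> t"
    have "(\<integral>x. exp (- t * x) \<partial>density \<nu> (\<lambda>_. ennreal ((norm f)\<^sup>2))) = (norm f)\<^sup>2 * (\<integral>x. exp (- t * x) \<partial>\<nu>)"
      by (subst integral_density) auto
    also have "\<dots> = (norm f)\<^sup>2 * inner g (T t g)" using \<nu>(3)[OF t] by simp
    also have "\<dots> = inner f (T t f)"
      by (subst (2 3) f) (simp add: sym_opD(4)[OF sym[OF t]] power2_eq_square)
    finally show "(\<integral>x. exp (- t * x) \<partial>density \<nu> (\<lambda>_. ennreal ((norm f)\<^sup>2))) = inner f (T t f)" .
  qed simp
qed

definition \<nu> :: "'h \<Rightarrow> real measure" where
  "\<nu> f = (SOME \<nu>. finite_measure \<nu> \<and> sets \<nu> = sets borel \<and> (AE x in \<nu>. 0 \<le> x) \<and>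
     (\<forall>t\<ge>0. (\<integral>x. exp (- t * x) \<partial>\<nu>) = inner f (T t f)))"

lemma spectral_measure: "finite_measure (\<nu> f)" "sets (\<nu> f) = sets borel" "AE x in \<nu> f. 0 \<le> x"
    "0 \<le> t \<Longrightarrow> (\<integral>x. exp (- t * x) \<partial>\<nu> f) = inner f (T t f)"
  using someI_ex[OF spectral_measure_exists[of f]] unfolding \<nu>_def by auto

lemma measurable_\<nu>_iff: "measurable (\<nu> f) N = measurable borel N"
  by (intro measurable_cong_sets spectral_measure refl)

lemma space_\<nu>: "space (\<nu> f) = UNIV"
  using sets_eq_imp_space_eq[OF spectral_measure(2)] by simp

lemma integrable_\<nu>_bounded:
  fixes \<psi> :: "real \<Rightarrow> real"
  assumes "\<psi> \<in> borel_measurable borel" "\<And>x. 0 \<le> x \<Longrightarrow> \<bar>\<psi> x\<bar> \<le> B"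
  shows "integrable (\<nu> f) \<psi>"
  using spectral_measure(3)[of f] assms
  by (intro finite_measure.integrable_const_bound[OF spectral_measure(1), where B = B])
     (auto simp: measurable_\<nu>_iff elim: AE_mp)

lemma integrable_exp: "0 \<le> t \<Longrightarrow> integrable (\<nu> f) (\<lambda>x. exp (- t * x))"
  by (rule integrable_\<nu>_bounded[of _ 1]) (auto simp: mult_nonneg_nonneg)

text \<open>The isometry of the functional calculus, before any projection exists:
  \<open>inner (T s f) (T r f)\<close> depends only on s + r, just as the product of the two
  exponentials does. Convergence of polynomials and of difference quotients of the semigroup is read
  off from it in L2 of \<open>\<nu> f\<close>.\<close>

lemma norm_sum_T:
  assumes I: "finite I" and s: "\<And>i. i \<in> I \<Longrightarrow> 0 \<le> s i"
  shows "(norm (\<Sum>i\<in>I. c i *\<^sub>R T (s i) f))\<^sup>2 = (\<integral>x. (\<Sum>i\<in>I. c i * exp (- s i * x))\<^sup>2 \<partial>\<nu> f)"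
proof -
  have "(norm (\<Sum>i\<in>I. c i *\<^sub>R T (s i) f))\<^sup>2 = (\<Sum>i\<in>I. \<Sum>j\<in>I. c i * (c j * inner f (T (s i + s j) f)))"
    unfolding power2_norm_eq_inner inner_sum_left inner_sum_right
    by (simp add: inner_T s add.commute)
  also have "\<dots> = (\<Sum>i\<in>I. \<Sum>j\<in>I. \<integral>x. c i * (c j * exp (- (s i + s j) * x)) \<partial>\<nu> f)"
    by (intro sum.cong refl) (simp add: spectral_measure(4)[symmetric] s)
  also have "\<dots> = (\<integral>x. (\<Sum>i\<in>I. \<Sum>j\<in>I. c i * (c j * exp (- (s i + s j) * x))) \<partial>\<nu> f)"
  proof -
    have int: "integrable (\<nu> f) (\<lambda>x. c i * (c j * exp (- (s i + s j) * x)))" if "i \<in> I" "j \<in> I" for i j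
      using that by (intro integrable_mult_right integrable_exp add_nonneg_nonneg s)
    have "(\<Sum>i\<in>I. \<Sum>j\<in>I. \<integral>x. c i * (c j * exp (- (s i + s j) * x)) \<partial>\<nu> f)
       = (\<Sum>i\<in>I. \<integral>x. (\<Sum>j\<in>I. c i * (c j * exp (- (s i + s j) * x))) \<partial>\<nu> f)"
      by (intro sum.cong refl Bochner_Integration.integral_sum[symmetric] int)
    also have "\<dots> = (\<integral>x. (\<Sum>i\<in>I. \<Sum>j\<in>I. c i * (c j * exp (- (s i + s j) * x))) \<partial>\<nu> f)"
      by (intro Bochner_Integration.integral_sum[symmetric] Bochner_Integration.integrable_sum int)
    finally show ?thesis .
  qed
  also have "\<dots> = (\<integral>x. (\<Sum>i\<in>I. c i * exp (- s i * x))\<^sup>2 \<partial>\<nu> f)"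
    unfolding power2_eq_square sum_product
    by (intro Bochner_Integration.integral_cong refl sum.cong) (simp add: mult_exp_exp algebra_simps)
  finally show ?thesis .
qed


text \<open>In the variable u = exp (- x) the half line x \<le> a becomes u \<ge> y with y = exp (-
  a), and the monomial u^i belongs to the operator \<open>T (real i)\<close>. Weierstrass
  approximation on [0,1] of ramps that tend to the indicator of u \<ge> y yields the
  polynomials.\<close>

lemma projection_atMost:
  "\<exists>P. sym_proj P \<and> (\<forall>t\<ge>0. \<forall>f. P (T t f) = T t (P f)) \<and> (\<forall>f. inner f (P f) = measure (\<nu> f) {..a})"
proof -
  define y where "y = exp (- a)"
  \<comment> \<open>The ramp rises to the left of y and equals 1 from y on, so the endpoint belongs
    to the limit set and the half line obtained is closed.\<close>
  define \<psi> :: "nat \<Rightarrow> real \<Rightarrow> real" where "\<psi> n u = max 0 (min 1 (1 - real n * (y - u)))" for n u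
  have \<psi>01: "0 \<le> \<psi> n u" "\<psi> n u \<le> 1" for n u by (auto simp: \<psi>_def)
  have \<psi>lim: "(\<lambda>n. \<psi> n u) \<longlonglongrightarrow> (if y \<le> u then 1 else 0)" for u
  proof (cases "y \<le> u")
    case True
    then have "\<psi> n u = 1" for n using mult_nonneg_nonpos[of "real n" "y - u"] by (simp add: \<psi>_def)
    then show ?thesis using True by simp
  next
    case False
    then obtain N :: nat where N: "1 < real N * (y - u)"
      using reals_Archimedean3[of "y - u"] by auto
    have "\<psi> n u = 0" if "N \<le> n" for n
    proof -
      have "real N * (y - u) \<le> real n * (y - u)" using that False by (intro mult_right_mono) auto
      then show ?thesis using N by (simp add: \<psi>_def)
    qed
    then have "eventually (\<lambda>n. \<psi> n u = 0) sequentially" by (auto simp: eventually_sequentially)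
    then show ?thesis using False by (simp add: tendsto_eventually)
  qed
  have "\<exists>b d. \<forall>u\<in>{0..1}. \<bar>\<psi> n u - (\<Sum>i\<le>d. b i * u ^ i)\<bar> < inverse (real (Suc n))" for n
  proof -
    have "continuous_on {0..1} (\<psi> n)" unfolding \<psi>_def by (intro continuous_intros)
    then obtain q where q: "real_polynomial_function q" "\<And>u. u \<in> {0..1} \<Longrightarrow> \<bar>\<psi> n u - q u\<bar> < inverse (real (Suc n))"
      using Stone_Weierstrass_real_polynomial_function[of "{0..1}" "\<psi> n" "inverse (real (Suc n))"] by auto
    moreover obtain b k where "q = (\<lambda>x. \<Sum>i\<le>k. b i * x ^ i)"
      using q(1) real_polynomial_function_iff_sum[of q] by auto
    ultimately show ?thesis by (intro exI[of _ b] exI[of _ k]) auto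
  qed
  then obtain b d where bd: "\<And>n u. u \<in> {0..1} \<Longrightarrow> \<bar>\<psi> n u - (\<Sum>i\<le>d n. b n i * u ^ i)\<bar> < inverse (real (Suc n))"
    by metis
  define p :: "nat \<Rightarrow> real \<Rightarrow> real" where "p n x = (\<Sum>i\<le>d n. b n i * exp (- real i * x))" for n x
  have p_eq: "p n x = (\<Sum>i\<le>d n. b n i * exp (- x) ^ i)" for n x
    by (simp add: p_def exp_of_nat_mult[symmetric])
  have [measurable]: "p n \<in> borel_measurable borel" for n unfolding p_def by measurable
  have close: "\<bar>\<psi> n (exp (- x)) - p n x\<bar> < inverse (real (Suc n))" if "0 \<le> x" for n x
    unfolding p_eq using that by (intro bd) auto
  \<comment> \<open>The ramp contributes 1 and the approximation error at most 1. The dominating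
    constants 3, 9 and 16 below come from this bound.\<close>
  have pb: "\<bar>p n x\<bar> \<le> 2" if "0 \<le> x" for n x
  proof -
    have "inverse (real (Suc n)) \<le> 1" by (simp add: inverse_le_1_iff)
    then show ?thesis using close[OF that, of n] \<psi>01[of n "exp (- x)"] by linarith
  qed
  have plim: "(\<lambda>n. p n x) \<longlonglongrightarrow> indicator {..a} x" if "0 \<le> x" for x
  proof -
    have "(\<lambda>n. \<psi> n (exp (- x)) - p n x) \<longlonglongrightarrow> 0"
      by (rule Lim_null_comparison[OF _ LIMSEQ_inverse_real_of_nat])
         (use close[OF that] in \<open>auto intro!: always_eventually less_imp_le\<close>)
    from tendsto_diff[OF \<psi>lim[of "exp (- x)"] this]
    show ?thesis by (auto simp: y_def indicator_def split: if_splits)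
  qed
  define S where "S n f = (\<Sum>i\<le>d n. b n i *\<^sub>R T (real i) f)" for n f
  have symS: "sym_op (S n)" for n unfolding S_def by (intro sym_op_sum sym) auto
  define J where "J f n = (\<integral>x. (p n x - indicator {..a} x)\<^sup>2 \<partial>\<nu> f)" for f n
  have sq4: "r\<^sup>2 \<le> 9" if "\<bar>r\<bar> \<le> 3" for r :: real
    using power_mono[of "\<bar>r\<bar>" 3 2] that by simp
  have pb3: "\<bar>p n x - indicator {..a} x\<bar> \<le> 3" if "0 \<le> x" for n x
    using pb[OF that, of n] by (auto simp: indicator_def)
  have intJ: "integrable (\<nu> f) (\<lambda>x. (p n x - indicator {..a} x)\<^sup>2)" for f n
    using sq4 pb3 by (intro integrable_\<nu>_bounded[where B = 9]) auto
  have Jlim: "J f \<longlonglongrightarrow> 0" for f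
  proof -
    have "(\<lambda>n. J f n) \<longlonglongrightarrow> (\<integral>x. 0 \<partial>\<nu> f)"
      unfolding J_def
    proof (rule integral_dominated_convergence[where w = "\<lambda>_. 9"])
      show "AE x in \<nu> f. (\<lambda>n. (p n x - indicator {..a} x)\<^sup>2) \<longlonglongrightarrow> 0"
        using spectral_measure(3)[of f]
      proof eventually_elim
        case (elim x)
        from tendsto_power[OF tendsto_diff[OF plim[OF elim] tendsto_const[of "indicator {..a} x"]], of 2]
        show ?case by simp
      qed
      show "AE x in \<nu> f. norm ((p n x - indicator {..a} x)\<^sup>2) \<le> 9" for n
        using spectral_measure(3)[of f] by eventually_elim (use sq4 pb3 in simp)
    qed (auto simp: measurable_\<nu>_iff intro!: integrable_\<nu>_bounded)
    then show ?thesis by simp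
  qed
  have diff: "(norm (S m f - S n f))\<^sup>2 \<le> 2 * (J f m + J f n)" for m n f
  proof -
    \<comment> \<open>The disjoint union of the two index sets presents the difference of two
      polynomials as one linear combination, to which the isometry applies.\<close>
    define c :: "nat + nat \<Rightarrow> real" where "c = case_sum (b m) (\<lambda>j. - b n j)"
    define s :: "nat + nat \<Rightarrow> real" where "s = case_sum real real"
    have s0: "0 \<le> s i" for i by (auto simp: s_def split: sum.split)
    have "S m f - S n f = (\<Sum>i\<in>{..d m} <+> {..d n}. c i *\<^sub>R T (s i) f)"
      by (simp add: sum.Plus S_def c_def s_def sum_negf)
    moreover have "(\<Sum>i\<in>{..d m} <+> {..d n}. c i * exp (- s i * x)) = p m x - p n x" for x
      by (simp add: sum.Plus p_def c_def s_def sum_negf)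
    ultimately have "(norm (S m f - S n f))\<^sup>2 = (\<integral>x. (p m x - p n x)\<^sup>2 \<partial>\<nu> f)"
      using norm_sum_T[of "{..d m} <+> {..d n}" s c f] s0 by simp
    also have "\<dots> \<le> (\<integral>x. 2 * ((p m x - indicator {..a} x)\<^sup>2 + (p n x - indicator {..a} x)\<^sup>2) \<partial>\<nu> f)"
    proof (rule integral_mono)
      show "integrable (\<nu> f) (\<lambda>x. (p m x - p n x)\<^sup>2)"
      proof (rule integrable_\<nu>_bounded)
        fix x :: real assume "0 \<le> x"
        then show "\<bar>(p m x - p n x)\<^sup>2\<bar> \<le> 16"
          using power_mono[of "\<bar>p m x - p n x\<bar>" 4 2] pb[of x m] pb[of x n] by simp
      qed measurable
      show "(p m x - p n x)\<^sup>2 \<le> 2 * ((p m x - indicator {..a} x)\<^sup>2 + (p n x - indicator {..a} x)\<^sup>2)" for x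
        using sum_squares_bound[of "p m x - indicator {..a} x" "- (p n x - indicator {..a} x)"]
        by (simp add: power2_eq_square algebra_simps)
    qed (use intJ in auto)
    also have "\<dots> = 2 * (J f m + J f n)" unfolding J_def by (simp add: intJ)
    finally show ?thesis .
  qed
  define P where "P f = lim (\<lambda>n. S n f)" for f
  have Plim: "(\<lambda>n. S n f) \<longlonglongrightarrow> P f" for f
    unfolding P_def using convergent_of_square_bound[OF Jlim diff] by (simp add: convergent_LIMSEQ_iff)
  have symP: "sym_op P" by (rule sym_op_limit[OF symS Plim])
  have ind: "(\<integral>x. indicator {..a} x \<partial>\<nu> f) = measure (\<nu> f) {..a}" for f
    by (simp add: space_\<nu>)
  have inn: "inner f (P f) = measure (\<nu> f) {..a}" for f
  proof (rule LIMSEQ_unique)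
    show "(\<lambda>n. inner f (S n f)) \<longlonglongrightarrow> inner f (P f)" by (intro tendsto_intros Plim)
    have "inner f (S n f) = (\<integral>x. p n x \<partial>\<nu> f)" for n
    proof -
      have "inner f (S n f) = (\<Sum>i\<le>d n. b n i * inner f (T (real i) f))"
        by (simp add: S_def inner_sum_right)
      also have "\<dots> = (\<Sum>i\<le>d n. \<integral>x. b n i * exp (- real i * x) \<partial>\<nu> f)"
        by (simp add: spectral_measure(4)[symmetric] del: minus_mult_left)
      also have "\<dots> = (\<integral>x. p n x \<partial>\<nu> f)" unfolding p_def
        by (rule Bochner_Integration.integral_sum[symmetric])
          (intro integrable_mult_right integrable_exp, simp)
      finally show ?thesis .
    qed
    moreover have "(\<lambda>n. \<integral>x. p n x \<partial>\<nu> f) \<longlonglongrightarrow> (\<integral>x. indicator {..a} x \<partial>\<nu> f)"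
    proof (rule integral_dominated_convergence[where w = "\<lambda>_. 2"])
      show "AE x in \<nu> f. (\<lambda>n. p n x) \<longlonglongrightarrow> indicator {..a} x"
        using spectral_measure(3)[of f] by eventually_elim (rule plim)
      show "AE x in \<nu> f. norm (p n x) \<le> 2" for n
        using spectral_measure(3)[of f] by eventually_elim (use pb in simp)
    qed (auto simp: measurable_\<nu>_iff intro!: integrable_\<nu>_bounded)
    ultimately show "(\<lambda>n. inner f (S n f)) \<longlonglongrightarrow> measure (\<nu> f) {..a}" using ind by simp
  qed
  \<comment> \<open>The squares of the polynomials have the same pointwise limit as the polynomials,
    an indicator being its own square. Equality of the norm square with the quadratic form is what
    makes P idempotent.\<close>
  have nrm: "(norm (P f))\<^sup>2 = measure (\<nu> f) {..a}" for f
  proof (rule LIMSEQ_unique)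
    show "(\<lambda>n. (norm (S n f))\<^sup>2) \<longlonglongrightarrow> (norm (P f))\<^sup>2" by (intro tendsto_intros Plim)
    have "(norm (S n f))\<^sup>2 = (\<integral>x. (p n x)\<^sup>2 \<partial>\<nu> f)" for n
      unfolding S_def p_def by (rule norm_sum_T) auto
    moreover have "(\<lambda>n. \<integral>x. (p n x)\<^sup>2 \<partial>\<nu> f) \<longlonglongrightarrow> (\<integral>x. indicator {..a} x \<partial>\<nu> f)"
    proof (rule integral_dominated_convergence[where w = "\<lambda>_. 9"])
      show "AE x in \<nu> f. (\<lambda>n. (p n x)\<^sup>2) \<longlonglongrightarrow> indicator {..a} x"
        using spectral_measure(3)[of f]
      proof eventually_elim
        case (elim x)
        from tendsto_power[OF plim[OF elim], of 2] show ?case by (auto simp: indicator_def)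
      qed
      show "AE x in \<nu> f. norm ((p n x)\<^sup>2) \<le> 9" for n
        using spectral_measure(3)[of f]
      proof eventually_elim
        case (elim x)
        then show ?case using sq4[of "p n x"] pb[OF elim, of n] by simp
      qed
    qed (auto simp: measurable_\<nu>_iff intro!: integrable_\<nu>_bounded)
    ultimately show "(\<lambda>n. (norm (S n f))\<^sup>2) \<longlonglongrightarrow> measure (\<nu> f) {..a}" using ind by simp
  qed
  have "P (T t f) = T t (P f)" if t: "0 \<le> t" for t f
  proof (rule LIMSEQ_unique[OF Plim])
    have "S n (T t f) = T t (S n f)" for n
    proof -
      have "T t (\<Sum>i\<in>I. u i) = (\<Sum>i\<in>I. T t (u i))" if "finite I" for I and u :: "nat \<Rightarrow> 'h"
        using that by (induction I) (simp_all add: sym_opD[OF sym[OF t]])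
      then show ?thesis
        by (simp add: S_def sym_opD[OF sym[OF t]] T_add t add.commute)
    qed
    moreover have "(\<lambda>n. T t (S n f)) \<longlonglongrightarrow> T t (P f)"
    proof -
      have "bounded_linear (T t)"
        using sym_op_bounded_clinear[OF sym[OF t] contr[OF t]] by (simp add: bounded_clinear_def)
      then show ?thesis by (rule bounded_linear.tendsto[OF _ Plim])
    qed
    ultimately show "(\<lambda>n. S n (T t f)) \<longlonglongrightarrow> T t (P f)" by simp
  qed
  moreover have "sym_proj P" by (rule sym_projI[OF symP]) (simp add: inn nrm)
  ultimately show ?thesis using inn by blast
qed


text \<open>\<open>P\<close> is the value at \<open>B\<close> of the projection valued measure to be constructed; being symmetric,
  it is determined by its quadratic form.\<close>

definition spectral_proj :: "('h \<Rightarrow> 'h) \<Rightarrow> real set \<Rightarrow> bool" where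
  "spectral_proj P B \<longleftrightarrow> sym_proj P \<and> (\<forall>t\<ge>0. \<forall>f. P (T t f) = T t (P f)) \<and>
     (\<forall>f. inner f (P f) = measure (\<nu> f) B)"

section \<open>Calculus of spectral projections\<close>

lemma spectral_projD:
  assumes "spectral_proj P B"
  shows "sym_proj P" "sym_op P" "P (P f) = P f" "0 \<le> t \<Longrightarrow> P (T t f) = T t (P f)"
    "inner f (P f) = measure (\<nu> f) B" "(norm (P f))\<^sup>2 = measure (\<nu> f) B"
  using assms sym_proj_norm(1)[of P f] by (auto simp: spectral_proj_def sym_proj_def)

lemma spectral_proj_unique: "spectral_proj P B \<Longrightarrow> spectral_proj Q B \<Longrightarrow> P = Q"
  by (rule sym_op_eqI) (simp_all add: spectral_projD)

lemma measure_\<nu>_UNIV: "measure (\<nu> f) UNIV = inner f f"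
  using spectral_measure(4)[of 0 f] by (simp add: T_0 space_\<nu>)

lemma spectral_proj_UNIV: "spectral_proj (\<lambda>f. f) UNIV"
  by (simp add: spectral_proj_def sym_proj_def sym_op_def measure_\<nu>_UNIV)

lemma spectral_proj_compl:
  assumes P: "spectral_proj P B" and B: "B \<in> sets borel"
  shows "spectral_proj (\<lambda>f. f - P f) (- B)"
proof -
  have "measure (\<nu> f) (- B) = inner f f - measure (\<nu> f) B" for f
    using finite_measure.finite_measure_compl[OF spectral_measure(1), of B f] B
    by (simp add: spectral_measure(2) space_\<nu> measure_\<nu>_UNIV Compl_eq_Diff_UNIV)
  then show ?thesis
    using sym_opD[OF spectral_projD(2)[OF P]] spectral_projD[OF P]
    by (auto simp: spectral_proj_def sym_proj_def sym_op_def scaleC_diff inner_diff_left inner_diff_right sym_opD[OF sym])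
qed

text \<open>For g = Q f the forms of P and Q at g add up to
  \<open>measure (\<nu> g) (A \<union> B)\<close>, hence to at most the norm square of g. The form
  of Q at g already exhausts this, which leaves nothing for P.\<close>

lemma spectral_proj_orthogonal:
  assumes P: "spectral_proj P A" and Q: "spectral_proj Q B" and AB: "A \<in> sets borel" "B \<in> sets borel" "A \<inter> B = {}"
  shows "P (Q f) = 0"
proof -
  let ?g = "Q f"
  have "inner ?g (P ?g) + inner ?g (Q ?g) = measure (\<nu> ?g) (A \<union> B)"
    using AB finite_measure.finite_measure_Union[OF spectral_measure(1)] by (simp add: spectral_projD(5)[OF P] spectral_projD(5)[OF Q] spectral_measure(2))
  also have "\<dots> \<le> inner ?g ?g"
    using finite_measure.bounded_measure[OF spectral_measure(1)] by (simp add: space_\<nu> flip: measure_\<nu>_UNIV)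
  finally have "inner ?g (P ?g) \<le> 0" by (simp add: spectral_projD(3)[OF Q])
  then show ?thesis by (simp add: sym_proj_norm(1)[OF spectral_projD(1)[OF P]])
qed

text \<open>As A is disjoint from the complement of B, P annihilates f - Q f, so P Q = P; expanding
  the square then gives the difference of the measures.\<close>

lemma spectral_proj_subset:
  assumes P: "spectral_proj P A" and Q: "spectral_proj Q B" and AB: "A \<in> sets borel" "B \<in> sets borel" "A \<subseteq> B"
  shows "(norm (Q f - P f))\<^sup>2 = measure (\<nu> f) B - measure (\<nu> f) A"
proof -
  have "P (g - Q g) = 0" for g
    using spectral_proj_orthogonal[OF P spectral_proj_compl[OF Q]] AB by auto
  then have PQ: "P (Q g) = P g" for g
    using sym_opD(5)[OF spectral_projD(2)[OF P]] by simp
  have "inner (Q f) (P f) = inner (P (Q f)) f"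
    by (simp add: sym_opD(3)[OF spectral_projD(2)[OF P]])
  also have "\<dots> = measure (\<nu> f) A"
    by (simp add: PQ inner_commute spectral_projD(5)[OF P])
  finally have "inner (Q f) (P f) = measure (\<nu> f) A" .
  moreover have "(norm (Q f - P f))\<^sup>2 = (norm (Q f))\<^sup>2 - 2 * inner (Q f) (P f) + (norm (P f))\<^sup>2"
    by (simp add: power2_norm_eq_inner inner_diff_left inner_diff_right inner_commute)
  ultimately show ?thesis by (simp add: spectral_projD(6)[OF P] spectral_projD(6)[OF Q])
qed

lemma spectral_proj_Un:
  assumes P: "spectral_proj P A" and Q: "spectral_proj Q B" and AB: "A \<in> sets borel" "B \<in> sets borel" "A \<inter> B = {}"
  shows "spectral_proj (\<lambda>f. P f + Q f) (A \<union> B)"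
proof -
  have "measure (\<nu> f) (A \<union> B) = inner f (P f) + inner f (Q f)" for f
    using AB finite_measure.finite_measure_Union[OF spectral_measure(1)] by (simp add: spectral_projD(5)[OF P] spectral_projD(5)[OF Q] spectral_measure(2))
  moreover have "P (Q f) = 0" "Q (P f) = 0" for f
    using spectral_proj_orthogonal[OF P Q] spectral_proj_orthogonal[OF Q P] AB by (auto simp: Int_commute)
  ultimately show ?thesis
    using sym_opD[OF spectral_projD(2)[OF P]] sym_opD[OF spectral_projD(2)[OF Q]] spectral_projD[OF P] spectral_projD[OF Q]
    by (auto simp: spectral_proj_def sym_proj_def sym_op_def scaleC_add_right inner_add_left inner_add_right sym_opD[OF sym])
qed

lemma bounded_linear_T: "0 \<le> t \<Longrightarrow> bounded_linear (T t)"
  using sym_op_bounded_clinear[OF sym contr] by (simp add: bounded_clinear_def)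

text \<open>The partial sums are the projections of the finite unions, and the squared distance of
  two of them is the measure of the part of the union between them. Countable additivity of
  \<open>\<nu> f\<close> makes them Cauchy.\<close>

lemma spectral_proj_UN:
  fixes B :: "nat \<Rightarrow> real set"
  assumes P: "\<And>n. spectral_proj (P n) (B n)" and B: "\<And>n. B n \<in> sets borel" and disj: "disjoint_family B"
  shows "\<exists>Q. spectral_proj Q (\<Union>n. B n) \<and> (\<forall>f. (\<lambda>n. P n f) sums Q f)"
proof -
  define U where "U N = (\<Union>n<N. B n)" for N
  define S where "S N f = (\<Sum>n<N. P n f)" for N f
  have UB: "U N \<in> sets borel" for N using B by (auto simp: U_def)
  have spec: "spectral_proj (S N) (U N)" for N
  proof (induction N)
    case 0
    show ?case by (simp add: S_def U_def spectral_proj_def sym_proj_def sym_op_def scaleC_0_right sym_opD(6)[OF sym])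
  next
    case (Suc N)
    have "U N \<inter> B N = {}"
      using disj by (auto simp: U_def disjoint_family_on_def) (metis disjoint_iff less_irrefl)
    from spectral_proj_Un[OF Suc.IH P UB B this] show ?case
      by (simp add: S_def U_def lessThan_Suc Un_commute add.commute)
  qed
  have UU: "(\<Union>N. U N) = (\<Union>n. B n)" by (auto simp: U_def)
  have inc: "incseq U" unfolding incseq_def U_def by (intro allI impI UN_mono) auto
  define J where "J f N = measure (\<nu> f) (\<Union>n. B n) - measure (\<nu> f) (U N)" for f N
  have mlim: "(\<lambda>N. measure (\<nu> f) (U N)) \<longlonglongrightarrow> measure (\<nu> f) (\<Union>n. B n)" for f
    using finite_measure.finite_Lim_measure_incseq[OF spectral_measure(1), of U f] UB inc by (simp add: UU spectral_measure(2) image_subset_iff)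
  have J0: "0 \<le> J f N" for f N
    unfolding J_def using UB B
    by (auto intro!: finite_measure.finite_measure_mono[OF spectral_measure(1)] simp: spectral_measure(2) U_def)
  have Jlim: "J f \<longlonglongrightarrow> 0" for f
  proof -
    have "(\<lambda>N. measure (\<nu> f) (\<Union>n. B n) - measure (\<nu> f) (U N))
        \<longlonglongrightarrow> measure (\<nu> f) (\<Union>n. B n) - measure (\<nu> f) (\<Union>n. B n)"
      by (intro tendsto_intros mlim)
    then show ?thesis by (simp add: J_def[abs_def])
  qed
  have le: "(norm (S M f - S N f))\<^sup>2 \<le> 2 * (J f M + J f N)" for M N f
  proof -
    have *: "(norm (S N f - S M f))\<^sup>2 \<le> 2 * (J f M + J f N)" if "M \<le> N" for M N
    proof -
      have "(norm (S N f - S M f))\<^sup>2 = J f M - J f N"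
        using spectral_proj_subset[OF spec spec UB UB] incseqD[OF inc that] by (simp add: J_def)
      then show ?thesis using J0[of f N] J0[of f M] by simp
    qed
    show ?thesis using *[of M N] *[of N M]
      by (cases "M \<le> N") (simp_all add: norm_minus_commute add.commute)
  qed
  define Q where "Q f = lim (\<lambda>N. S N f)" for f
  have Qlim: "(\<lambda>N. S N f) \<longlonglongrightarrow> Q f" for f
    unfolding Q_def using convergent_of_square_bound[OF Jlim le] by (simp add: convergent_LIMSEQ_iff)
  have symQ: "sym_op Q" by (rule sym_op_limit[OF spectral_projD(2)[OF spec] Qlim])
  have "inner f (Q f) = measure (\<nu> f) (\<Union>n. B n)" for f
    using tendsto_inner[OF tendsto_const Qlim, of f f] mlim[of f] LIMSEQ_unique
    by (simp add: spectral_projD(5)[OF spec])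
  moreover have "(norm (Q f))\<^sup>2 = measure (\<nu> f) (\<Union>n. B n)" for f
    using tendsto_power[OF tendsto_norm[OF Qlim], of f 2] mlim[of f] LIMSEQ_unique
    by (simp add: spectral_projD(6)[OF spec])
  moreover have "Q (T t f) = T t (Q f)" if "0 \<le> t" for t f
    using Qlim[of "T t f"] bounded_linear.tendsto[OF bounded_linear_T[OF that] Qlim[of f]] LIMSEQ_unique
    by (simp add: spectral_projD(4)[OF spec that])
  ultimately have "spectral_proj Q (\<Union>n. B n)"
    using sym_projI[OF symQ] by (simp add: spectral_proj_def)
  moreover have "(\<lambda>n. P n f) sums Q f" for f
    using Qlim[of f] by (simp add: sums_def S_def)
  ultimately show ?thesis by blast
qed

text \<open>Half lines are stable under intersection, so complements and disjoint unions suffice to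
  reach all Borel sets. This avoids intersections, whose projections are understood only after those
  of all differences are available.\<close>

lemma spectral_proj_exists:
  assumes "B \<in> sets borel"
  shows "\<exists>P. spectral_proj P B"
proof -
  have eq: "sigma_sets UNIV (range (\<lambda>a::real. {..a})) = sets borel"
    by (simp add: borel_eq_atMost)
  have "Int_stable (range (\<lambda>a::real. {..a}))" by (auto simp: Int_stable_def)
  moreover have "range (\<lambda>a::real. {..a}) \<subseteq> Pow UNIV" by simp
  moreover have "B \<in> sigma_sets UNIV (range (\<lambda>a::real. {..a}))"
    using assms eq by simp
  ultimately show ?thesis
  proof (induction rule: sigma_sets_induct_disjoint)
    case (basic A)
    then show ?case using projection_atMost by (auto simp: spectral_proj_def)
  next
    case empty
    then show ?case using spectral_proj_compl[OF spectral_proj_UNIV] by auto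
  next
    case (compl A)
    then show ?case using spectral_proj_compl[of _ A] eq by (metis Compl_eq_Diff_UNIV)
  next
    case (union A)
    then obtain P where "\<And>i. spectral_proj (P i) (A i)" by metis
    moreover have "\<And>i. A i \<in> sets borel" using union(2) eq by auto
    ultimately show ?case using spectral_proj_UN[of P A] union(1) by blast
  qed
qed

section \<open>The projection valued measure\<close>

definition E :: "real set \<Rightarrow> 'h \<Rightarrow> 'h" where
  "E B = (SOME P. spectral_proj P B)"

lemma spectral_proj_E: "B \<in> sets borel \<Longrightarrow> spectral_proj (E B) B"
  unfolding E_def by (rule someI_ex[OF spectral_proj_exists])

lemma E_eq: "spectral_proj P B \<Longrightarrow> B \<in> sets borel \<Longrightarrow> E B = P"
  by (rule spectral_proj_unique[OF spectral_proj_E])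

text \<open>Splitting A and B into the intersection and the two differences writes each projection
  as a sum of two; in the product, three of the four terms vanish by orthogonality.\<close>

lemma E_Int:
  assumes A: "A \<in> sets borel" and B: "B \<in> sets borel"
  shows "E A (E B f) = E (A \<inter> B) f"
proof -
  have eA: "E A = (\<lambda>f. E (A \<inter> B) f + E (A - B) f)"
    using spectral_proj_Un[OF spectral_proj_E spectral_proj_E, of "A \<inter> B" "A - B"] A B by (intro E_eq) (auto simp: Int_Diff_Un)
  have eB: "E B = (\<lambda>f. E (A \<inter> B) f + E (B - A) f)"
    using spectral_proj_Un[OF spectral_proj_E spectral_proj_E, of "A \<inter> B" "B - A"] A B
    by (intro E_eq) (auto simp: Int_commute[of A] Int_Diff_Un)
  have "E (A \<inter> B) (E (B - A) f) = 0" "E (A - B) (E (A \<inter> B) f) = 0" "E (A - B) (E (B - A) f) = 0"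
    using A B by (intro spectral_proj_orthogonal[OF spectral_proj_E spectral_proj_E]; auto)+
  moreover have "E (A \<inter> B) (E (A \<inter> B) f) = E (A \<inter> B) f"
    using A B by (intro spectral_projD(3)[OF spectral_proj_E]) auto
  ultimately show ?thesis
    using A B by (subst eA, subst (1 2) eB) (simp add: sym_opD(1)[OF spectral_projD(2)[OF spectral_proj_E]])
qed

lemma projection_valued_measure_E: "projection_valued_measure E"
  unfolding projection_valued_measure_def
proof (intro conjI ballI allI impI)
  show "orthogonal_projection (E B)" if "B \<in> sets borel" for B
    by (rule sym_proj_orthogonal_projection[OF spectral_projD(1)[OF spectral_proj_E[OF that]]])
  show "E {} = (\<lambda>f. 0)" using spectral_proj_compl[OF spectral_proj_UNIV] by (intro E_eq) auto
  show "E UNIV = id" using spectral_proj_UNIV by (intro E_eq) (auto simp: id_def)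
  show "E (A \<inter> B) = E A \<circ> E B" if "A \<in> sets borel" "B \<in> sets borel" for A B
    using E_Int[OF that] by auto
  show "(\<lambda>n. E (B n) f) sums E (\<Union>n. B n) f" if rB: "range B \<subseteq> sets borel" and dB: "disjoint_family B" for B f
  proof -
    have B: "B n \<in> sets borel" for n using rB by auto
    obtain Q where "spectral_proj Q (\<Union>n. B n)" "\<And>f. (\<lambda>n. E (B n) f) sums Q f"
      using spectral_proj_UN[of "\<lambda>n. E (B n)" B, OF spectral_proj_E[OF B] B dB] by blast
    then show ?thesis using E_eq[of Q "\<Union>n. B n"] B by auto
  qed
qed

lemma spectral_distribution_E: "spectral_distribution E f = \<nu> f"
proof (rule measure_eqI)
  show s: "sets (spectral_distribution E f) = sets (\<nu> f)"
    by (simp add: spectral_distribution_def spectral_measure(2) sets.sigma_sets_eq[of borel, simplified])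
  fix B assume "B \<in> sets (spectral_distribution E f)"
  then have B: "B \<in> sets borel" using s spectral_measure(2) by simp
  show "emeasure (spectral_distribution E f) B = emeasure (\<nu> f) B"
    by (simp add: emeasure_spectral_distribution[OF projection_valued_measure_E B] Re_cinner
        spectral_projD(5)[OF spectral_proj_E[OF B]] finite_measure.emeasure_eq_measure[OF spectral_measure(1)])
qed

end

section \<open>Difference quotients and the generator\<close>

lemma difference_quotient_exp_limit:
  fixes x :: real
  shows "(\<lambda>n. real (Suc n) * (1 - exp (- (1 / real (Suc n)) * x))) \<longlonglongrightarrow> x"
proof -
  have "((\<lambda>h. exp (- h * x)) has_real_derivative - x) (at 0)"
    by (auto intro!: derivative_eq_intros)
  then have "(\<lambda>h. (exp (- h * x) - 1) / h) \<midarrow>0\<rightarrow> - x"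
    by (simp add: has_field_derivative_iff)
  moreover have "(\<lambda>n. 1 / real (Suc n)) \<longlonglongrightarrow> 0"
    using LIMSEQ_inverse_real_of_nat by (simp add: inverse_eq_divide)
  then have "filterlim (\<lambda>n. 1 / real (Suc n)) (at 0) sequentially"
    by (simp add: filterlim_at del: of_nat_Suc)
  ultimately have "(\<lambda>n. (exp (- (1 / real (Suc n)) * x) - 1) / (1 / real (Suc n))) \<longlonglongrightarrow> - x"
    by (rule filterlim_compose)
  from tendsto_minus[OF this] show ?thesis by (simp add: field_simps)
qed

lemma difference_quotient_exp_bounds:
  fixes x :: real
  assumes "0 \<le> x"
  shows "0 \<le> real (Suc n) * (1 - exp (- (1 / real (Suc n)) * x))"
    "real (Suc n) * (1 - exp (- (1 / real (Suc n)) * x)) \<le> x"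
proof -
  show "0 \<le> real (Suc n) * (1 - exp (- (1 / real (Suc n)) * x))"
    using assms by (intro mult_nonneg_nonneg) auto
  have "1 - exp (- (1 / real (Suc n)) * x) \<le> x / real (Suc n)"
    using exp_ge_add_one_self[of "- (1 / real (Suc n)) * x"] by simp
  from mult_left_mono[OF this, of "real (Suc n)"]
  show "real (Suc n) * (1 - exp (- (1 / real (Suc n)) * x)) \<le> x" by simp
qed

context symmetric_contraction_semigroup
begin

text \<open>Bounded symmetric approximations of the generator. The step 1/(n + 1), rather than 1/n,
  avoids a division by zero at n = 0.\<close>

definition G :: "nat \<Rightarrow> 'h \<Rightarrow> 'h" where
  "G n f = real (Suc n) *\<^sub>R (f - T (1 / real (Suc n)) f)"

text \<open>The function of the spectral variable that corresponds to \<open>G n\<close>: the form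
  and the norm of \<open>G n f\<close> are integrals of g and of its square against
  \<open>\<nu> f\<close>.\<close>

definition g :: "nat \<Rightarrow> real \<Rightarrow> real" where
  "g n x = real (Suc n) * (1 - exp (- (1 / real (Suc n)) * x))"

lemma measurable_g [measurable]: "g n \<in> borel_measurable borel"
  unfolding g_def by measurable

lemma g_bounds:
  assumes x: "0 \<le> x"
  shows "0 \<le> g n x" "g n x \<le> x" "g n x \<le> real (Suc n)"
proof -
  show "0 \<le> g n x" "g n x \<le> x" unfolding g_def by (rule difference_quotient_exp_bounds[OF x])+
  have "real (Suc n) * (1 - exp (- (1 / real (Suc n)) * x)) \<le> real (Suc n) * 1"
    by (intro mult_left_mono) auto
  then show "g n x \<le> real (Suc n)" by (simp only: g_def mult_1_right)
qed

lemma g_lim: "(\<lambda>n. g n x) \<longlonglongrightarrow> x"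
  unfolding g_def by (rule difference_quotient_exp_limit)

lemma sym_op_G: "sym_op (G n)"
proof -
  have "sym_op (\<lambda>f. r *\<^sub>R (f - T t f))" if "0 \<le> t" for r t
    unfolding sym_op_def
    by (simp add: sym_opD[OF sym[OF that]] scaleC_scaleR scaleC_diff inner_diff_left inner_diff_right)
       (simp add: algebra_simps)
  then show ?thesis unfolding G_def[abs_def] by simp
qed

lemma norm_G_diff: "(norm (G m f - G n f))\<^sup>2 = (\<integral>x. (g m x - g n x)\<^sup>2 \<partial>\<nu> f)"
proof -
  \<comment> \<open>Index 0 belongs to the identity, which occurs m + 1 times with sign plus and n +
    1 times with sign minus.\<close>
  define c where "c i = (if i = 0 then real m - real n else if i = 1 then - real (Suc m) else real (Suc n))" for i :: nat
  define s where "s i = (if i = 0 then 0 else if i = 1 then 1 / real (Suc m) else 1 / real (Suc n))" for i :: nat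
  have "(norm (\<Sum>i<3. c i *\<^sub>R T (s i) f))\<^sup>2 = (\<integral>x. (\<Sum>i<3. c i * exp (- s i * x))\<^sup>2 \<partial>\<nu> f)"
    by (rule norm_sum_T) (auto simp: s_def)
  moreover have "(\<Sum>i<3. c i *\<^sub>R T (s i) f) = G m f - G n f"
    by (simp add: numeral_3_eq_3 c_def s_def G_def T_0 algebra_simps)
  moreover have "(\<Sum>i<3. c i * exp (- s i * x)) = g m x - g n x" for x
    by (simp add: numeral_3_eq_3 c_def s_def g_def algebra_simps)
  ultimately show ?thesis by simp
qed

lemma norm_G: "(norm (G n f))\<^sup>2 = (\<integral>x. (g n x)\<^sup>2 \<partial>\<nu> f)"
proof -
  define c where "c i = (if i = 0 then real (Suc n) else - real (Suc n))" for i :: nat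
  define s where "s i = (if i = 0 then 0 else 1 / real (Suc n))" for i :: nat
  have "(norm (\<Sum>i<2. c i *\<^sub>R T (s i) f))\<^sup>2 = (\<integral>x. (\<Sum>i<2. c i * exp (- s i * x))\<^sup>2 \<partial>\<nu> f)"
    by (rule norm_sum_T) (auto simp: s_def)
  moreover have "(\<Sum>i<2. c i *\<^sub>R T (s i) f) = G n f"
    by (simp add: numeral_2_eq_2 c_def s_def G_def T_0 algebra_simps)
  moreover have "(\<Sum>i<2. c i * exp (- s i * x)) = g n x" for x
    by (simp add: numeral_2_eq_2 c_def s_def g_def algebra_simps)
  ultimately show ?thesis by simp
qed

lemma inner_G: "inner f (G n f) = (\<integral>x. g n x \<partial>\<nu> f)"
proof -
  have "(\<integral>x. g n x \<partial>\<nu> f) = real (Suc n) * ((\<integral>x. exp (- 0 * x) \<partial>\<nu> f) - (\<integral>x. exp (- (1 / real (Suc n)) * x) \<partial>\<nu> f))"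
    unfolding g_def using integrable_exp[of 0 f] integrable_exp[of "1 / real (Suc n)" f]
    by (subst Bochner_Integration.integral_diff[symmetric]) auto
  also have "\<dots> = inner f (G n f)"
    by (subst (1 2) spectral_measure(4)) (auto simp: G_def T_0 inner_diff_right)
  finally show ?thesis ..
qed

definition D :: "'h set" where
  "D = {f. integrable (\<nu> f) (\<lambda>x. x\<^sup>2)}"

text \<open>Outside \<open>D\<close> the sequence is unbounded, hence divergent, and the value is
  unspecified.\<close>

definition K :: "'h \<Rightarrow> 'h" where
  "K f = lim (\<lambda>n. G n f)"

lemma integrable_g2: "integrable (\<nu> f) (\<lambda>x. (g n x)\<^sup>2)"
proof (rule integrable_\<nu>_bounded)
  fix x :: real assume "0 \<le> x"
  then show "\<bar>(g n x)\<^sup>2\<bar> \<le> (real (Suc n))\<^sup>2" using g_bounds[of x n] by (simp add: power_mono)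
qed measurable

text \<open>By 0 \<le> g n x \<le> x the square x^2, integrable by the choice of the domain,
  dominates (g n x - x)^2. Convergence of g to the identity in L2 of \<open>\<nu> f\<close> makes
  \<open>G n f\<close> Cauchy.\<close>

lemma K_lim:
  assumes f: "f \<in> D"
  shows "(\<lambda>n. G n f) \<longlonglongrightarrow> K f"
proof -
  define J where "J n = (\<integral>x. (g n x - x)\<^sup>2 \<partial>\<nu> f)" for n
  have int: "integrable (\<nu> f) (\<lambda>x. x\<^sup>2)" using f by (simp add: D_def)
  have bd: "(g n x - x)\<^sup>2 \<le> x\<^sup>2" if "0 \<le> x" for n x
    using power_mono[of "x - g n x" x 2] g_bounds[OF that, of n] by (simp add: power2_commute)
  have intg: "integrable (\<nu> f) (\<lambda>x. (g n x - x)\<^sup>2)" for n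
  proof (rule Bochner_Integration.integrable_bound[OF int])
    show "AE x in \<nu> f. norm ((g n x - x)\<^sup>2) \<le> norm (x\<^sup>2)"
      using spectral_measure(3)[of f] by eventually_elim (simp add: bd)
  qed (simp add: measurable_\<nu>_iff)
  have "(\<lambda>n. \<integral>x. (g n x - x)\<^sup>2 \<partial>\<nu> f) \<longlonglongrightarrow> (\<integral>x. 0 \<partial>\<nu> f)"
  proof (rule integral_dominated_convergence[where w = "\<lambda>x. x\<^sup>2"])
    show "AE x in \<nu> f. (\<lambda>n. (g n x - x)\<^sup>2) \<longlonglongrightarrow> 0"
    proof (rule AE_I2)
      fix x
      show "(\<lambda>n. (g n x - x)\<^sup>2) \<longlonglongrightarrow> 0"
        using tendsto_power[OF tendsto_diff[OF g_lim[of x] tendsto_const[of x]], of 2] by simp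
    qed
    show "AE x in \<nu> f. norm ((g n x - x)\<^sup>2) \<le> x\<^sup>2" for n
      using spectral_measure(3)[of f] by eventually_elim (simp add: bd)
  qed (auto simp: measurable_\<nu>_iff int)
  then have Jlim: "J \<longlonglongrightarrow> 0" by (simp add: J_def[abs_def])
  have "(norm (G m f - G n f))\<^sup>2 \<le> 2 * (J m + J n)" for m n
  proof -
    have *: "(g m x - g n x)\<^sup>2 \<le> 2 * ((g m x - x)\<^sup>2 + (g n x - x)\<^sup>2)" for x
      using sum_squares_bound[of "g m x - x" "- (g n x - x)"]
      by (simp add: power2_eq_square algebra_simps)
    have "(norm (G m f - G n f))\<^sup>2 \<le> (\<integral>x. 2 * ((g m x - x)\<^sup>2 + (g n x - x)\<^sup>2) \<partial>\<nu> f)"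
      unfolding norm_G_diff
    proof (rule integral_mono)
      show "integrable (\<nu> f) (\<lambda>x. (g m x - g n x)\<^sup>2)"
        by (rule Bochner_Integration.integrable_bound[of _ "\<lambda>x. 2 * ((g m x - x)\<^sup>2 + (g n x - x)\<^sup>2)"])
          (use intg * in \<open>auto simp: measurable_\<nu>_iff\<close>)
    qed (use intg * in auto)
    also have "\<dots> = 2 * (J m + J n)" by (simp add: J_def intg)
    finally show ?thesis .
  qed
  from convergent_of_square_bound[OF Jlim this] show ?thesis
    unfolding K_def by (simp add: convergent_LIMSEQ_iff)
qed

lemma D_integrable_id:
  assumes "f \<in> D"
  shows "integrable (\<nu> f) (\<lambda>x. x)"
proof (rule Bochner_Integration.integrable_bound)
  show "integrable (\<nu> f) (\<lambda>x. 1 + x\<^sup>2)"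
    using assms integrable_exp[of 0 f] by (simp add: D_def)
  have "\<bar>x\<bar> \<le> 1 + x\<^sup>2" for x :: real
  proof -
    have "2 * \<bar>x\<bar> * 1 \<le> \<bar>x\<bar>\<^sup>2 + 1\<^sup>2" by (rule sum_squares_bound)
    then show ?thesis by simp
  qed
  then show "AE x in \<nu> f. norm x \<le> norm (1 + x\<^sup>2)" by (simp add: add_nonneg_nonneg)
qed (simp add: measurable_\<nu>_iff)

lemma inner_K:
  assumes f: "f \<in> D"
  shows "inner f (K f) = (\<integral>x. x \<partial>\<nu> f)"
proof (rule LIMSEQ_unique)
  show "(\<lambda>n. inner f (G n f)) \<longlonglongrightarrow> inner f (K f)" by (intro tendsto_intros K_lim f)
  show "(\<lambda>n. inner f (G n f)) \<longlonglongrightarrow> (\<integral>x. x \<partial>\<nu> f)"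
    unfolding inner_G
  proof (rule integral_dominated_convergence[where w = "\<lambda>x. \<bar>x\<bar>"])
    show "AE x in \<nu> f. norm (g n x) \<le> \<bar>x\<bar>" for n
      using spectral_measure(3)[of f] by eventually_elim (simp add: g_bounds)
    show "integrable (\<nu> f) (\<lambda>x. \<bar>x\<bar>)" using D_integrable_id[OF f] by (rule integrable_abs)
    show "AE x in \<nu> f. (\<lambda>n. g n x) \<longlonglongrightarrow> x" by (intro AE_I2 g_lim)
  qed (simp_all add: measurable_\<nu>_iff)
qed

text \<open>The difference quotients approximate from below, g n x \<le> x, so their L2 norms are
  dominated by that of the identity, which is the norm of \<open>K f\<close>.\<close>

lemma norm_G_le_K:
  assumes f: "f \<in> D"
  shows "norm (G n f) \<le> norm (K f)"
proof -
  have "(\<lambda>n. (norm (G n f))\<^sup>2) \<longlonglongrightarrow> (\<integral>x. x\<^sup>2 \<partial>\<nu> f)"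
    unfolding norm_G
  proof (rule integral_dominated_convergence[where w = "\<lambda>x. x\<^sup>2"])
    show "AE x in \<nu> f. norm ((g n x)\<^sup>2) \<le> x\<^sup>2" for n
      using spectral_measure(3)[of f] by eventually_elim (simp add: g_bounds power_mono)
    show "AE x in \<nu> f. (\<lambda>n. (g n x)\<^sup>2) \<longlonglongrightarrow> x\<^sup>2"
      by (intro AE_I2 tendsto_intros g_lim)
  qed (use f in \<open>auto simp: measurable_\<nu>_iff D_def\<close>)
  moreover have "(\<lambda>n. (norm (G n f))\<^sup>2) \<longlonglongrightarrow> (norm (K f))\<^sup>2"
    by (intro tendsto_intros K_lim f)
  ultimately have K: "(norm (K f))\<^sup>2 = (\<integral>x. x\<^sup>2 \<partial>\<nu> f)" using LIMSEQ_unique by blast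
  have "(norm (G n f))\<^sup>2 \<le> (norm (K f))\<^sup>2"
    unfolding norm_G K
  proof (rule integral_mono_AE)
    show "AE x in \<nu> f. (g n x)\<^sup>2 \<le> x\<^sup>2"
      using spectral_measure(3)[of f] by eventually_elim (simp add: g_bounds power_mono)
  qed (use f integrable_g2 in \<open>auto simp: D_def\<close>)
  then show ?thesis by (simp add: power2_le_iff_abs_le)
qed

text \<open>Fatou's lemma bounds the second moment. Together with the bound of \<open>G n f\<close>
  by \<open>K f\<close> this describes the domain by norms of linear operators, so that it is seen
  to be a subspace although \<open>\<nu> (f + h)\<close> is not computed from \<open>\<nu> f\<close>
  and \<open>\<nu> h\<close>.\<close>

lemma D_of_bounded:
  assumes bd: "\<And>n. norm (G n f) \<le> C"
  shows "f \<in> D"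
proof -
  have nn: "(\<integral>\<^sup>+ x. ennreal ((g n x)\<^sup>2) \<partial>\<nu> f) \<le> ennreal (C\<^sup>2)" for n
    using integrable_g2 bd[of n]
    by (subst nn_integral_eq_integral) (auto simp: norm_G[symmetric] intro!: ennreal_leI power_mono)
  have "(\<integral>\<^sup>+ x. ennreal (x\<^sup>2) \<partial>\<nu> f) = (\<integral>\<^sup>+ x. liminf (\<lambda>n. ennreal ((g n x)\<^sup>2)) \<partial>\<nu> f)"
  proof (rule nn_integral_cong)
    fix x
    have "(\<lambda>n. ennreal ((g n x)\<^sup>2)) \<longlonglongrightarrow> ennreal (x\<^sup>2)"
      by (intro tendsto_ennrealI tendsto_intros g_lim)
    from lim_imp_Liminf[OF _ this] show "ennreal (x\<^sup>2) = liminf (\<lambda>n. ennreal ((g n x)\<^sup>2))" by simp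
  qed
  also have "\<dots> \<le> liminf (\<lambda>n. \<integral>\<^sup>+ x. ennreal ((g n x)\<^sup>2) \<partial>\<nu> f)"
    by (rule nn_integral_liminf) (simp add: measurable_\<nu>_iff)
  also have "\<dots> \<le> ennreal (C\<^sup>2)"
    by (rule Liminf_le) (simp_all add: nn)
  finally have "(\<integral>\<^sup>+ x. ennreal (x\<^sup>2) \<partial>\<nu> f) < \<infinity>"
    by (rule le_less_trans) simp
  then show ?thesis
    by (simp add: D_def integrable_iff_bounded measurable_\<nu>_iff)
qed

lemma csubspace_D: "csubspace D"
  unfolding csubspace_def
proof (intro conjI ballI allI)
  show "0 \<in> D" by (rule D_of_bounded[of _ 0]) (simp add: sym_opD(6)[OF sym_op_G])
  fix f assume f: "f \<in> D"
  show "f + h \<in> D" if h: "h \<in> D" for h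
    using norm_triangle_mono[OF norm_G_le_K[OF f] norm_G_le_K[OF h]]
    by (intro D_of_bounded[of _ "norm (K f) + norm (K h)"]) (simp add: sym_opD(1)[OF sym_op_G])
  show "c *\<^sub>C f \<in> D" for c
    using norm_G_le_K[OF f]
    by (intro D_of_bounded[of _ "cmod c * norm (K f)"]) (simp add: sym_opD(2)[OF sym_op_G] norm_scaleC mult_left_mono)
qed

lemma D_add: "f \<in> D \<Longrightarrow> h \<in> D \<Longrightarrow> f + h \<in> D" and D_scaleC: "f \<in> D \<Longrightarrow> c *\<^sub>C f \<in> D"
  using csubspace_D by (auto simp: csubspace_def)

lemma clinear_on_K: "clinear_on D K"
  unfolding clinear_on_def
proof (intro conjI ballI allI)
  fix f h assume f: "f \<in> D" and h: "h \<in> D"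
  have "(\<lambda>n. G n (f + h)) \<longlonglongrightarrow> K f + K h"
    using tendsto_add[OF K_lim[OF f] K_lim[OF h]] by (simp add: sym_opD(1)[OF sym_op_G])
  then show "K (f + h) = K f + K h"
    using LIMSEQ_unique[OF K_lim[OF D_add[OF f h]]] by blast
next
  fix f c assume f: "f \<in> D"
  have "(\<lambda>n. G n (c *\<^sub>C f)) \<longlonglongrightarrow> c *\<^sub>C K f"
    using tendsto_scaleC[OF K_lim[OF f]] by (simp add: sym_opD(2)[OF sym_op_G])
  then show "K (c *\<^sub>C f) = c *\<^sub>C K f"
    using LIMSEQ_unique[OF K_lim[OF D_scaleC[OF f]]] by blast
qed

lemma inner_K_sym:
  assumes f: "f \<in> D" and h: "h \<in> D"
  shows "inner (K f) h = inner f (K h)"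
proof (rule LIMSEQ_unique)
  show "(\<lambda>n. inner (G n f) h) \<longlonglongrightarrow> inner (K f) h" by (intro tendsto_intros K_lim f)
  show "(\<lambda>n. inner (G n f) h) \<longlonglongrightarrow> inner f (K h)"
    unfolding sym_opD(3)[OF sym_op_G] by (intro tendsto_intros K_lim h)
qed

lemma cinner_K_sym:
  assumes f: "f \<in> D" and h: "h \<in> D"
  shows "cinner (K f) h = cinner f (K h)"
proof -
  have "K (\<i> *\<^sub>C h) = \<i> *\<^sub>C K h" using clinear_on_K h unfolding clinear_on_def by blast
  then show ?thesis
    using inner_K_sym[OF f h] inner_K_sym[OF f D_scaleC[OF h, of \<i>]] by (simp only: cinner_eq_Complex)
qed

lemma cinner_K:
  assumes f: "f \<in> D"
  shows "cinner f (K f) = complex_of_real (\<integral>x. x \<partial>\<nu> f)"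
proof -
  have "cinner f (K f) = cnj (cinner f (K f))"
    using cinner_commute[of f "K f"] by (simp add: cinner_K_sym[OF f f])
  from arg_cong[OF this, of Im] have "Im (cinner f (K f)) = 0" by simp
  then show ?thesis by (simp add: complex_eq_iff Re_cinner inner_K[OF f])
qed

definition Em :: "nat \<Rightarrow> 'h \<Rightarrow> 'h" where
  "Em m = E {..real m}"

lemma spectral_proj_Em: "spectral_proj (Em m) {..real m}"
  unfolding Em_def by (rule spectral_proj_E) simp

text \<open>The spectral measure of a vector in the range of \<open>Em m\<close> has no mass beyond
  m, so x^2 is essentially bounded by m^2. Thus the cutoffs map everything into the domain; as they
  tend strongly to the identity, the domain is dense.\<close>

lemma Em_in_D: "Em m f \<in> D"
proof -
  have "measure (\<nu> (Em m f)) {real m<..} = inner (Em m f) (E {real m<..} (Em m f))"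
    by (rule spectral_projD(5)[OF spectral_proj_E, symmetric]) simp
  also have "E {real m<..} (Em m f) = 0"
    by (rule spectral_proj_orthogonal[OF spectral_proj_E spectral_proj_Em]) auto
  finally have "measure (\<nu> (Em m f)) {real m<..} = 0" by simp
  then have "AE x in \<nu> (Em m f). x \<notin> {real m<..}"
    by (intro AE_not_in) (simp add: null_sets_def spectral_measure(2) finite_measure.emeasure_eq_measure[OF spectral_measure(1)])
  then have "AE x in \<nu> (Em m f). norm (x\<^sup>2) \<le> (real m)\<^sup>2"
    using spectral_measure(3)[of "Em m f"] by eventually_elim (simp add: power_mono)
  then have "integrable (\<nu> (Em m f)) (\<lambda>x. x\<^sup>2)"
    by (rule finite_measure.integrable_const_bound[OF spectral_measure(1)]) (simp add: measurable_\<nu>_iff)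
  then show ?thesis by (simp add: D_def)
qed

lemma Em_lim: "(\<lambda>m. Em m f) \<longlonglongrightarrow> f"
proof -
  have "(\<lambda>m. measure (\<nu> f) {..real m}) \<longlonglongrightarrow> measure (\<nu> f) (\<Union>m. {..real m})"
    by (rule finite_measure.finite_Lim_measure_incseq[OF spectral_measure(1)]) (auto simp: spectral_measure(2) incseq_def)
  moreover have "(\<Union>m. {..real m}) = UNIV" using real_arch_simple by blast
  ultimately have "(\<lambda>m. measure (\<nu> f) UNIV - measure (\<nu> f) {..real m}) \<longlonglongrightarrow> 0"
    using tendsto_diff[OF tendsto_const, of _ "measure (\<nu> f) UNIV" sequentially "measure (\<nu> f) UNIV"] by simp
  moreover have "(norm (f - Em m f))\<^sup>2 = measure (\<nu> f) UNIV - measure (\<nu> f) {..real m}" for m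
    by (rule spectral_proj_subset[OF spectral_proj_Em spectral_proj_UNIV]) auto
  ultimately have "(\<lambda>m. (norm (f - Em m f))\<^sup>2) \<longlonglongrightarrow> 0" by simp
  from tendsto_real_sqrt[OF this] have "(\<lambda>m. norm (Em m f - f)) \<longlonglongrightarrow> 0"
    by (simp add: norm_minus_commute)
  then show ?thesis by (simp add: LIM_zero_iff tendsto_norm_zero_iff)
qed

lemma Em_G: "Em m (G n f) = G n (Em m f)"
  by (simp add: G_def sym_opD[OF spectral_projD(2)[OF spectral_proj_Em]] spectral_projD(4)[OF spectral_proj_Em])

text \<open>The cutoff commutes with each \<open>G n\<close>, hence with the limit: the range of the
  cutoff is invariant under K.\<close>

lemma Em_K: "Em m (K (Em m f)) = K (Em m f)"
proof (rule LIMSEQ_unique)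
  have "bounded_linear (Em m)"
    using sym_op_bounded_clinear[OF spectral_projD(2)[OF spectral_proj_Em] sym_proj_norm(2)[OF spectral_projD(1)[OF spectral_proj_Em]]]
    by (simp add: bounded_clinear_def)
  from bounded_linear.tendsto[OF this K_lim[OF Em_in_D[of m f]]]
  show "(\<lambda>n. G n (Em m f)) \<longlonglongrightarrow> Em m (K (Em m f))"
    by (simp add: Em_G spectral_projD(3)[OF spectral_proj_Em])
  show "(\<lambda>n. G n (Em m f)) \<longlonglongrightarrow> K (Em m f)" by (rule K_lim[OF Em_in_D])
qed

text \<open>The point is that (h, k) in the adjoint graph forces h into the domain. Testing with cut
  off vectors gives \<open>K (Em m h) = Em m k\<close>, so the norm of \<open>G n (Em m h)\<close>
  is at most that of k, uniformly in m and n. Letting m grow leaves a bound on \<open>G n h\<close>,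
  which characterizes the domain; density then yields k = K h.\<close>

lemma self_adjoint_on_K: "self_adjoint_on D K"
  unfolding self_adjoint_on_def
proof (intro conjI csubspace_D clinear_on_K)
  show "closure D = UNIV"
  proof -
    have "f \<in> closure D" for f
      unfolding closure_sequential
      by (rule exI[of _ "\<lambda>m. Em m f"]) (intro conjI allI Em_in_D Em_lim)
    then show ?thesis by blast
  qed
  have *: "h \<in> D \<and> k = K h" if adj: "\<forall>f\<in>D. cinner (K f) h = cinner f k" for h k
  proof -
    have inn: "inner (K f) h = inner f k" if "f \<in> D" for f
      using adj that by (metis Re_cinner)
    have K_Em: "K (Em m h) = Em m k" for m
    proof -
      have "inner f (K (Em m h)) = inner f (Em m k)" for f
      proof -
        note sEm = sym_opD(3)[OF spectral_projD(2)[OF spectral_proj_Em]]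
        have "inner f (Em m k) = inner (K (Em m f)) h"
          by (simp add: inn[OF Em_in_D] sEm)
        also have "\<dots> = inner (K (Em m f)) (Em m h)"
          by (subst Em_K[symmetric]) (rule sEm)
        also have "\<dots> = inner f (Em m (K (Em m h)))"
          by (simp add: inner_K_sym[OF Em_in_D Em_in_D] sEm)
        finally show ?thesis by (simp add: Em_K)
      qed
      then have "inner (K (Em m h) - Em m k) (K (Em m h) - Em m k) = 0"
        by (simp add: inner_diff_right)
      then show ?thesis by simp
    qed
    have "norm (G n h) \<le> norm k" for n
    proof (rule LIMSEQ_le_const2)
      have "bounded_linear (G n)"
        unfolding G_def by (intro bounded_linear_const_scaleR bounded_linear_sub bounded_linear_ident bounded_linear_T) auto
      from bounded_linear.tendsto[OF this Em_lim]
      show "(\<lambda>m. norm (G n (Em m h))) \<longlonglongrightarrow> norm (G n h)" by (rule tendsto_norm)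
      show "\<exists>N. \<forall>m\<ge>N. norm (G n (Em m h)) \<le> norm k"
        using norm_G_le_K[OF Em_in_D, of n _ h] sym_proj_norm(2)[OF spectral_projD(1)[OF spectral_proj_Em], of _ k]
        unfolding K_Em using order_trans by blast
    qed
    then have h: "h \<in> D" by (rule D_of_bounded)
    have "inner f (K h - k) = 0" for f
    proof (rule LIMSEQ_unique)
      show "(\<lambda>m. inner (Em m f) (K h - k)) \<longlonglongrightarrow> inner f (K h - k)"
        by (intro tendsto_intros Em_lim)
      show "(\<lambda>m. inner (Em m f) (K h - k)) \<longlonglongrightarrow> 0"
        using inn[OF Em_in_D] inner_K_sym[OF Em_in_D h] by (simp add: inner_diff_right)
    qed
    then have "K h - k = 0" using inner_eq_zero_iff by blast
    then show ?thesis using h by simp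
  qed
  show "adjoint_graph D K = (\<lambda>f. (f, K f)) ` D"
  proof (intro equalityI subsetI)
    fix p assume "p \<in> adjoint_graph D K"
    then obtain h k where "p = (h, k)" "\<forall>f\<in>D. cinner (K f) h = cinner f k"
      unfolding adjoint_graph_def by blast
    with *[of h k] show "p \<in> (\<lambda>f. (f, K f)) ` D" by simp
  next
    fix p assume "p \<in> (\<lambda>f. (f, K f)) ` D"
    then obtain h where "p = (h, K h)" "h \<in> D" by blast
    then show "p \<in> adjoint_graph D K"
      unfolding adjoint_graph_def using cinner_K_sym by simp
  qed
qed

theorem generator_exists:
  "\<exists>D K. self_adjoint_on D K \<and> bounded_from_below_on D K \<and>
     (\<forall>t\<ge>0. is_function_of_operator (\<lambda>x. exp (- t * x)) D K UNIV (T t))"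
proof (intro exI[of _ D] exI[of _ K] conjI allI impI)
  show "self_adjoint_on D K" by (rule self_adjoint_on_K)
  have "0 \<le> inner f (K f)" if "f \<in> D" for f
    unfolding inner_K[OF that] using spectral_measure(3) by (rule integral_nonneg_AE)
  then show "bounded_from_below_on D K"
    unfolding bounded_from_below_on_def by (intro exI[of _ 0]) (simp add: Re_cinner)
  fix t :: real assume t: "0 \<le> t"
  have "has_spectral_integral E (\<lambda>x. x) D K"
    unfolding has_spectral_integral_def spectral_distribution_E
    using clinear_on_K cinner_K by (simp add: D_def)
  moreover have "has_spectral_integral E (\<lambda>x. exp (- t * x)) UNIV (T t)"
    unfolding has_spectral_integral_def spectral_distribution_E
  proof (intro conjI ballI)
    have "integrable (\<nu> f) (\<lambda>x. (exp (- t * x))\<^sup>2)" for f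
      using integrable_exp[of "2 * t" f] t by (simp add: power2_eq_square mult_exp_exp ac_simps)
    then show "UNIV = {f. integrable (\<nu> f) (\<lambda>x. (exp (- t * x))\<^sup>2)}" by simp
    show "clinear_on UNIV (T t)" using sym_opD[OF sym[OF t]] by (auto simp: clinear_on_def)
    show "cinner f (T t f) = complex_of_real (\<integral>x. exp (- t * x) \<partial>\<nu> f)" for f
      by (simp only: sym_op_cinner_self[OF sym[OF t]] spectral_measure(4)[OF t])
  qed
  ultimately show "is_function_of_operator (\<lambda>x. exp (- t * x)) D K UNIV (T t)"
    unfolding is_function_of_operator_def using projection_valued_measure_E by blast
qed

end

section \<open>The Hilbert space of square integrable functions\<close>

lemma L2_rel_refl: "L2_rel f f \<longleftrightarrow> f \<in> square_integrable"
  by (auto simp: L2_rel_def)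

lemma L2_class_rep: "L2_class (rep_L2 F) = F"
  by (rule Quotient3_abs_rep[OF Quotient3_L2])

lemma rep_L2_square_integrable: "rep_L2 F \<in> square_integrable"
  using Quotient3_rep_reflp[OF Quotient3_L2, of F] by (simp add: L2_rel_refl)

lemma L2_class_eq_iff:
  assumes "f \<in> square_integrable" "g \<in> square_integrable"
  shows "L2_class f = L2_class g \<longleftrightarrow> (AE x in lborel. f x = g x)"
proof -
  have "L2_rel f g \<longleftrightarrow> L2_class f = L2_class g"
    using Quotient3_rel[OF Quotient3_L2, of f g] assms by (simp only: L2_rel_refl simp_thms)
  then show ?thesis using assms by (simp only: L2_rel_def simp_thms)
qed

lemma rep_L2_class_AE:
  assumes "f \<in> square_integrable"
  shows "AE x in lborel. rep_L2 (L2_class f) x = f x"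
  by (rule L2_class_eq_iff[THEN iffD1, OF rep_L2_square_integrable assms L2_class_rep])

lemma L2_class_add:
  assumes "f \<in> square_integrable" "g \<in> square_integrable"
  shows "L2_class f + L2_class g = L2_class (\<lambda>x. f x + g x)"
  by (rule plus_L2.abs_eq) (simp_all only: L2_rel_refl assms)

lemma L2_class_scaleC:
  assumes "f \<in> square_integrable"
  shows "c *\<^sub>C L2_class f = L2_class (\<lambda>x. c * f x)"
  by (rule scaleC_L2.abs_eq) (simp_all only: L2_rel_refl assms)

lemma L2_class_diff:
  assumes "f \<in> square_integrable" "g \<in> square_integrable"
  shows "L2_class f - L2_class g = L2_class (\<lambda>x. f x - g x)"
  unfolding minus_L2_def uminus_L2_def L2_class_scaleC[OF assms(2)]
    L2_class_add[OF assms(1) square_integrable_scale[OF assms(2)]]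
  by (simp only: mult_minus1 add_uminus_conv_diff)

lemma cinner_L2_class:
  assumes "f \<in> square_integrable" "g \<in> square_integrable"
  shows "cinner (L2_class f) (L2_class g) = (\<integral>x. cnj (f x) * g x \<partial>lborel)"
  by (rule cinner_L2.abs_eq) (simp_all only: L2_rel_refl assms)

lemma square_integrable_measurable: "f \<in> square_integrable \<Longrightarrow> f \<in> borel_measurable borel"
  by (simp add: square_integrable_def)

lemma norm_L2_class:
  assumes f: "f \<in> square_integrable"
  shows "(norm (L2_class f))\<^sup>2 = (\<integral>x. (cmod (f x))\<^sup>2 \<partial>lborel)"
    and "ennreal ((norm (L2_class f))\<^sup>2) = (\<integral>\<^sup>+ x. ennreal ((cmod (f x))\<^sup>2) \<partial>lborel)"
proof -
  have cs: "cnj z * z = complex_of_real ((cmod z)\<^sup>2)" for z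
    by (metis complex_norm_square mult.commute of_real_power)
  show 1: "(norm (L2_class f))\<^sup>2 = (\<integral>x. (cmod (f x))\<^sup>2 \<partial>lborel)"
    unfolding power2_norm_eq_inner Re_cinner[symmetric] cinner_L2_class[OF f f] cs
    by (simp only: integral_complex_of_real Re_complex_of_real)
  show "ennreal ((norm (L2_class f))\<^sup>2) = (\<integral>\<^sup>+ x. ennreal ((cmod (f x))\<^sup>2) \<partial>lborel)"
    unfolding 1 using f by (intro nn_integral_eq_integral[symmetric]) (auto simp: square_integrable_def)
qed

lemma square_integrableI:
  assumes "f \<in> borel_measurable borel" "(\<integral>\<^sup>+ x. ennreal ((cmod (f x))\<^sup>2) \<partial>lborel) < \<infinity>"
  shows "f \<in> square_integrable"
  unfolding square_integrable_def using assms by (simp add: integrable_iff_bounded)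

lemma norm_L2_class_le:
  assumes f: "f \<in> square_integrable" and C: "0 \<le> C"
    and le: "(\<integral>\<^sup>+ x. ennreal ((cmod (f x))\<^sup>2) \<partial>lborel) \<le> ennreal (C\<^sup>2)"
  shows "norm (L2_class f) \<le> C"
proof -
  have "(norm (L2_class f))\<^sup>2 \<le> C\<^sup>2" using le unfolding norm_L2_class(2)[OF f, symmetric] by simp
  then show ?thesis using C by (rule power2_le_imp_le)
qed

section \<open>Completeness: the Riesz-Fischer theorem\<close>

lemma square_integrable_of_real_norm:
  "f \<in> square_integrable \<Longrightarrow> (\<lambda>x. complex_of_real (cmod (f x))) \<in> square_integrable"
  by (auto simp: square_integrable_def)

lemma square_integrable_diff:
  assumes "f \<in> square_integrable" "g \<in> square_integrable"
  shows "(\<lambda>x. f x - g x) \<in> square_integrable"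
  using square_integrable_add[OF assms(1) square_integrable_scale[OF assms(2), of "-1"]]
  by (simp only: mult_minus1 add_uminus_conv_diff)

text \<open>The partial sums of the absolute increments have L2 norm at most \<Sum> 2^(-k) \<le> 2.
  By monotone convergence their supremum has square integral at most 4, hence is finite almost
  everywhere.\<close>

lemma L2_geometric_Cauchy_AE_summable:
  fixes f :: "nat \<Rightarrow> 'a::euclidean_space \<Rightarrow> complex"
  assumes f: "\<And>k. f k \<in> square_integrable"
    and le: "\<And>k. norm (L2_class (f (Suc k)) - L2_class (f k)) \<le> (1/2) ^ k"
  shows "AE x in lborel. summable (\<lambda>k. cmod (f (Suc k) x - f k x))"
proof -
  define d where "d k x = cmod (f (Suc k) x - f k x)" for k x
  define S where "S n x = (\<Sum>k<n. d k x)" for n x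
  have [measurable]: "f k \<in> borel_measurable borel" for k
    using f by (simp add: square_integrable_def)
  have d: "(\<lambda>x. complex_of_real (d k x)) \<in> square_integrable" for k
    unfolding d_def by (intro square_integrable_of_real_norm square_integrable_diff f)
  have nd: "norm (L2_class (\<lambda>x. complex_of_real (d k x))) \<le> (1/2) ^ k" for k
  proof -
    have "(norm (L2_class (\<lambda>x. complex_of_real (d k x))))\<^sup>2 = (norm (L2_class (f (Suc k)) - L2_class (f k)))\<^sup>2"
      unfolding norm_L2_class(1)[OF d] L2_class_diff[OF f f] norm_L2_class(1)[OF square_integrable_diff[OF f f]]
      by (simp add: d_def)
    then have "norm (L2_class (\<lambda>x. complex_of_real (d k x))) = norm (L2_class (f (Suc k)) - L2_class (f k))"
      by (simp add: power2_eq_iff_nonneg)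
    then show ?thesis using le by simp
  qed
  have S: "(\<lambda>x. complex_of_real (S n x)) \<in> square_integrable \<and>
      norm (L2_class (\<lambda>x. complex_of_real (S n x))) \<le> (\<Sum>k<n. (1/2) ^ k)" for n
  proof (induction n)
    case 0
    have "L2_class (\<lambda>x::'a. 0) = 0" by (simp add: zero_L2_def)
    then show ?case by (simp add: S_def square_integrable_zero)
  next
    case (Suc n)
    have "L2_class (\<lambda>x. complex_of_real (S (Suc n) x)) = L2_class (\<lambda>x. complex_of_real (S n x)) + L2_class (\<lambda>x. complex_of_real (d n x))"
      using Suc.IH d by (simp add: L2_class_add S_def)
    moreover have "(\<lambda>x. complex_of_real (S (Suc n) x)) \<in> square_integrable"
      using square_integrable_add[OF conjunct1[OF Suc.IH] d[of n]] by (simp add: S_def)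
    ultimately show ?case
      using norm_triangle_mono[OF conjunct2[OF Suc.IH] nd[of n]] by simp
  qed
  have sum2: "(\<Sum>k<n. (1/2) ^ k) \<le> (2::real)" for n
    by (simp add: geometric_sum)
  have "(\<integral>\<^sup>+ x. ennreal ((S n x)\<^sup>2) \<partial>lborel) \<le> 4" for n
  proof -
    have "(\<integral>\<^sup>+ x. ennreal ((S n x)\<^sup>2) \<partial>lborel) = ennreal ((norm (L2_class (\<lambda>x. complex_of_real (S n x))))\<^sup>2)"
      using norm_L2_class(2)[OF conjunct1[OF S[of n]]] by simp
    also have "\<dots> \<le> ennreal (2\<^sup>2)"
      using S[of n] sum2[of n] by (intro ennreal_leI power_mono) (auto intro: order_trans)
    finally show ?thesis by simp
  qed
  then have "(SUP n. \<integral>\<^sup>+ x. ennreal ((S n x)\<^sup>2) \<partial>lborel) \<le> 4" by (rule SUP_least)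
  moreover have S0: "0 \<le> S n x" and Smono: "m \<le> n \<Longrightarrow> S m x \<le> S n x" for m n x
    by (auto simp: S_def d_def intro!: sum_nonneg sum_mono2)
  have "(\<integral>\<^sup>+ x. (SUP n. ennreal ((S n x)\<^sup>2)) \<partial>lborel) = (SUP n. \<integral>\<^sup>+ x. ennreal ((S n x)\<^sup>2) \<partial>lborel)"
    using S0 Smono
    by (intro nn_integral_monotone_convergence_SUP)
       (auto simp: incseq_def le_fun_def S_def d_def intro!: ennreal_leI power_mono sum_nonneg sum_mono2)
  ultimately have "(\<integral>\<^sup>+ x. (SUP n. ennreal ((S n x)\<^sup>2)) \<partial>lborel) \<noteq> \<infinity>"
    by (metis ennreal_numeral ennreal_neq_top neq_top_trans infinity_ennreal_def)
  then have "AE x in lborel. (SUP n. ennreal ((S n x)\<^sup>2)) \<noteq> \<infinity>"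
    by (intro nn_integral_PInf_AE) (simp_all add: S_def d_def)
  then show ?thesis
  proof eventually_elim
    case (elim x)
    then obtain B where B: "(SUP n. ennreal ((S n x)\<^sup>2)) = ennreal B" "0 \<le> B"
      by (cases "SUP n. ennreal ((S n x)\<^sup>2)") auto
    have "S n x \<le> sqrt B" for n
    proof -
      have "ennreal ((S n x)\<^sup>2) \<le> ennreal B" unfolding B(1)[symmetric] by (rule SUP_upper) simp
      then show ?thesis using B(2) by (intro real_le_rsqrt) simp
    qed
    then show ?case
      using bounded_imp_summable[of "\<lambda>k. d k x" "sqrt B"]
      by (simp add: S_def d_def lessThan_Suc_atMost[symmetric] del: sum.lessThan_Suc)
  qed
qed

text \<open>A rapidly Cauchy subsequence of representatives converges almost everywhere; Fatou's
  lemma bounds the distance of its members to the pointwise limit, and a Cauchy sequence follows its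
  subsequence.\<close>

instance L2 :: (euclidean_space) complete_space
proof
  fix F :: "nat \<Rightarrow> 'a L2" assume F: "Cauchy F"
  have "\<exists>N. \<forall>m\<ge>N. \<forall>n\<ge>N. dist (F m) (F n) < (1/2) ^ k" for k :: nat
    using F unfolding Cauchy_def by simp
  then obtain N where N: "\<And>k m n. N k \<le> m \<Longrightarrow> N k \<le> n \<Longrightarrow> dist (F m) (F n) < (1/2) ^ k"
    by metis
  \<comment> \<open>The sum dominates each threshold \<open>N i\<close> with i \<le> k, so later
    indices are admissible for all earlier accuracies.\<close>
  define m where "m k = (\<Sum>i\<le>k. N i)" for k
  have mN: "N k \<le> m j" if "k \<le> j" for k j
    unfolding m_def using that by (intro member_le_sum) auto
  define f where "f k = rep_L2 (F (m k))" for k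
  have f: "f k \<in> square_integrable" and cf: "L2_class (f k) = F (m k)" for k
    by (simp_all add: f_def rep_L2_square_integrable L2_class_rep)
  have near: "norm (L2_class (f j) - L2_class (f k)) \<le> (1/2) ^ k" if "k \<le> j" for j k
    using N[of k "m j" "m k"] mN[of k j] mN[of k k] that by (simp add: cf dist_norm less_imp_le)
  have [measurable]: "f k \<in> borel_measurable borel" for k
    using f by (simp add: square_integrable_def)
  define g where "g x = lim (\<lambda>k. f k x)" for x
  have [measurable]: "g \<in> borel_measurable borel"
    unfolding g_def by (rule borel_measurable_lim_metric) measurable
  have lim: "AE x in lborel. (\<lambda>k. f k x) \<longlonglongrightarrow> g x"
  proof -
    have "AE x in lborel. summable (\<lambda>k. cmod (f (Suc k) x - f k x))"
      by (rule L2_geometric_Cauchy_AE_summable[OF f near]) simp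
    then show ?thesis
    proof eventually_elim
      case (elim x)
      then have "summable (\<lambda>k. f (Suc k) x - f k x)" by (rule summable_norm_cancel)
      then have "(\<lambda>n. \<Sum>k<n. f (Suc k) x - f k x) \<longlonglongrightarrow> (\<Sum>k. f (Suc k) x - f k x)"
        by (rule summable_LIMSEQ)
      from tendsto_add[OF this tendsto_const[of "f 0 x"]]
      have "convergent (\<lambda>k. f k x)"
        unfolding sum_lessThan_telescope[of "\<lambda>k. f k x"] by (intro convergentI[of _ "(\<Sum>k. f (Suc k) x - f k x) + f 0 x"]) simp
      then show ?case unfolding g_def by (simp add: convergent_LIMSEQ_iff)
    qed
  qed
  have Fatou: "(\<integral>\<^sup>+ x. ennreal ((cmod (g x - f k x))\<^sup>2) \<partial>lborel) \<le> ennreal (((1/2) ^ k)\<^sup>2)" for k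
  proof -
    have "(\<integral>\<^sup>+ x. ennreal ((cmod (g x - f k x))\<^sup>2) \<partial>lborel)
        = (\<integral>\<^sup>+ x. liminf (\<lambda>j. ennreal ((cmod (f j x - f k x))\<^sup>2)) \<partial>lborel)"
    proof (rule nn_integral_cong_AE)
      show "AE x in lborel. ennreal ((cmod (g x - f k x))\<^sup>2) = liminf (\<lambda>j. ennreal ((cmod (f j x - f k x))\<^sup>2))"
        using lim
      proof eventually_elim
        case (elim x)
        have "(\<lambda>j. ennreal ((cmod (f j x - f k x))\<^sup>2)) \<longlonglongrightarrow> ennreal ((cmod (g x - f k x))\<^sup>2)"
          by (intro tendsto_ennrealI tendsto_intros elim)
        from lim_imp_Liminf[OF _ this] show ?case by simp
      qed
    qed
    also have "\<dots> \<le> liminf (\<lambda>j. \<integral>\<^sup>+ x. ennreal ((cmod (f j x - f k x))\<^sup>2) \<partial>lborel)"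
      by (rule nn_integral_liminf) simp
    also have "\<dots> \<le> ennreal (((1/2) ^ k)\<^sup>2)"
    proof (rule Liminf_le)
      have "(\<integral>\<^sup>+ x. ennreal ((cmod (f j x - f k x))\<^sup>2) \<partial>lborel) \<le> ennreal (((1/2) ^ k)\<^sup>2)" if "k \<le> j" for j
        unfolding norm_L2_class(2)[OF square_integrable_diff[OF f f], symmetric] L2_class_diff[OF f f, symmetric]
        using near[OF that] by (intro ennreal_leI power_mono) auto
      then show "\<forall>\<^sub>F j in sequentially. (\<integral>\<^sup>+ x. ennreal ((cmod (f j x - f k x))\<^sup>2) \<partial>lborel) \<le> ennreal (((1/2) ^ k)\<^sup>2)"
        by (auto simp: eventually_sequentially)
    qed simp
    finally show ?thesis .
  qed
  have gf: "(\<lambda>x. g x - f k x) \<in> square_integrable" for k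
    by (rule square_integrableI) (use le_less_trans[OF Fatou] in auto)
  have g: "g \<in> square_integrable"
    using square_integrable_add[OF gf[of 0] f[of 0]] by simp
  have dist: "dist (F (m k)) (L2_class g) \<le> (1/2) ^ k" for k
    using norm_L2_class_le[OF gf _ Fatou, of k]
    by (simp add: dist_norm norm_minus_commute cf[symmetric] L2_class_diff[OF g f])
  have "F \<longlonglongrightarrow> L2_class g"
  proof (rule metric_LIMSEQ_I)
    fix e :: real assume "0 < e"
    then obtain k where k: "(1/2) ^ k < e / 2"
      using real_arch_pow_inv[of "e / 2" "1/2"] by auto
    show "\<exists>no. \<forall>n\<ge>no. dist (F n) (L2_class g) < e"
    proof (intro exI[of _ "N k"] allI impI)
      fix n assume "N k \<le> n"
      then have "dist (F n) (F (m k)) < (1/2) ^ k" using N mN by blast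
      then show "dist (F n) (L2_class g) < e"
        using dist[of k] k dist_triangle[of "F n" "L2_class g" "F (m k)"] by linarith
    qed
  qed
  then show "convergent F" by (rule convergentI)
qed

section \<open>Weighted shift operators\<close>

context prob_space
begin

text \<open>Tonelli's theorem and translation invariance for each fixed \<omega>. This invariance of
  Lebesgue measure is what makes the weighted shift operators contractions of L2.\<close>

lemma nn_integral_shift:
  fixes Z :: "'a \<Rightarrow> 'b::euclidean_space" and \<phi> :: "'b \<Rightarrow> ennreal"
  assumes [measurable]: "Z \<in> borel_measurable M" "\<phi> \<in> borel_measurable borel"
  shows "(\<integral>\<^sup>+ x. \<integral>\<^sup>+ \<omega>. \<phi> (x + Z \<omega>) \<partial>M \<partial>lborel) = (\<integral>\<^sup>+ x. \<phi> x \<partial>lborel)"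
proof -
  interpret pair_sigma_finite "lborel :: 'b measure" M ..
  have "(\<integral>\<^sup>+ x. \<phi> (x + z) \<partial>lborel) = (\<integral>\<^sup>+ x. \<phi> x \<partial>lborel)" for z
  proof -
    have "(\<integral>\<^sup>+ x. \<phi> x \<partial>lborel) = (\<integral>\<^sup>+ x. \<phi> x \<partial>distr lborel borel ((+) z))"
      by (simp only: lborel_distr_plus)
    also have "\<dots> = (\<integral>\<^sup>+ x. \<phi> (z + x) \<partial>lborel)" by (rule nn_integral_distr) auto
    finally show ?thesis by (simp add: add.commute)
  qed
  then have "(\<integral>\<^sup>+ \<omega>. \<integral>\<^sup>+ x. \<phi> (x + Z \<omega>) \<partial>lborel \<partial>M) = (\<integral>\<^sup>+ x. \<phi> x \<partial>lborel)"
    by (simp add: emeasure_space_1)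
  then show ?thesis by (subst Fubini'[symmetric]) auto
qed

text \<open>The expected indicator of a null set, integrated over the starting point, is the
  Lebesgue measure of that set. Hence the shifts act on classes of functions.\<close>

lemma AE_shift:
  fixes Z :: "'a \<Rightarrow> 'b::euclidean_space"
  assumes P: "AE x in lborel. P x" and [measurable]: "Z \<in> borel_measurable M"
  shows "AE x in lborel. AE \<omega> in M. P (x + Z \<omega>)"
proof -
  obtain N where N: "{x. \<not> P x} \<subseteq> N" "emeasure lborel N = 0" "N \<in> sets borel"
    using P by (auto elim!: AE_E)
  note [measurable] = N(3)
  have "(\<integral>\<^sup>+ x. \<integral>\<^sup>+ \<omega>. indicator N (x + Z \<omega>) \<partial>M \<partial>lborel) = 0"
    using N by (subst nn_integral_shift) auto
  then have "AE x in lborel. (\<integral>\<^sup>+ \<omega>. indicator N (x + Z \<omega>) \<partial>M) = 0"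
    by (subst (asm) nn_integral_0_iff_AE) auto
  then show ?thesis
  proof eventually_elim
    case (elim x)
    then have "AE \<omega> in M. indicator N (x + Z \<omega>) = (0 :: ennreal)"
      by (subst (asm) nn_integral_0_iff_AE) auto
    then show ?case by eventually_elim (use N(1) in \<open>auto simp: indicator_def split: if_splits\<close>)
  qed
qed

lemma nn_integral_cmod_square:
  fixes F :: "'a \<Rightarrow> complex"
  assumes [measurable]: "F \<in> borel_measurable M"
  shows "(\<integral>\<^sup>+ \<omega>. ennreal (cmod (F \<omega>)) \<partial>M)\<^sup>2 \<le> (\<integral>\<^sup>+ \<omega>. ennreal ((cmod (F \<omega>))\<^sup>2) \<partial>M)"
  using Cauchy_Schwarz_nn_integral[of "\<lambda>\<omega>. ennreal (cmod (F \<omega>))" M "\<lambda>_. 1"]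
  by (simp add: emeasure_space_1 ennreal_power)

lemma integrable_of_square:
  fixes F :: "'a \<Rightarrow> complex"
  assumes [measurable]: "F \<in> borel_measurable M" and "(\<integral>\<^sup>+ \<omega>. ennreal ((cmod (F \<omega>))\<^sup>2) \<partial>M) < \<infinity>"
  shows "integrable M F"
proof -
  have "(\<integral>\<^sup>+ \<omega>. ennreal (cmod (F \<omega>)) \<partial>M)\<^sup>2 < \<infinity>"
    using nn_integral_cmod_square[OF assms(1)] assms(2) by (rule le_less_trans)
  then have "(\<integral>\<^sup>+ \<omega>. ennreal (cmod (F \<omega>)) \<partial>M) \<noteq> \<infinity>"
    by (auto simp: power2_eq_square ennreal_top_mult)
  then show ?thesis by (simp add: integrable_iff_bounded top.not_eq_extremum)
qed

text \<open>Jensen's inequality, by Cauchy-Schwarz against the constant 1. It holds without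
  integrability because the Bochner integral of a non-integrable function is 0.\<close>

lemma cmod_expectation_square_le:
  fixes F :: "'a \<Rightarrow> complex"
  assumes [measurable]: "F \<in> borel_measurable M"
  shows "ennreal ((cmod (\<integral>\<omega>. F \<omega> \<partial>M))\<^sup>2) \<le> (\<integral>\<^sup>+ \<omega>. ennreal ((cmod (F \<omega>))\<^sup>2) \<partial>M)"
proof (cases "integrable M F")
  case True
  have "ennreal (cmod (\<integral>\<omega>. F \<omega> \<partial>M)) \<le> (\<integral>\<^sup>+ \<omega>. ennreal (cmod (F \<omega>)) \<partial>M)"
    using True by (rule integral_norm_bound_ennreal)
  then have "(ennreal (cmod (\<integral>\<omega>. F \<omega> \<partial>M)))\<^sup>2 \<le> (\<integral>\<^sup>+ \<omega>. ennreal (cmod (F \<omega>)) \<partial>M)\<^sup>2"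
    by (intro power_mono) auto
  also note nn_integral_cmod_square[OF assms]
  finally show ?thesis by (simp add: ennreal_power)
next
  case False
  then show ?thesis by (simp add: not_integrable_integral_eq)
qed

lemma average_square_integrable:
  fixes H :: "'b::euclidean_space \<Rightarrow> 'a \<Rightarrow> complex"
  assumes [measurable]: "(\<lambda>(x, \<omega>). H x \<omega>) \<in> borel_measurable (lborel \<Otimes>\<^sub>M M)"
    and fin: "(\<integral>\<^sup>+ x. \<integral>\<^sup>+ \<omega>. ennreal ((cmod (H x \<omega>))\<^sup>2) \<partial>M \<partial>lborel) < \<infinity>"
  shows "AE x in lborel. integrable M (H x)"
    and "(\<lambda>x. \<integral>\<omega>. H x \<omega> \<partial>M) \<in> square_integrable"
    and "(\<integral>\<^sup>+ x. ennreal ((cmod (\<integral>\<omega>. H x \<omega> \<partial>M))\<^sup>2) \<partial>lborel)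
       \<le> (\<integral>\<^sup>+ x. \<integral>\<^sup>+ \<omega>. ennreal ((cmod (H x \<omega>))\<^sup>2) \<partial>M \<partial>lborel)"
proof -
  have [measurable]: "H x \<in> borel_measurable M" for x
    using measurable_Pair2[OF assms(1), of x] by simp
  have "AE x in lborel. (\<integral>\<^sup>+ \<omega>. ennreal ((cmod (H x \<omega>))\<^sup>2) \<partial>M) \<noteq> \<infinity>"
    using fin by (intro nn_integral_PInf_AE) auto
  then show "AE x in lborel. integrable M (H x)"
    by eventually_elim (auto intro!: integrable_of_square simp: top.not_eq_extremum)
  show *: "(\<integral>\<^sup>+ x. ennreal ((cmod (\<integral>\<omega>. H x \<omega> \<partial>M))\<^sup>2) \<partial>lborel)
       \<le> (\<integral>\<^sup>+ x. \<integral>\<^sup>+ \<omega>. ennreal ((cmod (H x \<omega>))\<^sup>2) \<partial>M \<partial>lborel)"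
    by (intro nn_integral_mono cmod_expectation_square_le) measurable
  have "(\<lambda>x. \<integral>\<omega>. H x \<omega> \<partial>M) \<in> borel_measurable lborel"
    by (rule borel_measurable_lebesgue_integral) measurable
  then show "(\<lambda>x. \<integral>\<omega>. H x \<omega> \<partial>M) \<in> square_integrable"
    using le_less_trans[OF * fin] by (intro square_integrableI) auto
qed

definition weight :: "('b::euclidean_space \<Rightarrow> 'a \<Rightarrow> real) \<Rightarrow> bool" where
  "weight W \<longleftrightarrow> (\<lambda>(x, \<omega>). W x \<omega>) \<in> borel_measurable (lborel \<Otimes>\<^sub>M M) \<and>
     (\<forall>x. \<forall>\<omega>\<in>space M. 0 \<le> W x \<omega> \<and> W x \<omega> \<le> 1)"

text \<open>For \<open>Z = 0\<close> and \<open>W\<close> independent of \<open>\<omega>\<close> this is a multiplication operator, for \<open>W = 1\<close> the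
  convolution with the law of \<open>- Z\<close>, and for \<open>Z = X\<^sub>t\<close> and the Feynman-Kac weight the operator \<open>T\<^sub>t\<close>.\<close>

definition weighted_op :: "('b::euclidean_space \<Rightarrow> 'a \<Rightarrow> real) \<Rightarrow> ('a \<Rightarrow> 'b) \<Rightarrow> 'b L2 \<Rightarrow> 'b L2" where
  "weighted_op W Z F = L2_class (\<lambda>x. \<integral>\<omega>. complex_of_real (W x \<omega>) * rep_L2 F (x + Z \<omega>) \<partial>M)"

lemma weight_section: "weight W \<Longrightarrow> W x \<in> borel_measurable M"
  using measurable_Pair2[of "\<lambda>(x, \<omega>). W x \<omega>" lborel M borel x] by (simp add: weight_def)

context
  fixes W :: "'b::euclidean_space \<Rightarrow> 'a \<Rightarrow> real" and Z :: "'a \<Rightarrow> 'b"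
  assumes W: "weight W" and Z [measurable]: "Z \<in> borel_measurable M"
begin

lemma weighted_measurable:
  assumes [measurable]: "f \<in> borel_measurable borel"
  shows "(\<lambda>(x, \<omega>). complex_of_real (W x \<omega>) * f (x + Z \<omega>)) \<in> borel_measurable (lborel \<Otimes>\<^sub>M M)"
proof -
  have [measurable]: "(\<lambda>(x, \<omega>). W x \<omega>) \<in> borel_measurable (lborel \<Otimes>\<^sub>M M)"
    using W by (simp add: weight_def)
  show ?thesis by measurable
qed

lemma weighted_bound:
  assumes f: "f \<in> square_integrable"
  shows "(\<integral>\<^sup>+ x. \<integral>\<^sup>+ \<omega>. ennreal ((cmod (complex_of_real (W x \<omega>) * f (x + Z \<omega>)))\<^sup>2) \<partial>M \<partial>lborel)
     \<le> ennreal ((norm (L2_class f))\<^sup>2)"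
proof -
  have [measurable]: "f \<in> borel_measurable borel" by (rule square_integrable_measurable[OF f])
  have "(\<integral>\<^sup>+ x. \<integral>\<^sup>+ \<omega>. ennreal ((cmod (complex_of_real (W x \<omega>) * f (x + Z \<omega>)))\<^sup>2) \<partial>M \<partial>lborel)
     \<le> (\<integral>\<^sup>+ x. \<integral>\<^sup>+ \<omega>. ennreal ((cmod (f (x + Z \<omega>)))\<^sup>2) \<partial>M \<partial>lborel)"
    using W by (intro nn_integral_mono ennreal_leI power_mono)
      (auto simp: weight_def norm_mult intro!: mult_left_le_one_le)
  also have "\<dots> = (\<integral>\<^sup>+ x. ennreal ((cmod (f x))\<^sup>2) \<partial>lborel)"
    by (rule nn_integral_shift) measurable
  finally show ?thesis unfolding norm_L2_class(2)[OF f] .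
qed

lemma weighted_finite:
  assumes f: "f \<in> square_integrable"
  shows "(\<integral>\<^sup>+ x. \<integral>\<^sup>+ \<omega>. ennreal ((cmod (complex_of_real (W x \<omega>) * f (x + Z \<omega>)))\<^sup>2) \<partial>M \<partial>lborel) < \<infinity>"
  by (rule le_less_trans[OF weighted_bound[OF f]]) simp

lemma weighted_average:
  assumes f: "f \<in> square_integrable"
  shows "AE x in lborel. integrable M (\<lambda>\<omega>. complex_of_real (W x \<omega>) * f (x + Z \<omega>))"
    and "(\<lambda>x. \<integral>\<omega>. complex_of_real (W x \<omega>) * f (x + Z \<omega>) \<partial>M) \<in> square_integrable"
    and "(\<integral>\<^sup>+ x. ennreal ((cmod (\<integral>\<omega>. complex_of_real (W x \<omega>) * f (x + Z \<omega>) \<partial>M))\<^sup>2) \<partial>lborel)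
       \<le> (\<integral>\<^sup>+ x. \<integral>\<^sup>+ \<omega>. ennreal ((cmod (complex_of_real (W x \<omega>) * f (x + Z \<omega>)))\<^sup>2) \<partial>M \<partial>lborel)"
  by (rule average_square_integrable[OF weighted_measurable[OF square_integrable_measurable[OF f]] weighted_finite[OF f]])+

lemma weighted_op_L2_class:
  assumes f: "f \<in> square_integrable"
  shows "weighted_op W Z (L2_class f) = L2_class (\<lambda>x. \<integral>\<omega>. complex_of_real (W x \<omega>) * f (x + Z \<omega>) \<partial>M)"
  unfolding weighted_op_def
proof (rule L2_class_eq_iff[THEN iffD2])
  note r = rep_L2_square_integrable[of "L2_class f"]
  show "(\<lambda>x. \<integral>\<omega>. complex_of_real (W x \<omega>) * rep_L2 (L2_class f) (x + Z \<omega>) \<partial>M) \<in> square_integrable"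
    "(\<lambda>x. \<integral>\<omega>. complex_of_real (W x \<omega>) * f (x + Z \<omega>) \<partial>M) \<in> square_integrable"
    using weighted_average(2)[OF r] weighted_average(2)[OF f] by auto
  have [measurable]: "f \<in> borel_measurable borel" "rep_L2 (L2_class f) \<in> borel_measurable borel"
    by (auto intro: square_integrable_measurable f r)
  have [measurable]: "W x \<in> borel_measurable M" for x by (rule weight_section[OF W])
  from AE_shift[OF rep_L2_class_AE[OF f] Z]
  show "AE x in lborel. (\<integral>\<omega>. complex_of_real (W x \<omega>) * rep_L2 (L2_class f) (x + Z \<omega>) \<partial>M)
      = (\<integral>\<omega>. complex_of_real (W x \<omega>) * f (x + Z \<omega>) \<partial>M)"
  proof eventually_elim
    case (elim x)
    show ?case
    proof (rule integral_cong_AE)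
      show "AE \<omega> in M. complex_of_real (W x \<omega>) * rep_L2 (L2_class f) (x + Z \<omega>) = complex_of_real (W x \<omega>) * f (x + Z \<omega>)"
        using elim by eventually_elim simp
    qed measurable
  qed
qed

lemma norm_weighted_op_le: "norm (weighted_op W Z F) \<le> norm F"
proof -
  note r = rep_L2_square_integrable[of F]
  have "norm (weighted_op W Z F) \<le> norm (L2_class (rep_L2 F))"
    unfolding weighted_op_def
    by (rule norm_L2_class_le[OF weighted_average(2)[OF r]])
       (auto intro: order_trans[OF weighted_average(3)[OF r] weighted_bound[OF r]])
  then show ?thesis by (simp add: L2_class_rep)
qed

lemma weighted_op_add: "weighted_op W Z (F + G) = weighted_op W Z F + weighted_op W Z G"
proof -
  note r = rep_L2_square_integrable
  have "weighted_op W Z (F + G) = weighted_op W Z (L2_class (\<lambda>x. rep_L2 F x + rep_L2 G x))"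
    by (simp only: L2_class_add[OF r r, symmetric] L2_class_rep)
  also have "\<dots> = L2_class (\<lambda>x. \<integral>\<omega>. complex_of_real (W x \<omega>) * (rep_L2 F (x + Z \<omega>) + rep_L2 G (x + Z \<omega>)) \<partial>M)"
    by (rule weighted_op_L2_class[OF square_integrable_add[OF r r]])
  also have "\<dots> = L2_class (\<lambda>x. (\<integral>\<omega>. complex_of_real (W x \<omega>) * rep_L2 F (x + Z \<omega>) \<partial>M) +
      (\<integral>\<omega>. complex_of_real (W x \<omega>) * rep_L2 G (x + Z \<omega>) \<partial>M))"
  proof (rule L2_class_eq_iff[THEN iffD2])
    show "(\<lambda>x. \<integral>\<omega>. complex_of_real (W x \<omega>) * (rep_L2 F (x + Z \<omega>) + rep_L2 G (x + Z \<omega>)) \<partial>M) \<in> square_integrable"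
      using weighted_average(2)[OF square_integrable_add[OF r r]] .
    show "(\<lambda>x. (\<integral>\<omega>. complex_of_real (W x \<omega>) * rep_L2 F (x + Z \<omega>) \<partial>M) +
      (\<integral>\<omega>. complex_of_real (W x \<omega>) * rep_L2 G (x + Z \<omega>) \<partial>M)) \<in> square_integrable"
      by (intro square_integrable_add weighted_average(2)[OF r])
    from weighted_average(1)[OF r, of F] weighted_average(1)[OF r, of G]
    show "AE x in lborel. (\<integral>\<omega>. complex_of_real (W x \<omega>) * (rep_L2 F (x + Z \<omega>) + rep_L2 G (x + Z \<omega>)) \<partial>M)
      = (\<integral>\<omega>. complex_of_real (W x \<omega>) * rep_L2 F (x + Z \<omega>) \<partial>M) +
        (\<integral>\<omega>. complex_of_real (W x \<omega>) * rep_L2 G (x + Z \<omega>) \<partial>M)"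
      by eventually_elim (simp add: distrib_left)
  qed
  also have "\<dots> = weighted_op W Z F + weighted_op W Z G"
    unfolding weighted_op_def by (rule L2_class_add[symmetric]) (rule weighted_average(2)[OF r])+
  finally show ?thesis .
qed

lemma weighted_op_scaleC: "weighted_op W Z (c *\<^sub>C F) = c *\<^sub>C weighted_op W Z F"
proof -
  note r = rep_L2_square_integrable
  have "weighted_op W Z (c *\<^sub>C F) = weighted_op W Z (L2_class (\<lambda>x. c * rep_L2 F x))"
    by (simp only: L2_class_scaleC[OF r, symmetric] L2_class_rep)
  also have "\<dots> = L2_class (\<lambda>x. \<integral>\<omega>. complex_of_real (W x \<omega>) * (c * rep_L2 F (x + Z \<omega>)) \<partial>M)"
    by (rule weighted_op_L2_class[OF square_integrable_scale[OF r]])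
  also have "\<dots> = L2_class (\<lambda>x. c * (\<integral>\<omega>. complex_of_real (W x \<omega>) * rep_L2 F (x + Z \<omega>) \<partial>M))"
    by (simp add: mult.left_commute[of _ c])
  also have "\<dots> = c *\<^sub>C weighted_op W Z F"
    unfolding weighted_op_def by (rule L2_class_scaleC[symmetric]) (rule weighted_average(2)[OF r])
  finally show ?thesis .
qed

lemma weighted_op_diff: "weighted_op W Z (F - G) = weighted_op W Z F - weighted_op W Z G"
  using weighted_op_add[of "F - G" G] by simp

end

lemma weighted_op_cong:
  assumes W: "weight W" "weight W'" and Z: "Z \<in> borel_measurable M" "Z' \<in> borel_measurable M"
    and eq: "AE x in lborel. AE \<omega> in M. W x \<omega> = W' x \<omega> \<and> Z \<omega> = Z' \<omega>"
  shows "weighted_op W Z F = weighted_op W' Z' F"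
  unfolding weighted_op_def
proof (rule L2_class_eq_iff[THEN iffD2])
  note r = rep_L2_square_integrable
  note [measurable] = Z weight_section[OF W(1)] weight_section[OF W(2)]
  have [measurable]: "rep_L2 F \<in> borel_measurable borel" by (rule square_integrable_measurable[OF r])
  show "(\<lambda>x. \<integral>\<omega>. complex_of_real (W x \<omega>) * rep_L2 F (x + Z \<omega>) \<partial>M) \<in> square_integrable"
    by (rule weighted_average(2)[OF W(1) Z(1) r])
  show "(\<lambda>x. \<integral>\<omega>. complex_of_real (W' x \<omega>) * rep_L2 F (x + Z' \<omega>) \<partial>M) \<in> square_integrable"
    by (rule weighted_average(2)[OF W(2) Z(2) r])
  from eq show "AE x in lborel. (\<integral>\<omega>. complex_of_real (W x \<omega>) * rep_L2 F (x + Z \<omega>) \<partial>M)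
     = (\<integral>\<omega>. complex_of_real (W' x \<omega>) * rep_L2 F (x + Z' \<omega>) \<partial>M)"
  proof eventually_elim
    case (elim x)
    show ?case
    proof (rule integral_cong_AE)
      show "AE \<omega> in M. complex_of_real (W x \<omega>) * rep_L2 F (x + Z \<omega>) = complex_of_real (W' x \<omega>) * rep_L2 F (x + Z' \<omega>)"
        using elim by eventually_elim simp
    qed measurable
  qed
qed

text \<open>Dominated convergence, first in \<omega> and then in x, with the majorant |f (x + Z)|^2;
  its double integral is the norm square of f by translation invariance, and the difference of two
  weights is at most 1. Every approximation of Feynman-Kac operators below passes through this
  statement.\<close>

lemma weighted_op_tendsto:
  fixes Wn :: "nat \<Rightarrow> 'b::euclidean_space \<Rightarrow> 'a \<Rightarrow> real"
  assumes Wn: "\<And>n. weight (Wn n)" and W: "weight W" and Z: "Z \<in> borel_measurable M"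
    and lim: "AE x in lborel. AE \<omega> in M. (\<lambda>n. Wn n x \<omega>) \<longlonglongrightarrow> W x \<omega>"
  shows "(\<lambda>n. weighted_op (Wn n) Z F) \<longlonglongrightarrow> weighted_op W Z F"
proof -
  define f where "f = rep_L2 F"
  have f: "f \<in> square_integrable" by (simp add: f_def rep_L2_square_integrable)
  have [measurable]: "f \<in> borel_measurable borel" by (rule square_integrable_measurable[OF f])
  note [measurable] = Z weight_section[OF W] weight_section[OF Wn]
  have [measurable]: "(\<lambda>(x, \<omega>). W x \<omega>) \<in> borel_measurable (lborel \<Otimes>\<^sub>M M)"
    "\<And>n. (\<lambda>(x, \<omega>). Wn n x \<omega>) \<in> borel_measurable (lborel \<Otimes>\<^sub>M M)"
    using W Wn by (auto simp: weight_def)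
  define H where "H n x \<omega> = complex_of_real (Wn n x \<omega> - W x \<omega>) * f (x + Z \<omega>)" for n x \<omega>
  have Hm [measurable]: "(\<lambda>(x, \<omega>). H n x \<omega>) \<in> borel_measurable (lborel \<Otimes>\<^sub>M M)" for n
    unfolding H_def by measurable
  have [measurable]: "H n x \<in> borel_measurable M" for n x
    using measurable_Pair2[OF Hm, of x n] by simp
  define \<Phi> where "\<Phi> x = (\<integral>\<^sup>+ \<omega>. ennreal ((cmod (f (x + Z \<omega>)))\<^sup>2) \<partial>M)" for x
  have [measurable]: "\<Phi> \<in> borel_measurable borel"
    using borel_measurable_nn_integral[of "\<lambda>x \<omega>. ennreal ((cmod (f (x + Z \<omega>)))\<^sup>2)" lborel]
    unfolding \<Phi>_def[abs_def] by simp
  have \<Phi>: "(\<integral>\<^sup>+ x. \<Phi> x \<partial>lborel) < \<infinity>"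
    unfolding \<Phi>_def using f
    by (subst nn_integral_shift) (auto simp: norm_L2_class(2)[OF f, symmetric])
  have Hle: "ennreal ((cmod (H n x \<omega>))\<^sup>2) \<le> ennreal ((cmod (f (x + Z \<omega>)))\<^sup>2)" if "\<omega> \<in> space M" for n x \<omega>
  proof -
    have "\<bar>Wn n x \<omega> - W x \<omega>\<bar> \<le> 1" using W Wn[of n] that unfolding weight_def by (smt (verit))
    then have "cmod (H n x \<omega>) \<le> cmod (f (x + Z \<omega>))"
      unfolding H_def norm_mult norm_of_real by (intro mult_left_le_one_le) auto
    then show ?thesis by (intro ennreal_leI power_mono) auto
  qed
  define J where "J n = (\<integral>\<^sup>+ x. \<integral>\<^sup>+ \<omega>. ennreal ((cmod (H n x \<omega>))\<^sup>2) \<partial>M \<partial>lborel)" for n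
  have \<Phi>fin: "AE x in lborel. \<Phi> x \<noteq> \<infinity>"
    using \<Phi> by (intro nn_integral_PInf_AE) auto
  have "J \<longlonglongrightarrow> (\<integral>\<^sup>+ x. 0 \<partial>(lborel :: 'b measure))"
    unfolding J_def
  proof (rule nn_integral_dominated_convergence[where w = \<Phi>])
    show "AE x in lborel. (\<integral>\<^sup>+ \<omega>. ennreal ((cmod (H n x \<omega>))\<^sup>2) \<partial>M) \<le> \<Phi> x" for n
      unfolding \<Phi>_def by (intro AE_I2 nn_integral_mono Hle)
    show "AE x in lborel. (\<lambda>n. \<integral>\<^sup>+ \<omega>. ennreal ((cmod (H n x \<omega>))\<^sup>2) \<partial>M) \<longlonglongrightarrow> 0"
      using lim \<Phi>fin
    proof eventually_elim
      case (elim x)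
      have "(\<lambda>n. \<integral>\<^sup>+ \<omega>. ennreal ((cmod (H n x \<omega>))\<^sup>2) \<partial>M) \<longlonglongrightarrow> (\<integral>\<^sup>+ \<omega>. 0 \<partial>M)"
      proof (rule nn_integral_dominated_convergence[where w = "\<lambda>\<omega>. ennreal ((cmod (f (x + Z \<omega>)))\<^sup>2)"])
        show "AE \<omega> in M. ennreal ((cmod (H n x \<omega>))\<^sup>2) \<le> ennreal ((cmod (f (x + Z \<omega>)))\<^sup>2)" for n
          by (intro AE_I2 Hle)
        show "(\<integral>\<^sup>+ \<omega>. ennreal ((cmod (f (x + Z \<omega>)))\<^sup>2) \<partial>M) < \<infinity>"
          using elim(2) by (simp add: \<Phi>_def top.not_eq_extremum)
        from elim(1) show "AE \<omega> in M. (\<lambda>n. ennreal ((cmod (H n x \<omega>))\<^sup>2)) \<longlonglongrightarrow> 0"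
        proof eventually_elim
          case (elim \<omega>)
          have "(\<lambda>n. ennreal ((cmod (H n x \<omega>))\<^sup>2)) \<longlonglongrightarrow> ennreal ((cmod (complex_of_real (W x \<omega> - W x \<omega>) * f (x + Z \<omega>)))\<^sup>2)"
            unfolding H_def by (intro tendsto_ennrealI tendsto_intros elim)
          then show ?case by simp
        qed
      qed measurable
      then show ?case by simp
    qed
  qed (use \<Phi> in auto)
  then have J: "J \<longlonglongrightarrow> 0" by simp
  have Jfin: "J n < \<infinity>" for n
  proof (rule le_less_trans[OF _ \<Phi>])
    show "J n \<le> (\<integral>\<^sup>+ x. \<Phi> x \<partial>lborel)"
      unfolding J_def \<Phi>_def by (intro nn_integral_mono Hle)
  qed
  have le: "ennreal ((norm (weighted_op (Wn n) Z F - weighted_op W Z F))\<^sup>2) \<le> J n" for n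
  proof -
    note a = weighted_average[OF Wn[of n] Z f] and b = weighted_average[OF W Z f]
    have "weighted_op (Wn n) Z F - weighted_op W Z F = L2_class (\<lambda>x. \<integral>\<omega>. H n x \<omega> \<partial>M)"
      unfolding weighted_op_def f_def[symmetric] L2_class_diff[OF a(2) b(2)]
    proof (rule L2_class_eq_iff[THEN iffD2])
      show "(\<lambda>x. (\<integral>\<omega>. complex_of_real (Wn n x \<omega>) * f (x + Z \<omega>) \<partial>M) - (\<integral>\<omega>. complex_of_real (W x \<omega>) * f (x + Z \<omega>) \<partial>M)) \<in> square_integrable"
        by (intro square_integrable_diff a b)
      show "(\<lambda>x. \<integral>\<omega>. H n x \<omega> \<partial>M) \<in> square_integrable"
        by (rule average_square_integrable(2)[OF Hm Jfin[unfolded J_def]])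
      from a(1) b(1) show "AE x in lborel. (\<integral>\<omega>. complex_of_real (Wn n x \<omega>) * f (x + Z \<omega>) \<partial>M) - (\<integral>\<omega>. complex_of_real (W x \<omega>) * f (x + Z \<omega>) \<partial>M)
          = (\<integral>\<omega>. H n x \<omega> \<partial>M)"
        by eventually_elim (simp add: H_def left_diff_distrib)
    qed
    then show ?thesis
      using average_square_integrable(3)[OF Hm Jfin[unfolded J_def], of n]
      by (simp only: norm_L2_class(2)[OF average_square_integrable(2)[OF Hm Jfin[unfolded J_def]]] J_def)
  qed
  have "(\<lambda>n. ennreal ((norm (weighted_op (Wn n) Z F - weighted_op W Z F))\<^sup>2)) \<longlonglongrightarrow> 0"
    by (rule tendsto_sandwich[OF _ _ tendsto_const J]) (auto intro: always_eventually le)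
  then have "(\<lambda>n. (norm (weighted_op (Wn n) Z F - weighted_op W Z F))\<^sup>2) \<longlonglongrightarrow> 0"
    by (subst (asm) ennreal_0[symmetric], subst (asm) tendsto_ennreal_iff) auto
  from tendsto_real_sqrt[OF this] have "(\<lambda>n. norm (weighted_op (Wn n) Z F - weighted_op W Z F)) \<longlonglongrightarrow> 0" by simp
  then show ?thesis by (simp add: LIM_zero_iff tendsto_norm_zero_iff)
qed

end

section \<open>Approximation by continuous functions, for square integrable functions and for
  potentials\<close>

lemma AE_limit_of_continuous:
  fixes f :: "'a::euclidean_space \<Rightarrow> 'b::euclidean_space"
  assumes f: "f \<in> borel_measurable borel"
  obtains g :: "nat \<Rightarrow> 'a \<Rightarrow> 'b" where "\<And>n. continuous_on UNIV (g n)"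
    "AE x in lborel. (\<lambda>n. g n x) \<longlonglongrightarrow> f x"
proof -
  have "f \<in> borel_measurable lebesgue" using f by (simp add: measurable_completion)
  then have "f measurable_on UNIV" by (intro lebesgue_measurable_imp_measurable_on) auto
  then obtain N g where N: "negligible N" and g: "\<And>n. continuous_on UNIV (g n)"
    "\<And>x. x \<notin> N \<Longrightarrow> (\<lambda>n. g n x) \<longlonglongrightarrow> f x"
    unfolding measurable_on_def by auto
  have "AE x in lebesgue. x \<notin> N" using N by (intro AE_not_in) (simp add: negligible_iff_null_sets)
  then have "AE x in lborel. x \<notin> N" by (simp only: AE_completion_iff)
  then have "AE x in lborel. (\<lambda>n. g n x) \<longlonglongrightarrow> f x" by eventually_elim (rule g(2))
  with g(1) show ?thesis by (rule that)
qed

lemma L2_class_tendsto: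
  fixes f :: "'a::euclidean_space \<Rightarrow> complex"
  assumes fn: "\<And>n. fn n \<in> square_integrable" and f: "f \<in> square_integrable"
    and lim: "AE x in lborel. (\<lambda>n. fn n x) \<longlonglongrightarrow> f x"
    and w: "integrable lborel w"
    and bd: "\<And>n x. (cmod (fn n x - f x))\<^sup>2 \<le> w x"
  shows "(\<lambda>n. L2_class (fn n)) \<longlonglongrightarrow> L2_class f"
proof -
  have [measurable]: "fn n \<in> borel_measurable borel" "f \<in> borel_measurable borel" for n
    using fn f by (auto simp: square_integrable_def)
  have "(\<lambda>n. \<integral>x. (cmod (fn n x - f x))\<^sup>2 \<partial>lborel) \<longlonglongrightarrow> (\<integral>x. 0 \<partial>(lborel :: 'a measure))"
  proof (rule integral_dominated_convergence[OF _ _ w])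
    show "AE x in lborel. (\<lambda>n. (cmod (fn n x - f x))\<^sup>2) \<longlonglongrightarrow> 0"
      using lim
    proof eventually_elim
      case (elim x)
      from tendsto_power[OF tendsto_norm[OF tendsto_diff[OF elim tendsto_const[of "f x"]]], of 2]
      show ?case by simp
    qed
    show "AE x in lborel. norm ((cmod (fn n x - f x))\<^sup>2) \<le> w x" for n using bd by simp
  qed auto
  then have "(\<lambda>n. (norm (L2_class (fn n) - L2_class f))\<^sup>2) \<longlonglongrightarrow> 0"
    by (simp add: L2_class_diff[OF fn f] norm_L2_class(1)[OF square_integrable_diff[OF fn f]])
  from tendsto_real_sqrt[OF this] have "(\<lambda>n. norm (L2_class (fn n) - L2_class f)) \<longlonglongrightarrow> 0" by simp
  then show ?thesis by (simp add: LIM_zero_iff tendsto_norm_zero_iff)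
qed

definition test_function :: "('a::euclidean_space \<Rightarrow> complex) \<Rightarrow> bool" where
  "test_function f \<longleftrightarrow> continuous_on UNIV f \<and> (\<exists>B. \<forall>x. cmod (f x) \<le> B) \<and> (\<exists>R. \<forall>x. R < norm x \<longrightarrow> f x = 0)"

lemma bounded_cball_support_integrable:
  fixes f :: "'a::euclidean_space \<Rightarrow> 'b::{banach,second_countable_topology}"
  assumes "f \<in> borel_measurable borel" and B: "\<And>x. norm (f x) \<le> B" and R: "\<And>x. R < norm x \<Longrightarrow> f x = 0"
  shows "integrable lborel f"
proof (rule Bochner_Integration.integrable_bound)
  show "integrable lborel (\<lambda>x::'a. indicator (cball 0 R) x * B)"
    using emeasure_lborel_cball_finite[of "0::'a" R]
    by (intro integrable_mult_left integrable_real_indicator) (simp_all add: less_top)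
  have "norm (f x) \<le> norm (indicator (cball 0 R) x * B)" for x
    using B[of x] R[of x] order_trans[OF norm_ge_zero B[of x]] by (cases "norm x \<le> R") auto
  then show "AE x in lborel. norm (f x) \<le> norm (indicator (cball 0 R) x * B)" by simp
qed (use assms in simp)

lemma bounded_cball_support_square_integrable:
  fixes f :: "'a::euclidean_space \<Rightarrow> complex"
  assumes [measurable]: "f \<in> borel_measurable borel" and B: "\<And>x. cmod (f x) \<le> B" and R: "\<And>x. R < norm x \<Longrightarrow> f x = 0"
  shows "f \<in> square_integrable"
  unfolding square_integrable_def
proof (intro CollectI conjI assms)
  show "integrable lborel (\<lambda>x. (cmod (f x))\<^sup>2)"
    by (rule bounded_cball_support_integrable[of _ "B\<^sup>2" R]) (auto intro!: power_mono B simp: R)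
qed

lemma test_function_square_integrable: "test_function f \<Longrightarrow> f \<in> square_integrable"
  unfolding test_function_def
  by (auto intro!: bounded_cball_support_square_integrable borel_measurable_continuous_onI)

lemma truncation_tendsto:
  fixes f :: "'a::euclidean_space \<Rightarrow> complex"
  assumes f: "f \<in> square_integrable"
  defines "h n x \<equiv> (if norm x \<le> real n \<and> cmod (f x) \<le> real n then f x else 0)"
  shows "(\<lambda>n. L2_class (h n)) \<longlonglongrightarrow> L2_class f" and "h n \<in> square_integrable"
proof -
  have [measurable]: "f \<in> borel_measurable borel" by (rule square_integrable_measurable[OF f])
  have hm [measurable]: "h n \<in> borel_measurable borel" for n unfolding h_def by measurable
  show hs: "h n \<in> square_integrable" for n
    by (rule bounded_cball_support_square_integrable[OF hm, of _ "real n" "real n"]) (auto simp: h_def)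
  show "(\<lambda>n. L2_class (h n)) \<longlonglongrightarrow> L2_class f"
  proof (rule L2_class_tendsto[OF hs f])
    show "integrable lborel (\<lambda>x. (cmod (f x))\<^sup>2)" using f by (simp add: square_integrable_def)
    show "(cmod (h n x - f x))\<^sup>2 \<le> (cmod (f x))\<^sup>2" for n x by (auto simp: h_def)
    show "AE x in lborel. (\<lambda>n. h n x) \<longlonglongrightarrow> f x"
    proof (rule AE_I2)
      fix x
      obtain N where N: "max (norm x) (cmod (f x)) \<le> real N" using real_arch_simple by blast
      have "h n x = f x" if "N \<le> n" for n using N that by (auto simp: h_def)
      then show "(\<lambda>n. h n x) \<longlonglongrightarrow> f x"
        by (intro tendsto_eventually) (auto simp: eventually_sequentially)
    qed
  qed
qed

lemma bounded_support_approx: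
  fixes f :: "'a::euclidean_space \<Rightarrow> complex"
  assumes fm [measurable]: "f \<in> borel_measurable borel" and B: "\<And>x. cmod (f x) \<le> real N" and R: "\<And>x. real N < norm x \<Longrightarrow> f x = 0"
  obtains h where "\<And>n. test_function (h n)" "(\<lambda>n. L2_class (h n)) \<longlonglongrightarrow> L2_class f"
proof -
  obtain g where g: "\<And>n. continuous_on UNIV (g n)" and lim: "AE x in lborel. (\<lambda>n. g n x) \<longlonglongrightarrow> f x"
    using AE_limit_of_continuous[OF fm] by blast
  \<comment> \<open>The radial retraction onto the disc of radius N + 1, which is positive even for
    N = 0. It fixes all values of f, just as the cutoff below equals 1 on the support of f.\<close>
  define cl where "cl z = (1 / max 1 (cmod z / real (Suc N))) *\<^sub>R z" for z :: complex
  define cut where "cut x = max 0 (min 1 (real N + 1 - norm x))" for x :: 'a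
  define h where "h n x = cut x *\<^sub>R cl (g n x)" for n x
  have cl_bd: "cmod (cl z) \<le> real (Suc N)" for z
  proof -
    define q where "q = cmod z / real (Suc N)"
    have "cmod z = q * real (Suc N)" by (simp add: q_def del: of_nat_Suc)
    also have "\<dots> \<le> max 1 q * real (Suc N)" by (intro mult_right_mono) auto
    finally have "cmod z / max 1 q \<le> real (Suc N)" by (subst pos_divide_le_eq) (simp_all add: mult.commute)
    then show ?thesis by (simp add: cl_def q_def)
  qed
  have cl_id: "cl z = z" if "cmod z \<le> real N" for z
  proof -
    have "cmod z / real (Suc N) \<le> 1" using that by simp
    then show ?thesis unfolding cl_def by (simp add: max_absorb1 del: of_nat_Suc)
  qed
  have clc: "continuous_on UNIV cl"
    unfolding cl_def by (intro continuous_intros) auto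
  have hc: "continuous_on UNIV (h n)" for n
    unfolding h_def cut_def using continuous_on_compose2[OF clc g] by (intro continuous_intros) auto
  have cut: "0 \<le> cut x" "cut x \<le> 1" for x by (auto simp: cut_def)
  have hb: "cmod (h n x) \<le> real (Suc N)" for n x
  proof -
    have "cmod (h n x) \<le> 1 * real (Suc N)"
      unfolding h_def norm_scaleR using cut[of x] cl_bd[of "g n x"] by (intro mult_mono) auto
    then show ?thesis by simp
  qed
  have hR: "h n x = 0" if "real N + 1 < norm x" for n x using that by (simp add: h_def cut_def)
  have test: "test_function (h n)" for n
    unfolding test_function_def using hc hb hR by blast
  have fs: "f \<in> square_integrable" by (rule bounded_cball_support_square_integrable[OF fm B R])
  have "(\<lambda>n. L2_class (h n)) \<longlonglongrightarrow> L2_class f"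
  proof (rule L2_class_tendsto[OF test_function_square_integrable[OF test] fs])
    show "integrable lborel (\<lambda>x::'a. indicator (cball 0 (real N + 1)) x * (2 * real (Suc N))\<^sup>2)"
      using emeasure_lborel_cball_finite[of "0::'a" "real N + 1"]
      by (intro integrable_mult_left integrable_real_indicator) (simp_all add: less_top)
    fix n x
    have "cmod (h n x - f x) \<le> 2 * real (Suc N)"
      using norm_triangle_ineq4[of "h n x" "f x"] hb[of n x] B[of x] by simp
    then have "(cmod (h n x - f x))\<^sup>2 \<le> (2 * real (Suc N))\<^sup>2" by (intro power_mono) auto
    then show "(cmod (h n x - f x))\<^sup>2 \<le> indicator (cball 0 (real N + 1)) x * (2 * real (Suc N))\<^sup>2"
      using hR[of x n] R[of x] by (cases "norm x \<le> real N + 1") auto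
  next
    show "AE x in lborel. (\<lambda>n. h n x) \<longlonglongrightarrow> f x"
      using lim
    proof eventually_elim
      case (elim x)
      have "(\<lambda>n. h n x) \<longlonglongrightarrow> cut x *\<^sub>R cl (f x)"
        unfolding h_def using clc elim
        by (intro tendsto_intros) (auto simp: continuous_on_eq_continuous_at intro: isCont_tendsto_compose)
      moreover have "cut x *\<^sub>R cl (f x) = f x"
        using cl_id[OF B] cl_id[of 0] R[of x] by (cases "norm x \<le> real N") (auto simp: cut_def)
      ultimately show ?case by simp
    qed
  qed
  with test show ?thesis by (rule that)
qed

lemma test_functions_dense:
  fixes F :: "'a::euclidean_space L2"
  assumes "0 < e"
  obtains f where "test_function f" "norm (F - L2_class f) < e"
proof -
  define f where "f = rep_L2 F"
  have f: "f \<in> square_integrable" by (simp add: f_def rep_L2_square_integrable)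
  have [measurable]: "f \<in> borel_measurable borel" by (rule square_integrable_measurable[OF f])
  define h where "h n x = (if norm x \<le> real n \<and> cmod (f x) \<le> real n then f x else 0)" for n x
  have "(\<lambda>n. L2_class (h n)) \<longlonglongrightarrow> F"
    using truncation_tendsto(1)[OF f] by (simp add: h_def[abs_def] f_def L2_class_rep)
  then obtain n where n: "dist (L2_class (h n)) F < e / 2"
    using assms unfolding lim_sequentially by (meson half_gt_zero le_refl)
  have "h n \<in> borel_measurable borel" unfolding h_def by measurable
  then obtain k where k: "\<And>n. test_function (k n)" "(\<lambda>j. L2_class (k j)) \<longlonglongrightarrow> L2_class (h n)"
    by (rule bounded_support_approx[of "h n" n]) (auto simp: h_def)
  then obtain j where j: "dist (L2_class (k j)) (L2_class (h n)) < e / 2"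
    using assms unfolding lim_sequentially by (meson half_gt_zero le_refl)
  have "dist F (L2_class (k j)) < e"
    using n j dist_triangle[of F "L2_class (k j)" "L2_class (h n)"] by (simp add: dist_commute)
  then show ?thesis by (intro that[OF k(1)[of j]]) (simp add: dist_norm)
qed

section \<open>Adjoints of shifts and multiplications, and the Markov step\<close>

context prob_space
begin

lemma shift_product_integrable:
  fixes Z :: "'a \<Rightarrow> 'b::euclidean_space"
  assumes [measurable]: "Z \<in> borel_measurable M" and f: "f \<in> square_integrable" and g: "g \<in> square_integrable"
  shows "integrable (lborel \<Otimes>\<^sub>M M) (\<lambda>(x, \<omega>). cnj (f (x + Z \<omega>)) * g x)"
proof -
  have [measurable]: "f \<in> borel_measurable borel" "g \<in> borel_measurable borel"
    using f g by (simp_all add: square_integrable_measurable)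
  have [measurable]: "cnj \<in> borel_measurable borel"
    by (intro borel_measurable_continuous_onI continuous_intros)
  have ab: "a * b \<le> a\<^sup>2 + b\<^sup>2" if "0 \<le> a" "0 \<le> b" for a b :: real
    using sum_squares_bound[of a b] mult_nonneg_nonneg[OF that] by linarith
  have "(\<integral>\<^sup>+ p. ennreal (norm (case p of (x, \<omega>) \<Rightarrow> cnj (f (x + Z \<omega>)) * g x)) \<partial>(lborel \<Otimes>\<^sub>M M))
      = (\<integral>\<^sup>+ x. \<integral>\<^sup>+ \<omega>. ennreal (cmod (f (x + Z \<omega>)) * cmod (g x)) \<partial>M \<partial>lborel)"
    by (subst nn_integral_fst[symmetric]) (auto simp: norm_mult)
  also have "\<dots> \<le> (\<integral>\<^sup>+ x. \<integral>\<^sup>+ \<omega>. ennreal ((cmod (f (x + Z \<omega>)))\<^sup>2) + ennreal ((cmod (g x))\<^sup>2) \<partial>M \<partial>lborel)"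
    by (intro nn_integral_mono) (simp add: ab flip: ennreal_plus)
  also have "\<dots> = (\<integral>\<^sup>+ x. \<integral>\<^sup>+ \<omega>. ennreal ((cmod (f (x + Z \<omega>)))\<^sup>2) \<partial>M \<partial>lborel) + (\<integral>\<^sup>+ x. ennreal ((cmod (g x))\<^sup>2) \<partial>lborel)"
    by (simp add: nn_integral_add emeasure_space_1)
  also have "\<dots> = ennreal ((norm (L2_class f))\<^sup>2) + ennreal ((norm (L2_class g))\<^sup>2)"
    by (subst nn_integral_shift) (auto simp: norm_L2_class(2) f g)
  also have "\<dots> < \<infinity>" by simp
  finally show ?thesis by (intro integrableI_bounded) auto
qed

lemma weight_one: "weight (\<lambda>_ _. 1)"
  by (simp add: weight_def)

text \<open>For fixed \<omega> the adjoint of a translation is the opposite translation; averaging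
  over \<omega> is Fubini's theorem, applied once on each side of the substitution.\<close>

lemma cinner_shift_operator:
  fixes Z :: "'a \<Rightarrow> 'b::euclidean_space"
  assumes Z [measurable]: "Z \<in> borel_measurable M"
  shows "cinner (weighted_op (\<lambda>_ _. 1) Z F) G = cinner F (weighted_op (\<lambda>_ _. 1) (\<lambda>\<omega>. - Z \<omega>) G)"
proof -
  interpret pair_sigma_finite "lborel :: 'b measure" M ..
  define f where "f = rep_L2 F"
  define g where "g = rep_L2 G"
  have f: "f \<in> square_integrable" "F = L2_class f" and g: "g \<in> square_integrable" "G = L2_class g"
    by (auto simp: f_def g_def rep_L2_square_integrable L2_class_rep)
  have [measurable]: "f \<in> borel_measurable borel" "g \<in> borel_measurable borel"
    using f g by (simp_all add: square_integrable_measurable)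
  have [measurable]: "cnj \<in> borel_measurable borel"
    by (intro borel_measurable_continuous_onI continuous_intros)
  have mZ: "(\<lambda>\<omega>. - Z \<omega>) \<in> borel_measurable M" by measurable
  have shift: "(\<integral>x. cnj (f (x + z)) * g x \<partial>lborel) = (\<integral>x. cnj (f x) * g (x + - z) \<partial>lborel)" for z
  proof -
    have "(\<integral>x. cnj (f x) * g (x + - z) \<partial>lborel) = (\<integral>x. cnj (f x) * g (x + - z) \<partial>distr lborel borel ((+) z))"
      by (simp only: lborel_distr_plus)
    also have "\<dots> = (\<integral>x. cnj (f (z + x)) * g (z + x + - z) \<partial>lborel)" by (rule integral_distr) auto
    finally show ?thesis by (simp add: add.commute)
  qed
  note af = weighted_average(2)[OF weight_one Z f(1)] and ag = weighted_average(2)[OF weight_one mZ g(1)]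
  have "cinner (weighted_op (\<lambda>_ _. 1) Z F) G = (\<integral>x. cnj (\<integral>\<omega>. f (x + Z \<omega>) \<partial>M) * g x \<partial>lborel)"
    unfolding f(2) g(2) weighted_op_L2_class[OF weight_one Z f(1)] cinner_L2_class[OF af g(1)] by simp
  also have "\<dots> = (\<integral>x. \<integral>\<omega>. cnj (f (x + Z \<omega>)) * g x \<partial>M \<partial>lborel)"
  proof -
    have "cnj (\<integral>\<omega>. f (x + Z \<omega>) \<partial>M) * g x = (\<integral>\<omega>. cnj (f (x + Z \<omega>)) * g x \<partial>M)" for x
    proof -
      have "cnj (\<integral>\<omega>. f (x + Z \<omega>) \<partial>M) = (\<integral>\<omega>. cnj (f (x + Z \<omega>)) \<partial>M)"
        by (rule Bochner_Integration.integral_cnj[symmetric])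
      then show ?thesis by simp
    qed
    then show ?thesis by simp
  qed
  also have "\<dots> = (\<integral>\<omega>. \<integral>x. cnj (f (x + Z \<omega>)) * g x \<partial>lborel \<partial>M)"
    by (rule Fubini_integral[symmetric]) (rule shift_product_integrable[OF Z f(1) g(1)])
  also have "\<dots> = (\<integral>\<omega>. \<integral>x. cnj (f x) * g (x + - Z \<omega>) \<partial>lborel \<partial>M)"
    by (simp only: shift)
  also have "\<dots> = (\<integral>x. \<integral>\<omega>. cnj (f x) * g (x + - Z \<omega>) \<partial>M \<partial>lborel)"
  proof (rule Fubini_integral)
    have "integrable (lborel \<Otimes>\<^sub>M M) (\<lambda>p. cnj (case p of (x, \<omega>) \<Rightarrow> cnj (g (x + - Z \<omega>)) * f x))"
      by (rule integrable_cnj) (rule shift_product_integrable[OF mZ g(1) f(1)])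
    then show "integrable (lborel \<Otimes>\<^sub>M M) (\<lambda>(x, \<omega>). cnj (f x) * g (x + - Z \<omega>))"
      by (simp add: split_beta' mult.commute)
  qed
  also have "\<dots> = (\<integral>x. cnj (f x) * (\<integral>\<omega>. g (x + - Z \<omega>) \<partial>M) \<partial>lborel)"
    by simp
  also have "\<dots> = cinner F (weighted_op (\<lambda>_ _. 1) (\<lambda>\<omega>. - Z \<omega>) G)"
    unfolding f(2) g(2) weighted_op_L2_class[OF weight_one mZ g(1)] cinner_L2_class[OF f(1) ag] by simp
  finally show ?thesis .
qed

lemma weighted_op_one_distr_cong:
  fixes Z Z' :: "'a \<Rightarrow> 'b::euclidean_space"
  assumes [measurable]: "Z \<in> borel_measurable M" "Z' \<in> borel_measurable M"
    and eq: "distr M borel Z = distr M borel Z'"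
  shows "weighted_op (\<lambda>_ _. 1) Z = weighted_op (\<lambda>_ _. 1) Z'"
proof (rule ext)
  fix F :: "'b L2"
  have [measurable]: "rep_L2 F \<in> borel_measurable borel"
    by (rule square_integrable_measurable[OF rep_L2_square_integrable])
  have "(\<integral>\<omega>. rep_L2 F (x + Y \<omega>) \<partial>M) = (\<integral>z. rep_L2 F (x + z) \<partial>distr M borel Y)"
    if [measurable]: "Y \<in> borel_measurable M" for x and Y :: "'a \<Rightarrow> 'b"
    by (rule integral_distr[symmetric]) auto
  then show "weighted_op (\<lambda>_ _. 1) Z F = weighted_op (\<lambda>_ _. 1) Z' F"
    unfolding weighted_op_def using assms by simp
qed

abbreviation mult_op :: "('b::euclidean_space \<Rightarrow> real) \<Rightarrow> 'b L2 \<Rightarrow> 'b L2" where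
  "mult_op \<phi> \<equiv> weighted_op (\<lambda>x _. \<phi> x) (\<lambda>_. 0)"

abbreviation shift_op :: "('a \<Rightarrow> 'b::euclidean_space) \<Rightarrow> 'b L2 \<Rightarrow> 'b L2" where
  "shift_op Z \<equiv> weighted_op (\<lambda>_ _. 1) Z"

lemma weight_mult:
  assumes "\<phi> \<in> borel_measurable borel" "\<And>x. 0 \<le> \<phi> x" "\<And>x. \<phi> x \<le> 1"
  shows "weight (\<lambda>x _. \<phi> x)"
  using assms by (auto simp: weight_def case_prod_beta)

lemma mult_op_L2_class:
  assumes \<phi>: "\<phi> \<in> borel_measurable borel" "\<And>x. 0 \<le> \<phi> x" "\<And>x. \<phi> x \<le> 1"
    and f: "f \<in> square_integrable"
  shows "mult_op \<phi> (L2_class f) = L2_class (\<lambda>x. complex_of_real (\<phi> x) * f x)"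
    and "(\<lambda>x. complex_of_real (\<phi> x) * f x) \<in> square_integrable"
proof -
  have m0: "(\<lambda>_. 0) \<in> borel_measurable M" by simp
  show "mult_op \<phi> (L2_class f) = L2_class (\<lambda>x. complex_of_real (\<phi> x) * f x)"
    unfolding weighted_op_L2_class[OF weight_mult[OF \<phi>] m0 f] by (simp add: prob_space)
  show "(\<lambda>x. complex_of_real (\<phi> x) * f x) \<in> square_integrable"
    using weighted_average(2)[OF weight_mult[OF \<phi>] m0 f] by (simp add: prob_space)
qed

lemma cinner_mult_op:
  assumes \<phi>: "\<phi> \<in> borel_measurable borel" "\<And>x. 0 \<le> \<phi> x" "\<And>x. \<phi> x \<le> 1"
  shows "cinner (mult_op \<phi> F) G = cinner F (mult_op \<phi> G)"
proof -
  note r = rep_L2_square_integrable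
  have "cinner (mult_op \<phi> (L2_class (rep_L2 F))) (L2_class (rep_L2 G)) = cinner (L2_class (rep_L2 F)) (mult_op \<phi> (L2_class (rep_L2 G)))"
    unfolding mult_op_L2_class(1)[OF \<phi> r] cinner_L2_class[OF mult_op_L2_class(2)[OF \<phi> r] r] cinner_L2_class[OF r mult_op_L2_class(2)[OF \<phi> r]]
    by (simp add: ac_simps)
  then show ?thesis by (simp only: L2_class_rep)
qed

text \<open>\<open>Y\<close> is the past and \<open>D\<close> the next increment; \<open>Y\<close> and \<open>D'\<close> share a type because
  \<^const>\<open>prob_space.indep_var\<close> demands it.\<close>

lemma weighted_op_markov:
  fixes w :: "'b::euclidean_space \<Rightarrow> 'c \<Rightarrow> real" and N N' :: "'c measure"
    and Y D' :: "'a \<Rightarrow> 'c" and z d :: "'c \<Rightarrow> 'b" and \<phi> :: "'b \<Rightarrow> real"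
  assumes ind: "indep_var N Y N' D'" and d [measurable]: "d \<in> borel_measurable N'"
    and w [measurable]: "(\<lambda>(x, y). w x y) \<in> borel_measurable (lborel \<Otimes>\<^sub>M N)"
    and w01: "\<And>x y. y \<in> space N \<Longrightarrow> 0 \<le> w x y \<and> w x y \<le> 1"
    and z [measurable]: "z \<in> borel_measurable N"
    and \<phi>: "\<phi> \<in> borel_measurable borel" "\<And>x. 0 \<le> \<phi> x" "\<And>x. \<phi> x \<le> 1"
  defines "D \<equiv> \<lambda>\<omega>. d (D' \<omega>)"
  shows "weighted_op (\<lambda>x \<omega>. w x (Y \<omega>) * \<phi> (x + (z (Y \<omega>) + D \<omega>))) (\<lambda>\<omega>. z (Y \<omega>) + D \<omega>) F
       = weighted_op (\<lambda>x \<omega>. w x (Y \<omega>)) (\<lambda>\<omega>. z (Y \<omega>)) (shift_op D (mult_op \<phi> F))"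
proof -
  have Y [measurable]: "Y \<in> measurable M N" and D' [measurable]: "D' \<in> measurable M N'"
    and joint: "distr M N Y \<Otimes>\<^sub>M distr M N' D' = distr M (N \<Otimes>\<^sub>M N') (\<lambda>\<omega>. (Y \<omega>, D' \<omega>))"
    using ind unfolding indep_var_distribution_eq by auto
  have D [measurable]: "D \<in> borel_measurable M" unfolding D_def by measurable
  note [measurable] = \<phi>(1)
  define f where "f = rep_L2 F"
  have f: "f \<in> square_integrable" "F = L2_class f"
    by (auto simp: f_def rep_L2_square_integrable L2_class_rep)
  \<comment> \<open>The factor \<open>\<phi>\<close> at the new position is absorbed into f, so that
    what remains to be averaged depends only on the position reached. Integrating the independent
    increment first turns this average into \<open>p\<close> at the old position.\<close>
  define \<psi> where "\<psi> u = complex_of_real (\<phi> u) * f u" for u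
  have \<psi>: "\<psi> \<in> square_integrable" and F\<psi>: "mult_op \<phi> F = L2_class \<psi>"
    unfolding f(2) \<psi>_def[abs_def] by (rule mult_op_L2_class[OF \<phi> f(1)])+
  have [measurable]: "f \<in> borel_measurable borel" "\<psi> \<in> borel_measurable borel"
    by (auto intro: square_integrable_measurable f \<psi>)
  define p where "p u = (\<integral>\<omega>. \<psi> (u + D \<omega>) \<partial>M)" for u
  have p: "p \<in> square_integrable" and Fp: "shift_op D (mult_op \<phi> F) = L2_class p"
    unfolding F\<psi> using weighted_average(2)[OF weight_one D \<psi>] weighted_op_L2_class[OF weight_one D \<psi>]
    by (simp_all add: p_def[abs_def])
  have [measurable]: "p \<in> borel_measurable borel" by (rule square_integrable_measurable[OF p])
  have [measurable]: "w x \<in> borel_measurable N" for x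
    using measurable_Pair2[OF w, of x] by simp
  have W1: "weight (\<lambda>x \<omega>. w x (Y \<omega>))"
    unfolding weight_def using w01 measurable_space[OF Y]
    by (auto simp: case_prod_beta intro!: measurable_compose[OF _ w, unfolded case_prod_beta, of "\<lambda>p. (fst p, Y (snd p))", simplified])
  have W2: "weight (\<lambda>x \<omega>. w x (Y \<omega>) * \<phi> (x + (z (Y \<omega>) + D \<omega>)))"
  proof -
    have [measurable]: "(\<lambda>(x, \<omega>). w x (Y \<omega>)) \<in> borel_measurable (lborel \<Otimes>\<^sub>M M)"
      using W1 by (simp add: weight_def)
    show ?thesis
      unfolding weight_def using w01 measurable_space[OF Y] \<phi>
      by (auto intro!: mult_nonneg_nonneg mult_le_one)
  qed
  have Z1: "(\<lambda>\<omega>. z (Y \<omega>)) \<in> borel_measurable M" by measurable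
  have Z2: "(\<lambda>\<omega>. z (Y \<omega>) + D \<omega>) \<in> borel_measurable M" by measurable
  interpret \<mu>: prob_space "distr M N Y" by (rule prob_space_distr) measurable
  interpret \<delta>: prob_space "distr M N' D'" by (rule prob_space_distr) measurable
  interpret pair_sigma_finite "distr M N Y" "distr M N' D'" ..
  show ?thesis
    unfolding Fp weighted_op_L2_class[OF W1 Z1 p]
    unfolding f(2) weighted_op_L2_class[OF W2 Z2 f(1)]
  proof (rule L2_class_eq_iff[THEN iffD2])
    show "(\<lambda>x. \<integral>\<omega>. complex_of_real (w x (Y \<omega>)) * p (x + z (Y \<omega>)) \<partial>M) \<in> square_integrable"
      by (rule weighted_average(2)[OF W1 Z1 p])
    show "(\<lambda>x. \<integral>\<omega>. complex_of_real (w x (Y \<omega>) * \<phi> (x + (z (Y \<omega>) + D \<omega>))) * f (x + (z (Y \<omega>) + D \<omega>)) \<partial>M) \<in> square_integrable"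
      by (rule weighted_average(2)[OF W2 Z2 f(1)])
    show "AE x in lborel. (\<integral>\<omega>. complex_of_real (w x (Y \<omega>) * \<phi> (x + (z (Y \<omega>) + D \<omega>))) * f (x + (z (Y \<omega>) + D \<omega>)) \<partial>M)
        = (\<integral>\<omega>. complex_of_real (w x (Y \<omega>)) * p (x + z (Y \<omega>)) \<partial>M)"
      using weighted_average(1)[OF W2 Z2 f(1)]
    proof eventually_elim
      case (elim x)
      define G where "G y d' = complex_of_real (w x y) * \<psi> (x + (z y + d d'))" for y d'
      have [measurable]: "(\<lambda>(y, d). G y d) \<in> borel_measurable (N \<Otimes>\<^sub>M N')"
        unfolding G_def by measurable
      have GY: "complex_of_real (w x (Y \<omega>) * \<phi> (x + (z (Y \<omega>) + D \<omega>))) * f (x + (z (Y \<omega>) + D \<omega>)) = G (Y \<omega>) (D' \<omega>)" for \<omega>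
        by (simp add: G_def \<psi>_def D_def)
      have int: "integrable (distr M N Y \<Otimes>\<^sub>M distr M N' D') (\<lambda>(y, d). G y d)"
        unfolding joint using elim unfolding GY by (subst integrable_distr_eq) auto
      have "(\<integral>\<omega>. G (Y \<omega>) (D' \<omega>) \<partial>M) = (\<integral>q. (\<lambda>(y, d). G y d) q \<partial>distr M (N \<Otimes>\<^sub>M N') (\<lambda>\<omega>. (Y \<omega>, D' \<omega>)))"
        by (subst integral_distr) auto
      also have "\<dots> = (\<integral>y. \<integral>d. G y d \<partial>distr M N' D' \<partial>distr M N Y)"
        unfolding joint[symmetric] by (rule integral_fst[OF int, symmetric])
      also have "\<dots> = (\<integral>y. complex_of_real (w x y) * p (x + z y) \<partial>distr M N Y)"
        unfolding G_def p_def D_def by (simp add: integral_distr add.assoc)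
      also have "\<dots> = (\<integral>\<omega>. complex_of_real (w x (Y \<omega>)) * p (x + z (Y \<omega>)) \<partial>M)"
        by (rule integral_distr) auto
      finally show ?case unfolding GY .
    qed
  qed
qed

end

section \<open>Uniqueness of characteristic functions\<close>

definition gauss :: "'a::euclidean_space \<Rightarrow> real" where
  "gauss y = (\<Prod>b\<in>Basis. std_normal_density (y \<bullet> b))"

lemma sum_Basis_square: "(\<Sum>b\<in>Basis. - (y \<bullet> b)\<^sup>2 / 2) = - (norm y)\<^sup>2 / 2"
  unfolding power2_norm_eq_inner euclidean_inner[of y y]
  by (simp add: sum_negf sum_divide_distrib[symmetric] power2_eq_square)

lemma gauss_eq: "gauss (y :: 'a::euclidean_space) = (1 / sqrt (2 * pi)) ^ DIM('a) * exp (- (norm y)\<^sup>2 / 2)"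
proof -
  have "gauss y = (\<Prod>b\<in>Basis. (1 / sqrt (2 * pi)) * exp (- (y \<bullet> b)\<^sup>2 / 2))"
    by (simp add: gauss_def std_normal_density_def)
  also have "\<dots> = (1 / sqrt (2 * pi)) ^ DIM('a) * exp (\<Sum>b\<in>Basis. - (y \<bullet> b)\<^sup>2 / 2)"
    by (simp only: prod.distrib exp_sum[OF finite_Basis] prod_constant)
  also note sum_Basis_square
  finally show ?thesis .
qed

lemma gauss_nonneg: "0 \<le> gauss y"
  by (simp add: gauss_def prod_nonneg)

lemma gauss_measurable [measurable]: "gauss \<in> borel_measurable borel"
  unfolding gauss_def[abs_def] by measurable

lemma nn_integral_gauss: "(\<integral>\<^sup>+ y. ennreal (gauss (y :: 'a::euclidean_space)) \<partial>lborel) = 1"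
proof -
  have 1: "(\<integral>\<^sup>+ x. ennreal (std_normal_density x) \<partial>lborel) = 1"
    using prob_space.emeasure_space_1[OF prob_space_normal_density[of 1 0]] by (simp add: emeasure_density)
  have "(\<integral>\<^sup>+ y. ennreal (gauss (y :: 'a)) \<partial>lborel)
      = (\<integral>\<^sup>+ y. (\<Prod>b\<in>Basis. ennreal (std_normal_density (y \<bullet> b))) \<partial>(lborel :: 'a measure))"
    by (simp add: gauss_def prod_ennreal)
  also have "\<dots> = (\<Prod>b\<in>(Basis :: 'a set). \<integral>\<^sup>+ x. ennreal (std_normal_density x) \<partial>lborel)"
    by (rule nn_integral_lborel_prod) auto
  finally show ?thesis by (simp add: 1)
qed

definition normal_coords :: "('a::euclidean_space \<Rightarrow> real) measure" where
  "normal_coords = PiM Basis (\<lambda>_. std_normal_distribution)"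

definition from_coords :: "('a::euclidean_space \<Rightarrow> real) \<Rightarrow> 'a" where
  "from_coords z = (\<Sum>b\<in>Basis. z b *\<^sub>R b)"

lemma measurable_from_coords [measurable]: "from_coords \<in> borel_measurable normal_coords"
  unfolding from_coords_def[abs_def] normal_coords_def by measurable

lemma prob_space_normal_coords: "prob_space normal_coords"
  unfolding normal_coords_def by (intro prob_space_PiM prob_space_normal_density) auto

text \<open>The Gaussian is the characteristic function of a standard normal vector. Writing it as
  an average of characters reduces, by Fubini, the integral of a Gaussian bump against a law to the
  characteristic function of that law.\<close>

lemma exp_norm_square_eq_char:
  "complex_of_real (exp (- (norm y)\<^sup>2 / 2)) = (\<integral>z. iexp (from_coords z \<bullet> y) \<partial>normal_coords)"
proof -
  interpret N: prob_space std_normal_distribution by (rule prob_space_normal_density) auto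
  interpret product_sigma_finite "\<lambda>_. std_normal_distribution" ..
  have int: "integrable std_normal_distribution (\<lambda>x. iexp (x * c))" for c :: real
    by (rule N.integrable_const_bound[of _ 1]) auto
  have "(\<integral>z. iexp (from_coords z \<bullet> y) \<partial>normal_coords)
      = (\<integral>z. (\<Prod>b\<in>Basis. iexp (z b * (y \<bullet> b))) \<partial>PiM Basis (\<lambda>_. std_normal_distribution))"
  proof -
    have "iexp (from_coords z \<bullet> y) = (\<Prod>b\<in>Basis. iexp (z b * (y \<bullet> b)))" for z
    proof -
      have "from_coords z \<bullet> y = (\<Sum>b\<in>Basis. z b * (y \<bullet> b))"
        unfolding from_coords_def inner_sum_left inner_scaleR_left inner_commute[of y] ..
      then show ?thesis by (simp only: of_real_sum sum_distrib_left exp_sum[OF finite_Basis])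
    qed
    then show ?thesis by (simp only: normal_coords_def)
  qed
  also have "\<dots> = (\<Prod>b\<in>Basis. \<integral>x. iexp (x * (y \<bullet> b)) \<partial>std_normal_distribution)"
    by (rule product_integral_prod[OF finite_Basis int])
  also have "\<dots> = (\<Prod>b\<in>Basis. char std_normal_distribution (y \<bullet> b))"
    by (simp add: char_def mult.commute)
  also have "\<dots> = complex_of_real (exp (\<Sum>b\<in>Basis. - (y \<bullet> b)\<^sup>2 / 2))"
    by (simp add: char_std_normal_distribution exp_sum)
  also note sum_Basis_square
  finally show ?thesis by simp
qed

context
  fixes \<mu> \<nu> :: "'a::euclidean_space measure"
  assumes \<mu>: "prob_space \<mu>" "sets \<mu> = sets borel" and \<nu>: "prob_space \<nu>" "sets \<nu> = sets borel"
    and char_eq: "\<And>\<xi>. (\<integral>x. iexp (\<xi> \<bullet> x) \<partial>\<mu>) = (\<integral>x. iexp (\<xi> \<bullet> x) \<partial>\<nu>)"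
begin

lemma gaussian_expectation:
  assumes \<rho>: "prob_space \<rho>" "sets \<rho> = sets (borel :: 'a measure)"
  shows "(\<integral>x. complex_of_real (exp (- (norm (s *\<^sub>R (a - x)))\<^sup>2 / 2)) \<partial>\<rho>)
     = (\<integral>z. iexp (from_coords z \<bullet> (s *\<^sub>R a)) * (\<integral>x. iexp ((- s *\<^sub>R from_coords z) \<bullet> x) \<partial>\<rho>) \<partial>normal_coords)"
proof -
  interpret \<rho>: prob_space \<rho> by (rule \<rho>)
  interpret N: prob_space normal_coords by (rule prob_space_normal_coords)
  interpret pair_prob_space \<rho> normal_coords ..
  note [measurable_cong] = \<rho>(2)
  have "(\<integral>x. complex_of_real (exp (- (norm (s *\<^sub>R (a - x)))\<^sup>2 / 2)) \<partial>\<rho>)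
    = (\<integral>x. \<integral>z. iexp (from_coords z \<bullet> (s *\<^sub>R (a - x))) \<partial>normal_coords \<partial>\<rho>)"
    by (simp only: exp_norm_square_eq_char)
  also have "\<dots> = (\<integral>z. \<integral>x. iexp (from_coords z \<bullet> (s *\<^sub>R (a - x))) \<partial>\<rho> \<partial>normal_coords)"
    by (rule Fubini_integral[symmetric]) (rule P.integrable_const_bound[of _ 1], auto)
  also have "\<dots> = (\<integral>z. iexp (from_coords z \<bullet> (s *\<^sub>R a)) * (\<integral>x. iexp ((- s *\<^sub>R from_coords z) \<bullet> x) \<partial>\<rho>) \<partial>normal_coords)"
  proof (intro Bochner_Integration.integral_cong refl)
    fix z
    have "iexp (from_coords z \<bullet> (s *\<^sub>R (a - x))) = iexp (from_coords z \<bullet> (s *\<^sub>R a)) * iexp ((- s *\<^sub>R from_coords z) \<bullet> x)" for x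
      unfolding mult_exp_exp by (simp add: inner_diff_right algebra_simps)
    then show "(\<integral>x. iexp (from_coords z \<bullet> (s *\<^sub>R (a - x))) \<partial>\<rho>) = iexp (from_coords z \<bullet> (s *\<^sub>R a)) * (\<integral>x. iexp ((- s *\<^sub>R from_coords z) \<bullet> x) \<partial>\<rho>)"
      by simp
  qed
  finally show ?thesis .
qed

lemma nn_integral_gauss_eq:
  "(\<integral>\<^sup>+ x. ennreal (gauss (s *\<^sub>R (a - x))) \<partial>\<mu>) = (\<integral>\<^sup>+ x. ennreal (gauss (s *\<^sub>R (a - x))) \<partial>\<nu>)"
proof -
  have *: "(\<integral>\<^sup>+ x. ennreal (gauss (s *\<^sub>R (a - x))) \<partial>\<rho>)
     = ennreal ((1 / sqrt (2 * pi)) ^ DIM('a) * (\<integral>x. exp (- (norm (s *\<^sub>R (a - x)))\<^sup>2 / 2) \<partial>\<rho>))"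
    if \<rho>: "prob_space \<rho>" "sets \<rho> = sets (borel :: 'a measure)" for \<rho>
  proof -
    interpret \<rho>: prob_space \<rho> by (rule \<rho>)
    note [measurable_cong] = \<rho>(2)
    have "integrable \<rho> (\<lambda>x. exp (- (norm (s *\<^sub>R (a - x)))\<^sup>2 / 2))"
      by (rule \<rho>.integrable_const_bound[of _ 1]) auto
    then show ?thesis
      unfolding gauss_eq by (subst nn_integral_eq_integral) auto
  qed
  have "complex_of_real (\<integral>x. exp (- (norm (s *\<^sub>R (a - x)))\<^sup>2 / 2) \<partial>\<mu>)
      = complex_of_real (\<integral>x. exp (- (norm (s *\<^sub>R (a - x)))\<^sup>2 / 2) \<partial>\<nu>)"
    unfolding integral_complex_of_real[symmetric] gaussian_expectation[OF \<mu>] gaussian_expectation[OF \<nu>]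
    by (simp only: char_eq)
  then show ?thesis unfolding *[OF \<mu>] *[OF \<nu>] by (simp only: of_real_eq_iff)
qed

text \<open>The substitution a = x + \<sigma> y moves the Gaussian onto the law: the smoothed
  integral becomes an integral over a of f against the mean of a Gaussian bump centred at a, and
  these means agree. \<open>C\<close> is the Jacobian, positive and finite, hence
  cancellable.\<close>

lemma smoothed_integral_eq:
  fixes f :: "'a \<Rightarrow> real"
  assumes [measurable]: "f \<in> borel_measurable borel" and \<sigma>: "0 < \<sigma>"
  shows "(\<integral>\<^sup>+ x. \<integral>\<^sup>+ y. ennreal (f (x + \<sigma> *\<^sub>R y)) * ennreal (gauss y) \<partial>lborel \<partial>\<mu>)
       = (\<integral>\<^sup>+ x. \<integral>\<^sup>+ y. ennreal (f (x + \<sigma> *\<^sub>R y)) * ennreal (gauss y) \<partial>lborel \<partial>\<nu>)"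
proof -
  define C where "C = ennreal (\<sigma> ^ DIM('a))"
  have C: "C * A = C * B \<Longrightarrow> A = B" for A B :: ennreal
    using \<sigma> by (simp add: C_def ennreal_mult_cancel_left)
  have "C * (\<integral>\<^sup>+ x. \<integral>\<^sup>+ y. ennreal (f (x + \<sigma> *\<^sub>R y)) * ennreal (gauss y) \<partial>lborel \<partial>\<rho>)
     = (\<integral>\<^sup>+ a. ennreal (f a) * (\<integral>\<^sup>+ x. ennreal (gauss (inverse \<sigma> *\<^sub>R (a - x))) \<partial>\<rho>) \<partial>lborel)"
    if \<rho>: "prob_space \<rho>" "sets \<rho> = sets (borel :: 'a measure)" for \<rho>
  proof -
    interpret \<rho>: prob_space \<rho> by (rule \<rho>)
    interpret pair_sigma_finite "lborel :: 'a measure" \<rho> ..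
    note [measurable_cong] = \<rho>(2)
    have sub: "(\<integral>\<^sup>+ a. ennreal (f a) * ennreal (gauss (inverse \<sigma> *\<^sub>R (a - x))) \<partial>lborel)
        = C * (\<integral>\<^sup>+ y. ennreal (f (x + \<sigma> *\<^sub>R y)) * ennreal (gauss y) \<partial>lborel)" for x
    proof -
      have "(\<integral>\<^sup>+ a. ennreal (f a) * ennreal (gauss (inverse \<sigma> *\<^sub>R (a - x))) \<partial>lborel)
        = (\<integral>\<^sup>+ a. ennreal (f a) * ennreal (gauss (inverse \<sigma> *\<^sub>R (a - x)))
             \<partial>density (distr lborel borel (\<lambda>y. x + \<sigma> *\<^sub>R y)) (\<lambda>_. ennreal (\<bar>\<sigma>\<bar> ^ DIM('a))))"
        using \<sigma> by (subst lborel_affine[of \<sigma> x]) auto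
      also have "\<dots> = C * (\<integral>\<^sup>+ y. ennreal (f (x + \<sigma> *\<^sub>R y)) * ennreal (gauss y) \<partial>lborel)"
        using \<sigma> by (simp add: nn_integral_density nn_integral_distr nn_integral_cmult C_def)
      finally show ?thesis .
    qed
    have "C * (\<integral>\<^sup>+ x. \<integral>\<^sup>+ y. ennreal (f (x + \<sigma> *\<^sub>R y)) * ennreal (gauss y) \<partial>lborel \<partial>\<rho>)
      = (\<integral>\<^sup>+ x. C * (\<integral>\<^sup>+ y. ennreal (f (x + \<sigma> *\<^sub>R y)) * ennreal (gauss y) \<partial>lborel) \<partial>\<rho>)"
      by (rule nn_integral_cmult[symmetric]) measurable
    also have "\<dots> = (\<integral>\<^sup>+ x. \<integral>\<^sup>+ a. ennreal (f a) * ennreal (gauss (inverse \<sigma> *\<^sub>R (a - x))) \<partial>lborel \<partial>\<rho>)"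
      by (simp only: sub)
    also have "\<dots> = (\<integral>\<^sup>+ a. \<integral>\<^sup>+ x. ennreal (f a) * ennreal (gauss (inverse \<sigma> *\<^sub>R (a - x))) \<partial>\<rho> \<partial>lborel)"
      by (rule Fubini') measurable
    also have "\<dots> = (\<integral>\<^sup>+ a. ennreal (f a) * (\<integral>\<^sup>+ x. ennreal (gauss (inverse \<sigma> *\<^sub>R (a - x))) \<partial>\<rho>) \<partial>lborel)"
      by (intro nn_integral_cong nn_integral_cmult) measurable
    finally show ?thesis .
  qed
  note * = this
  show ?thesis by (rule C) (simp only: *[OF \<mu>] *[OF \<nu>] nn_integral_gauss_eq)
qed

lemma smoothing_limit:
  fixes f :: "'a \<Rightarrow> real"
  assumes f: "continuous_on UNIV f" and f01: "\<And>x. 0 \<le> f x" "\<And>x. f x \<le> 1"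
    and \<rho>: "prob_space \<rho>" "sets \<rho> = sets (borel :: 'a measure)"
  shows "(\<lambda>n. \<integral>\<^sup>+ x. \<integral>\<^sup>+ y. ennreal (f (x + inverse (real (Suc n)) *\<^sub>R y)) * ennreal (gauss y) \<partial>lborel \<partial>\<rho>)
      \<longlonglongrightarrow> (\<integral>\<^sup>+ x. ennreal (f x) \<partial>\<rho>)"
proof -
  interpret \<rho>: prob_space \<rho> by (rule \<rho>)
  note [measurable_cong] = \<rho>(2)
  have [measurable]: "f \<in> borel_measurable borel" using f by (rule borel_measurable_continuous_onI)
  have le: "ennreal (f u) * ennreal (gauss y) \<le> ennreal (gauss y)" for u and y :: 'a
    using f01[of u] mult_right_mono[of "ennreal (f u)" 1 "ennreal (gauss y)"] by (simp add: ennreal_le_1)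
  show ?thesis
  proof (rule nn_integral_dominated_convergence[where w = "\<lambda>_. 1"])
    show "AE x in \<rho>. (\<integral>\<^sup>+ y. ennreal (f (x + inverse (real (Suc n)) *\<^sub>R y)) * ennreal (gauss y) \<partial>lborel) \<le> 1" for n
    proof (rule AE_I2)
      fix x
      have "(\<integral>\<^sup>+ y. ennreal (f (x + inverse (real (Suc n)) *\<^sub>R y)) * ennreal (gauss y) \<partial>lborel)
          \<le> (\<integral>\<^sup>+ y. ennreal (gauss (y :: 'a)) \<partial>lborel)"
        by (intro nn_integral_mono le)
      then show "(\<integral>\<^sup>+ y. ennreal (f (x + inverse (real (Suc n)) *\<^sub>R y)) * ennreal (gauss y) \<partial>lborel) \<le> 1"
        by (simp only: nn_integral_gauss)
    qed
    show "AE x in \<rho>. (\<lambda>n. \<integral>\<^sup>+ y. ennreal (f (x + inverse (real (Suc n)) *\<^sub>R y)) * ennreal (gauss y) \<partial>lborel) \<longlonglongrightarrow> ennreal (f x)"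
    proof (rule AE_I2)
      fix x
      have "(\<lambda>n. \<integral>\<^sup>+ y. ennreal (f (x + inverse (real (Suc n)) *\<^sub>R y)) * ennreal (gauss y) \<partial>lborel) \<longlonglongrightarrow> (\<integral>\<^sup>+ y. ennreal (f x) * ennreal (gauss (y :: 'a)) \<partial>lborel)"
      proof (rule nn_integral_dominated_convergence[where w = "\<lambda>y::'a. ennreal (gauss y)"])
        show "AE y in lborel. (\<lambda>n. ennreal (f (x + inverse (real (Suc n)) *\<^sub>R y)) * ennreal (gauss y)) \<longlonglongrightarrow> ennreal (f x) * ennreal (gauss y)"
        proof (rule AE_I2)
          fix y :: 'a
          have "(\<lambda>n. x + inverse (real (Suc n)) *\<^sub>R y) \<longlonglongrightarrow> x + 0 *\<^sub>R y"
            by (intro tendsto_intros LIMSEQ_inverse_real_of_nat)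
          then have "(\<lambda>n. f (x + inverse (real (Suc n)) *\<^sub>R y)) \<longlonglongrightarrow> f x"
            using continuous_on_tendsto_compose[OF f] by simp
          then have "(\<lambda>n. ennreal (f (x + inverse (real (Suc n)) *\<^sub>R y) * gauss y)) \<longlonglongrightarrow> ennreal (f x * gauss y)"
            by (intro tendsto_ennrealI tendsto_mult tendsto_const)
          then show "(\<lambda>n. ennreal (f (x + inverse (real (Suc n)) *\<^sub>R y)) * ennreal (gauss y)) \<longlonglongrightarrow> ennreal (f x) * ennreal (gauss y)"
            by (simp add: ennreal_mult f01 gauss_nonneg)
        qed
      qed (auto simp: nn_integral_gauss le)
      then show "(\<lambda>n. \<integral>\<^sup>+ y. ennreal (f (x + inverse (real (Suc n)) *\<^sub>R y)) * ennreal (gauss y) \<partial>lborel) \<longlonglongrightarrow> ennreal (f x)"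
        by (simp add: nn_integral_cmult nn_integral_gauss)
    qed
  qed (auto simp: \<rho>.emeasure_space_1)
qed

text \<open>The laws agree on Gaussian smoothings; letting the width tend to 0 they agree on
  continuous functions with values in [0,1], and such functions approximate the indicators of closed
  sets, which form an intersection stable generator.\<close>

theorem char_eq_imp_measure_eq: "\<mu> = \<nu>"
proof (rule measure_eqI_generator_eq[where E = "Collect closed" and \<Omega> = UNIV and A = "\<lambda>_. UNIV"])
  show "Int_stable (Collect closed :: 'a set set)" by (auto simp: Int_stable_def)
  have "sets (borel :: 'a measure) = sigma_sets UNIV (Collect closed)"
    by (subst borel_eq_closed) simp
  then show "sets \<mu> = sigma_sets UNIV (Collect closed)" "sets \<nu> = sigma_sets UNIV (Collect closed)"
    using \<mu>(2) \<nu>(2) by auto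
  show "emeasure \<mu> UNIV \<noteq> \<infinity>"
    using prob_space.emeasure_space_1[OF \<mu>(1)] sets_eq_imp_space_eq[OF \<mu>(2)] by simp
  fix S :: "'a set" assume "S \<in> Collect closed"
  then have S: "closed S" by simp
  show "emeasure \<mu> S = emeasure \<nu> S"
  \<comment> \<open>By convention the distance to the empty set is 0, so the approximation of the
    indicator works only for nonempty sets.\<close>
  proof (cases "S = {}")
    case False
    define f where "f n x = max 0 (1 - real n * infdist x S)" for n x
    have f: "continuous_on UNIV (f n)" "0 \<le> f n x" "f n x \<le> 1" for n x
      unfolding f_def by (auto intro!: continuous_intros simp: infdist_nonneg)
    have fm [measurable]: "f n \<in> borel_measurable borel" for n
      using f(1) by (rule borel_measurable_continuous_onI)
    have eq: "(\<integral>\<^sup>+ x. ennreal (f n x) \<partial>\<mu>) = (\<integral>\<^sup>+ x. ennreal (f n x) \<partial>\<nu>)" for n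
      using smoothing_limit[OF f \<mu>, of n] smoothing_limit[OF f \<nu>, of n] LIMSEQ_unique
      by (simp add: smoothed_integral_eq)
    have lim: "(\<lambda>n. \<integral>\<^sup>+ x. ennreal (f n x) \<partial>\<rho>) \<longlonglongrightarrow> emeasure \<rho> S"
      if \<rho>: "prob_space \<rho>" "sets \<rho> = sets (borel :: 'a measure)" for \<rho>
    proof -
      interpret \<rho>: prob_space \<rho> by (rule \<rho>)
      note [measurable_cong] = \<rho>(2)
      have [measurable]: "S \<in> sets borel" using S by simp
      have "(\<lambda>n. \<integral>\<^sup>+ x. ennreal (f n x) \<partial>\<rho>) \<longlonglongrightarrow> (\<integral>\<^sup>+ x. indicator S x \<partial>\<rho>)"
      proof (rule nn_integral_dominated_convergence[where w = "\<lambda>_. 1"])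
        show "AE x in \<rho>. (\<lambda>n. ennreal (f n x)) \<longlonglongrightarrow> indicator S x"
        proof (rule AE_I2)
          fix x
          show "(\<lambda>n. ennreal (f n x)) \<longlonglongrightarrow> indicator S x"
          proof (cases "x \<in> S")
            case True
            then show ?thesis by (simp add: f_def)
          next
            case False
            then have "0 < infdist x S"
              using S \<open>S \<noteq> {}\<close> by (simp add: infdist_pos_not_in_closed)
            then obtain N :: nat where N: "1 < real N * infdist x S" using reals_Archimedean3 by blast
            have "ennreal (f n x) = 0" if "N \<le> n" for n
            proof -
              have "real N * infdist x S \<le> real n * infdist x S"
                using that by (intro mult_right_mono) (auto simp: infdist_nonneg)
              then show ?thesis using N by (simp add: f_def)
            qed
            then show ?thesis using False
              by (intro tendsto_eventually) (auto simp: eventually_sequentially)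
          qed
        qed
      qed (auto simp: f \<rho>.emeasure_space_1 ennreal_le_1)
      then show ?thesis using \<rho>(2) by simp
    qed
    show ?thesis
      using lim[OF \<mu>] lim[OF \<nu>] LIMSEQ_unique by (simp add: eq)
  qed simp
qed auto

end

section \<open>Feynman-Kac operators of the Cauchy process\<close>

locale cauchy_motion = prob_space M for M :: "'w measure" +
  fixes X :: "real \<Rightarrow> 'w \<Rightarrow> 'a::euclidean_space"
  assumes cauchy: "cauchy_process M X"
begin

lemma measurable_X [measurable]: "0 \<le> t \<Longrightarrow> X t \<in> borel_measurable M"
  and X_0: "AE \<omega> in M. X 0 \<omega> = 0"
  using cauchy by (auto simp: cauchy_process_def levy_process_def)

lemma independent_increments:
  fixes \<tau> :: "nat \<Rightarrow> real"
  assumes "0 \<le> \<tau> 0" "\<And>i. i < n \<Longrightarrow> \<tau> i < \<tau> (Suc i)"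
  shows "indep_vars (\<lambda>_. borel) (\<lambda>i \<omega>. X (\<tau> (Suc i)) \<omega> - X (\<tau> i) \<omega>) {..<n}"
  using cauchy assms by (auto simp: cauchy_process_def levy_process_def)

lemma stationary_increments:
  assumes "0 \<le> s" "0 \<le> h"
  shows "distr M borel (\<lambda>\<omega>. X (s + h) \<omega> - X s \<omega>) = distr M borel (X h)"
proof -
  have "distr M borel (\<lambda>\<omega>. X (s + h) \<omega> - X s \<omega>) = distr M borel (\<lambda>\<omega>. X h \<omega> - X 0 \<omega>)"
    using cauchy assms by (auto simp: cauchy_process_def levy_process_def)
  also have "\<dots> = distr M borel (X h)"
  proof (rule distr_cong_AE)
    show "AE \<omega> in M. X h \<omega> - X 0 \<omega> = X h \<omega>" using X_0 by eventually_elim simp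
  qed (use assms in auto)
  finally show ?thesis .
qed

lemma right_continuous: "\<omega> \<in> space M \<Longrightarrow> 0 \<le> t \<Longrightarrow> ((\<lambda>s. X s \<omega>) \<longlongrightarrow> X t \<omega>) (at_right t)"
  using cauchy by (auto simp: cauchy_process_def levy_process_def cadlag_def)

lemma distr_uminus_X:
  assumes t: "0 \<le> t"
  shows "distr M borel (\<lambda>\<omega>. - X t \<omega>) = distr M borel (X t)"
proof (rule char_eq_imp_measure_eq)
  note [measurable] = measurable_X[OF t]
  have ch: "(\<integral>\<omega>. iexp (\<xi> \<bullet> X t \<omega>) \<partial>M) = complex_of_real (exp (- t * norm \<xi>))" for \<xi>
    using cauchy t by (auto simp: cauchy_process_def)
  fix \<xi> :: 'a
  have "(\<integral>x. iexp (\<xi> \<bullet> x) \<partial>distr M borel (\<lambda>\<omega>. - X t \<omega>)) = (\<integral>\<omega>. iexp ((- \<xi>) \<bullet> X t \<omega>) \<partial>M)"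
    by (subst integral_distr) auto
  also have "\<dots> = (\<integral>\<omega>. iexp (\<xi> \<bullet> X t \<omega>) \<partial>M)"
    unfolding ch by simp
  also have "\<dots> = (\<integral>x. iexp (\<xi> \<bullet> x) \<partial>distr M borel (X t))"
    by (subst integral_distr) auto
  finally show "(\<integral>x. iexp (\<xi> \<bullet> x) \<partial>distr M borel (\<lambda>\<omega>. - X t \<omega>)) = (\<integral>x. iexp (\<xi> \<bullet> x) \<partial>distr M borel (X t))" .
qed (use t in \<open>auto intro!: prob_space_distr\<close>)

text \<open>Reading the path at a grid time depends on time only through an integer, which makes it
  jointly measurable. Grid times decreasing to the given time recover the path by right
  continuity.\<close>

lemma measurable_X_joint [measurable]:
  "(\<lambda>(s, \<omega>). X (max 0 s) \<omega>) \<in> borel_measurable (lborel \<Otimes>\<^sub>M M)"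
proof (rule borel_measurable_LIMSEQ_metric)
  fix n :: nat
  have "(\<lambda>p. X (real (Suc k) / real (Suc n)) (snd p)) \<in> borel_measurable (lborel \<Otimes>\<^sub>M M)" for k
    by measurable
  moreover have "(\<lambda>p. nat \<lfloor>max 0 (fst p) * real (Suc n)\<rfloor>) \<in> measurable (lborel \<Otimes>\<^sub>M M) (count_space UNIV)"
    by measurable
  ultimately show "(\<lambda>p. X (real (Suc (nat \<lfloor>max 0 (fst p) * real (Suc n)\<rfloor>)) / real (Suc n)) (snd p)) \<in> borel_measurable (lborel \<Otimes>\<^sub>M M)"
    by (rule measurable_compose_countable)
next
  fix p assume "p \<in> space (lborel \<Otimes>\<^sub>M M :: (real \<times> 'w) measure)"
  then have p: "snd p \<in> space M" by (simp add: space_pair_measure mem_Times_iff)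
  define u where "u = max 0 (fst p)"
  have u: "0 \<le> u" by (simp add: u_def)
  \<comment> \<open>The successor of the integer part puts the grid time strictly to the right,
    where the one-sided limit applies.\<close>
  define r where "r n = real (Suc (nat \<lfloor>u * real (Suc n)\<rfloor>)) / real (Suc n)" for n
  have k: "u * real (Suc n) < real (Suc (nat \<lfloor>u * real (Suc n)\<rfloor>))"
    "real (Suc (nat \<lfloor>u * real (Suc n)\<rfloor>)) \<le> u * real (Suc n) + 1" for n
  proof -
    have "0 \<le> u * real (Suc n)" using u by simp
    then have "real (nat \<lfloor>u * real (Suc n)\<rfloor>) = of_int \<lfloor>u * real (Suc n)\<rfloor>" by simp
    then show "u * real (Suc n) < real (Suc (nat \<lfloor>u * real (Suc n)\<rfloor>))"
      "real (Suc (nat \<lfloor>u * real (Suc n)\<rfloor>)) \<le> u * real (Suc n) + 1" by linarith+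
  qed
  have ru: "u < r n" "r n \<le> u + inverse (real (Suc n))" for n
  proof -
    show "u < r n" unfolding r_def using k(1)[of n] by (simp only: pos_less_divide_eq of_nat_0_less_iff zero_less_Suc)
    have "r n \<le> (u * real (Suc n) + 1) / real (Suc n)"
      unfolding r_def by (intro divide_right_mono k) simp
    also have "\<dots> = u + inverse (real (Suc n))"
      by (simp add: add_divide_distrib inverse_eq_divide del: of_nat_Suc)
    finally show "r n \<le> u + inverse (real (Suc n))" .
  qed
  have "r \<longlonglongrightarrow> u"
  proof (rule tendsto_sandwich[of "\<lambda>_. u" r sequentially "\<lambda>n. u + inverse (real (Suc n))"])
    show "(\<lambda>n. u + inverse (real (Suc n))) \<longlonglongrightarrow> u"
      using tendsto_add[OF tendsto_const LIMSEQ_inverse_real_of_nat, of u] by simp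
  qed (use ru in \<open>auto intro!: always_eventually less_imp_le simp del: of_nat_Suc\<close>)
  then have "filterlim r (at_right u) sequentially"
    by (rule tendsto_imp_filterlim_at_right) (simp add: ru)
  from filterlim_compose[OF right_continuous[OF p u] this]
  show "(\<lambda>n. X (real (Suc (nat \<lfloor>max 0 (fst p) * real (Suc n)\<rfloor>)) / real (Suc n)) (snd p)) \<longlonglongrightarrow> (case p of (s, \<omega>) \<Rightarrow> X (max 0 s) \<omega>)"
    by (simp add: r_def u_def split_beta)
qed

section \<open>Occupation integrals along a path\<close>

lemma measurable_path: "\<omega> \<in> space M \<Longrightarrow> (\<lambda>s. X (max 0 s) \<omega>) \<in> borel_measurable lborel"
  using measurable_Pair1[OF measurable_X_joint, of \<omega>] by simp

lemma measurable_path_triple: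
  assumes [measurable]: "f \<in> measurable borel N"
  shows "(\<lambda>((x, \<omega>), s). f (x + X (max 0 s) \<omega>)) \<in> measurable ((lborel \<Otimes>\<^sub>M M) \<Otimes>\<^sub>M lborel) N"
proof -
  have [measurable]: "(\<lambda>p. X (max 0 (snd p)) (snd (fst p))) \<in> borel_measurable ((lborel \<Otimes>\<^sub>M M) \<Otimes>\<^sub>M lborel)"
    using measurable_compose[OF _ measurable_X_joint, of "\<lambda>p. (snd p, snd (fst p))" "(lborel \<Otimes>\<^sub>M M) \<Otimes>\<^sub>M lborel"]
    by simp
  show ?thesis unfolding split_beta by measurable
qed

text \<open>The process is unspecified at negative times, hence \<open>max 0 s\<close>.\<close>

definition occupation :: "('a \<Rightarrow> ennreal) \<Rightarrow> real \<Rightarrow> 'a \<Rightarrow> 'w \<Rightarrow> ennreal" where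
  "occupation f t x \<omega> = (\<integral>\<^sup>+ s. f (x + X (max 0 s) \<omega>) * indicator {0..t} s \<partial>lborel)"

lemma measurable_occupation:
  assumes [measurable]: "f \<in> borel_measurable borel"
  shows "(\<lambda>(x, \<omega>). occupation f t x \<omega>) \<in> borel_measurable (lborel \<Otimes>\<^sub>M M)"
proof -
  have [measurable]: "(\<lambda>(p, s). f (fst p + X (max 0 s) (snd p))) \<in> borel_measurable ((lborel \<Otimes>\<^sub>M M) \<Otimes>\<^sub>M lborel)"
    using measurable_path_triple[OF assms] by (simp add: split_beta)
  have "(\<lambda>p. \<integral>\<^sup>+ s. f (fst p + X (max 0 s) (snd p)) * indicator {0..t} s \<partial>lborel) \<in> borel_measurable (lborel \<Otimes>\<^sub>M M)"
    by measurable
  then show ?thesis by (simp add: occupation_def split_beta)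
qed

text \<open>Lebesgue measure is invariant for the process: at each time the mean of f along the
  path, integrated over all starting points, is the integral of f. The rest is Tonelli's
  theorem.\<close>

lemma nn_integral_occupation:
  assumes f [measurable]: "f \<in> borel_measurable borel" and t: "0 \<le> t"
  shows "(\<integral>\<^sup>+ x. \<integral>\<^sup>+ \<omega>. occupation f t x \<omega> \<partial>M \<partial>lborel) = ennreal t * (\<integral>\<^sup>+ x. f x \<partial>lborel)"
proof -
  interpret P1: pair_sigma_finite "lborel :: real measure" M ..
  note [measurable] = measurable_path_triple[OF f, unfolded split_beta]
  have m1: "(\<lambda>(s, \<omega>). f (x + X (max 0 s) \<omega>) * indicator {0..t} s) \<in> borel_measurable (lborel \<Otimes>\<^sub>M M)" for x
    by measurable
  have m2: "(\<lambda>(s, x). \<integral>\<^sup>+ \<omega>. f (x + X (max 0 s) \<omega>) * indicator {0..t} s \<partial>M) \<in> borel_measurable (lborel \<Otimes>\<^sub>M lborel)"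
  proof -
    have [measurable]: "(\<lambda>q. X (max 0 (fst (fst q))) (snd q)) \<in> borel_measurable ((lborel \<Otimes>\<^sub>M (lborel :: 'a measure)) \<Otimes>\<^sub>M M)"
      using measurable_compose[OF _ measurable_X_joint, of "\<lambda>q. (fst (fst q), snd q)" "(lborel \<Otimes>\<^sub>M lborel) \<Otimes>\<^sub>M M"]
      by simp
    show ?thesis unfolding split_beta
      by (rule borel_measurable_nn_integral) (simp add: split_beta)
  qed
  have "(\<integral>\<^sup>+ x. \<integral>\<^sup>+ \<omega>. occupation f t x \<omega> \<partial>M \<partial>lborel)
      = (\<integral>\<^sup>+ x. \<integral>\<^sup>+ s. \<integral>\<^sup>+ \<omega>. f (x + X (max 0 s) \<omega>) * indicator {0..t} s \<partial>M \<partial>lborel \<partial>lborel)"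
    unfolding occupation_def by (intro nn_integral_cong P1.Fubini' m1)
  also have "\<dots> = (\<integral>\<^sup>+ s. \<integral>\<^sup>+ x. \<integral>\<^sup>+ \<omega>. f (x + X (max 0 s) \<omega>) * indicator {0..t} s \<partial>M \<partial>lborel \<partial>lborel)"
    by (rule lborel_pair.Fubini'[OF m2])
  also have "\<dots> = (\<integral>\<^sup>+ s. (\<integral>\<^sup>+ x. f x \<partial>lborel) * indicator {0..t} s \<partial>lborel)"
  proof (intro nn_integral_cong)
    fix s :: real
    have [measurable]: "X (max 0 s) \<in> borel_measurable M" by (rule measurable_X) simp
    have "(\<integral>\<^sup>+ x. \<integral>\<^sup>+ \<omega>. f (x + X (max 0 s) \<omega>) * indicator {0..t} s \<partial>M \<partial>lborel)
        = (\<integral>\<^sup>+ x. \<integral>\<^sup>+ \<omega>. f (x + X (max 0 s) \<omega>) \<partial>M \<partial>lborel) * indicator {0..t} s"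
      by (simp add: nn_integral_multc)
    also have "\<dots> = (\<integral>\<^sup>+ x. f x \<partial>lborel) * indicator {0..t} s"
      by (subst nn_integral_shift) auto
    finally show "(\<integral>\<^sup>+ x. \<integral>\<^sup>+ \<omega>. f (x + X (max 0 s) \<omega>) * indicator {0..t} s \<partial>M \<partial>lborel) = (\<integral>\<^sup>+ x. f x \<partial>lborel) * indicator {0..t} s" .
  qed
  also have "\<dots> = ennreal t * (\<integral>\<^sup>+ x. f x \<partial>lborel)"
    using t by (simp add: nn_integral_cmult mult.commute)
  finally show ?thesis .
qed

text \<open>The occupation integral of a null set vanishes on average, hence almost surely for
  almost every starting point. Properties of the potential that hold almost everywhere in space thus
  hold at almost all times along the path.\<close>

lemma AE_path:
  assumes P: "AE x in lborel. P x" and t: "0 \<le> t"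
  shows "AE x in lborel. AE \<omega> in M. AE s in lborel. s \<in> {0..t} \<longrightarrow> P (x + X s \<omega>)"
proof -
  obtain N where N: "{x. \<not> P x} \<subseteq> N" "emeasure lborel N = 0" "N \<in> sets borel"
    using P by (auto elim!: AE_E)
  have m: "(indicator N :: 'a \<Rightarrow> ennreal) \<in> borel_measurable borel" using N(3) by simp
  note [measurable] = measurable_occupation[OF m]
  have [measurable]: "occupation (indicator N) t x \<in> borel_measurable M" for x
    using measurable_Pair2[OF measurable_occupation[OF m], of x] by simp
  have "(\<integral>\<^sup>+ x. \<integral>\<^sup>+ \<omega>. occupation (indicator N) t x \<omega> \<partial>M \<partial>lborel) = 0"
    unfolding nn_integral_occupation[OF m t] using N by simp
  then have "AE x in lborel. (\<integral>\<^sup>+ \<omega>. occupation (indicator N) t x \<omega> \<partial>M) = 0"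
    by (subst (asm) nn_integral_0_iff_AE) auto
  then show ?thesis
  proof eventually_elim
    case (elim x)
    then have "AE \<omega> in M. occupation (indicator N) t x \<omega> = 0"
      by (subst (asm) nn_integral_0_iff_AE) auto
    moreover have "AE \<omega> in M. occupation (indicator N) t x \<omega> = 0 \<longrightarrow>
        (AE s in lborel. s \<in> {0..t} \<longrightarrow> P (x + X s \<omega>))"
    proof (rule AE_I2, rule impI)
      fix \<omega> assume \<omega>: "\<omega> \<in> space M" and "occupation (indicator N) t x \<omega> = 0"
      note [measurable] = measurable_path[OF \<omega>] N(3)
      have "AE s in lborel. (indicator N (x + X (max 0 s) \<omega>) * indicator {0..t} s :: ennreal) = 0"
        using \<open>occupation (indicator N) t x \<omega> = 0\<close> unfolding occupation_def
        by (subst (asm) nn_integral_0_iff_AE) auto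
      then show "AE s in lborel. s \<in> {0..t} \<longrightarrow> P (x + X s \<omega>)"
        by eventually_elim (use N(1) in \<open>auto simp: indicator_def max_absorb2 split: if_splits\<close>)
    qed
    ultimately show ?case by (rule AE_mp)
  qed
qed

end

text \<open>The exponential exp (- a) on [0, \<infinity>], with the value 0 at \<infinity> that the
  definition of the Feynman-Kac weight prescribes for a non-integrable path.\<close>

definition wexp :: "ennreal \<Rightarrow> real" where
  "wexp a = (if a = \<top> then 0 else exp (- enn2real a))"

lemma wexp_bounds: "0 \<le> wexp a" "wexp a \<le> 1"
  by (auto simp: wexp_def)

lemma measurable_wexp [measurable]: "wexp \<in> borel_measurable borel"
  unfolding wexp_def[abs_def] by measurable

lemma wexp_ennreal: "0 \<le> r \<Longrightarrow> wexp (ennreal r) = exp (- r)"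
  by (simp add: wexp_def)

text \<open>Continuity includes the point \<infinity>, where it rests on the value 0. Potentials may
  therefore be approximated without finiteness of the limiting path integral.\<close>

lemma tendsto_wexp:
  assumes lim: "u \<longlonglongrightarrow> a"
  shows "(\<lambda>n. wexp (u n)) \<longlonglongrightarrow> wexp a"
proof (cases "a = \<top>")
  case False
  then have "eventually (\<lambda>n. u n < \<top>) sequentially"
    using lim by (intro order_tendstoD(2)[OF lim]) (simp add: top.not_eq_extremum)
  then have ev: "eventually (\<lambda>n. exp (- enn2real (u n)) = wexp (u n)) sequentially"
    by eventually_elim (auto simp: wexp_def)
  have "(\<lambda>n. exp (- enn2real (u n))) \<longlonglongrightarrow> exp (- enn2real a)"
  proof -
    have "a = ennreal (enn2real a)" using False by (simp add: top.not_eq_extremum)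
    then have "u \<longlonglongrightarrow> ennreal (enn2real a)" using lim by simp
    then show ?thesis by (intro tendsto_intros) auto
  qed
  from Lim_transform_eventually[OF this ev] show ?thesis using False by (simp add: wexp_def)
next
  case True
  show ?thesis
  proof (rule LIMSEQ_I)
    fix e :: real assume e: "0 < e"
    define B where "B = max 0 (- ln (e / 2))"
    have B: "exp (- B) < e"
    proof -
      have "exp (- B) \<le> exp (ln (e / 2))" by (simp add: B_def)
      also have "\<dots> < e" using e by simp
      finally show ?thesis .
    qed
    have "eventually (\<lambda>n. ennreal B < u n) sequentially"
      using True by (intro order_tendstoD(1)[OF lim]) simp
    then obtain N where N: "\<And>n. N \<le> n \<Longrightarrow> ennreal B < u n" by (auto simp: eventually_sequentially)
    have "wexp (u n) < e" if "N \<le> n" for n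
    proof (cases "u n = \<top>")
      case False
      then obtain r where r: "u n = ennreal r" "0 \<le> r" by (cases "u n") auto
      have "0 \<le> B" by (simp add: B_def)
      then have "B < r" using N[OF that] unfolding r(1) by (rule ennreal_less_iff[THEN iffD1])
      then have "exp (- r) < e" using B by (meson exp_less_mono neg_less_iff_less order_less_trans)
      then show ?thesis using r by (simp add: wexp_ennreal)
    qed (use e in \<open>simp add: wexp_def\<close>)
    then show "\<exists>no. \<forall>n\<ge>no. norm (wexp (u n) - wexp a) < e"
    proof -
      have "wexp a = 0" using True by (simp add: wexp_def)
      then show ?thesis
        using \<open>\<And>n. N \<le> n \<Longrightarrow> wexp (u n) < e\<close> wexp_bounds by (intro exI[of _ N]) simp
    qed
  qed
qed

section \<open>Feynman-Kac weights through occupation integrals\<close>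

context cauchy_motion
begin

text \<open>The coercion to \<^typ>\<open>ennreal\<close> truncates negative values of \<open>V\<close>, which makes the weight lie in
  \<open>[0, 1]\<close> everywhere and not only off the null set where \<open>V\<close> is negative.\<close>

definition occupation_weight :: "('a \<Rightarrow> real) \<Rightarrow> real \<Rightarrow> 'a \<Rightarrow> 'w \<Rightarrow> real" where
  "occupation_weight V t x \<omega> = wexp (occupation (\<lambda>x. ennreal (V x)) t x \<omega>)"

lemma weight_occupation_weight:
  assumes [measurable]: "V \<in> borel_measurable borel"
  shows "weight (occupation_weight V t)"
proof -
  have m: "(\<lambda>x. ennreal (V x)) \<in> borel_measurable borel" by measurable
  note [measurable] = measurable_occupation[OF m, of t]
  show ?thesis unfolding weight_def occupation_weight_def by (auto simp: wexp_bounds)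
qed

text \<open>Along a path on which V is nonnegative for almost all times, Bochner integrability means
  a finite nonnegative integral, and the two integrals agree; in the remaining case both weights are
  0.\<close>

lemma feynman_kac_weight_eq_occupation_weight:
  assumes [measurable]: "V \<in> borel_measurable borel" and \<omega>: "\<omega> \<in> space M"
    and pos: "AE s in lborel. s \<in> {0..t} \<longrightarrow> 0 \<le> V (x + X s \<omega>)"
  shows "feynman_kac_weight V t (\<lambda>s. x + X s \<omega>) = occupation_weight V t x \<omega>"
proof -
  note [measurable] = measurable_path[OF \<omega>]
  define h where "h s = indicator {0..t} s * V (x + X (max 0 s) \<omega>)" for s :: real
  have [measurable]: "h \<in> borel_measurable borel" unfolding h_def by measurable
  have h_eq: "indicator {0..t} s *\<^sub>R V (x + X s \<omega>) = h s" for s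
    by (auto simp: h_def indicator_def max_absorb2)
  have h0: "AE s in lborel. 0 \<le> h s"
    using pos by eventually_elim (auto simp: h_def indicator_def max_absorb2)
  have occ: "occupation (\<lambda>x. ennreal (V x)) t x \<omega> = (\<integral>\<^sup>+ s. ennreal (h s) \<partial>lborel)"
    unfolding occupation_def by (intro nn_integral_cong) (auto simp: h_def indicator_def)
  have "(\<integral>\<^sup>+ s. ennreal (norm (h s)) \<partial>lborel) = (\<integral>\<^sup>+ s. ennreal (h s) \<partial>lborel)"
    using h0 by (intro nn_integral_cong_AE) (auto elim: AE_mp)
  then have "integrable lborel h \<longleftrightarrow> (\<integral>\<^sup>+ s. ennreal (h s) \<partial>lborel) < \<infinity>"
    by (simp add: integrable_iff_bounded)
  moreover have "integral\<^sup>L lborel h = enn2real (\<integral>\<^sup>+ s. ennreal (h s) \<partial>lborel)"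
    using h0 by (intro integral_eq_nn_integral) auto
  ultimately show ?thesis
    unfolding feynman_kac_weight_def set_integrable_def set_lebesgue_integral_def h_eq occupation_weight_def wexp_def occ
    by (auto simp: top.not_eq_extremum)
qed

lemma weighted_op_zero_time: "weighted_op (\<lambda>_ _. 1) (X 0) F = F"
proof -
  have "weighted_op (\<lambda>_ _. 1) (X 0) F = mult_op (\<lambda>_. 1) F"
  proof (rule weighted_op_cong)
    show "AE x in lborel. AE \<omega> in M. (1::real) = 1 \<and> X 0 \<omega> = 0" using X_0 by simp
  qed (auto simp: weight_one)
  also have "\<dots> = L2_class (\<lambda>x. complex_of_real 1 * rep_L2 F x)"
    by (subst L2_class_rep[of F, symmetric], rule mult_op_L2_class) (auto simp: rep_L2_square_integrable)
  finally show ?thesis by (simp add: L2_class_rep)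
qed

lemma mult_op_one: "mult_op (\<lambda>_. 1) F = F"
proof -
  have "mult_op (\<lambda>_. 1) F = L2_class (\<lambda>x. complex_of_real 1 * rep_L2 F x)"
    by (subst L2_class_rep[of F, symmetric], rule mult_op_L2_class) (auto simp: rep_L2_square_integrable)
  then show ?thesis by (simp add: L2_class_rep)
qed

text \<open>The factors are read at the right endpoints of the time steps, in accordance with right
  continuity of the paths. The matching operator product \<open>steps\<close> puts the last time
  step innermost.\<close>

definition disc :: "(nat \<Rightarrow> real) \<Rightarrow> (nat \<Rightarrow> 'a \<Rightarrow> real) \<Rightarrow> nat \<Rightarrow> 'a \<Rightarrow> 'w \<Rightarrow> real" where
  "disc \<tau> \<phi> n x \<omega> = (\<Prod>i<n. \<phi> i (x + X (\<tau> (Suc i)) \<omega>))"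

primrec steps :: "(nat \<Rightarrow> real) \<Rightarrow> (nat \<Rightarrow> 'a \<Rightarrow> real) \<Rightarrow> nat \<Rightarrow> 'a L2 \<Rightarrow> 'a L2" where
  "steps \<tau> \<phi> 0 F = F"
| "steps \<tau> \<phi> (Suc n) F = steps \<tau> \<phi> n (shift_op (X (\<tau> (Suc n) - \<tau> n)) (mult_op (\<phi> n) F))"

context
  fixes \<tau> :: "nat \<Rightarrow> real" and \<phi> :: "nat \<Rightarrow> 'a \<Rightarrow> real"
  assumes \<phi>: "\<And>i. \<phi> i \<in> borel_measurable borel" "\<And>i x. 0 \<le> \<phi> i x" "\<And>i x. \<phi> i x \<le> 1"
    and \<tau>0: "\<tau> 0 = 0"
begin

lemma weight_disc:
  assumes "\<And>i. i < n \<Longrightarrow> 0 \<le> \<tau> (Suc i)"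
  shows "weight (disc \<tau> \<phi> n)"
proof -
  have "(\<lambda>p. \<phi> i (fst p + X (\<tau> (Suc i)) (snd p))) \<in> borel_measurable (lborel \<Otimes>\<^sub>M M)" if "i < n" for i
  proof -
    note [measurable] = measurable_X[OF assms[OF that]] \<phi>(1)
    show ?thesis by measurable
  qed
  then show ?thesis
    unfolding weight_def disc_def split_beta
    using \<phi> by (auto intro!: borel_measurable_prod prod_nonneg prod_le_1)
qed

text \<open>Positions are sums of increments, so the weight of the first n steps is a function of
  the first n increments, and these are independent of the next one. The induction peels off the
  last step; stationarity replaces its increment by \<open>X\<close> at the length of the
  step.\<close>

lemma weighted_op_disc:
  assumes "\<And>i. i < n \<Longrightarrow> \<tau> i < \<tau> (Suc i)"
  shows "weighted_op (disc \<tau> \<phi> n) (X (\<tau> n)) F = steps \<tau> \<phi> n F"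
  using assms
proof (induction n arbitrary: F)
  case 0
  have "disc \<tau> \<phi> 0 = (\<lambda>_ _. 1)" by (simp add: disc_def fun_eq_iff)
  then show ?case by (simp add: \<tau>0 weighted_op_zero_time)
next
  case (Suc n)
  have \<tau>pos: "0 \<le> \<tau> k" if "k \<le> Suc n" for k
    using that
  proof (induction k)
    case (Suc k)
    then show ?case using Suc.prems(1) \<open>\<And>i. i < Suc n \<Longrightarrow> \<tau> i < \<tau> (Suc i)\<close>[of k] by simp
  qed (simp add: \<tau>0)
  define incr where "incr i \<omega> = X (\<tau> (Suc i)) \<omega> - X (\<tau> i) \<omega>" for i \<omega>
  have incr_m: "incr i \<in> borel_measurable M" if "i \<le> n" for i
    using that unfolding incr_def[abs_def] by (intro borel_measurable_diff measurable_X \<tau>pos) auto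
  define N where "N = PiM {..<n} (\<lambda>_. borel :: 'a measure)"
  define N' where "N' = PiM {n} (\<lambda>_. borel :: 'a measure)"
  \<comment> \<open>Past and next increment are both taken as families of vectors, the latter with a
    single component, so that they share a type.\<close>
  define Y where "Y \<omega> = (\<lambda>i\<in>{..<n}. incr i \<omega>)" for \<omega>
  define D' where "D' \<omega> = (\<lambda>i\<in>{n}. incr i \<omega>)" for \<omega>
  have ind: "indep_var N Y N' D'"
    unfolding N_def N'_def Y_def D'_def
    using independent_increments[of \<tau> "Suc n"] Suc.prems \<tau>0
    by (intro indep_var_restrict[where I = "{..<Suc n}"]) (auto simp: incr_def)
  define w where "w x y = (\<Prod>i<n. \<phi> i (x + (\<Sum>j<Suc i. y j)))" for x :: 'a and y :: "nat \<Rightarrow> 'a"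
  define z where "z y = (\<Sum>j<n. y j)" for y :: "nat \<Rightarrow> 'a"
  note [measurable] = \<phi>(1)
  have comp: "(\<lambda>y. y j) \<in> borel_measurable N" if "j < n" for j
    unfolding N_def using that by (intro measurable_component_singleton) simp
  have sm: "(\<lambda>y. \<Sum>j<k. y j) \<in> borel_measurable N" if "k \<le> n" for k
    using that by (intro borel_measurable_sum comp) auto
  have wm: "(\<lambda>(x, y). w x y) \<in> borel_measurable (lborel \<Otimes>\<^sub>M N)"
    unfolding w_def split_beta
  proof (rule borel_measurable_prod)
    fix i assume "i \<in> {..<n}"
    then have "Suc i \<le> n" by simp
    show "(\<lambda>p. \<phi> i (fst p + (\<Sum>j<Suc i. snd p j))) \<in> borel_measurable (lborel \<Otimes>\<^sub>M N)"
      using measurable_compose[OF measurable_snd sm[OF \<open>Suc i \<le> n\<close>]] by measurable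
  qed
  have w01: "0 \<le> w x y \<and> w x y \<le> 1" for x y
    using \<phi> by (auto simp: w_def intro!: prod_nonneg prod_le_1)
  have zm: "z \<in> borel_measurable N" unfolding z_def[abs_def] by (rule sm) simp
  have dm: "(\<lambda>y. y n) \<in> borel_measurable N'" unfolding N'_def by measurable
  have D'n: "D' \<omega> n = incr n \<omega>" for \<omega> by (simp add: D'_def)
  have markov: "weighted_op (\<lambda>x \<omega>. w x (Y \<omega>) * \<phi> n (x + (z (Y \<omega>) + incr n \<omega>))) (\<lambda>\<omega>. z (Y \<omega>) + incr n \<omega>) F
      = weighted_op (\<lambda>x \<omega>. w x (Y \<omega>)) (\<lambda>\<omega>. z (Y \<omega>)) (shift_op (incr n) (mult_op (\<phi> n) F))"
    using weighted_op_markov[OF ind dm wm w01 zm \<phi>(1)[of n] \<phi>(2)[of n] \<phi>(3)[of n], of F] by (simp only: D'n)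
  \<comment> \<open>Only almost sure, since the path starts at 0 only almost surely.\<close>
  have telescope: "AE \<omega> in M. \<forall>k\<le>Suc n. X (\<tau> k) \<omega> = (\<Sum>j<k. incr j \<omega>)"
    using X_0
  proof eventually_elim
    case (elim \<omega>)
    have "(\<Sum>j<k. incr j \<omega>) = X (\<tau> k) \<omega>" for k
      using elim sum_lessThan_telescope[of "\<lambda>j. X (\<tau> j) \<omega>" k] by (simp add: incr_def \<tau>0)
    then show ?case by simp
  qed
  have Ysum: "(\<Sum>j<k. Y \<omega> j) = (\<Sum>j<k. incr j \<omega>)" if "k \<le> n" for k \<omega>
    using that by (intro sum.cong) (auto simp: Y_def)
  have shiftn: "shift_op (incr n) = shift_op (X (\<tau> (Suc n) - \<tau> n))"
  proof (rule weighted_op_one_distr_cong)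
    have h: "0 \<le> \<tau> (Suc n) - \<tau> n" using Suc.prems[of n] by simp
    show "distr M borel (incr n) = distr M borel (X (\<tau> (Suc n) - \<tau> n))"
      using stationary_increments[OF \<tau>pos[of n] h] by (simp add: incr_def[abs_def])
    show "X (\<tau> (Suc n) - \<tau> n) \<in> borel_measurable M" by (rule measurable_X[OF h])
  qed (rule incr_m, simp)
  have Wd: "weight (disc \<tau> \<phi> (Suc n))" "weight (disc \<tau> \<phi> n)" by (rule weight_disc, rule \<tau>pos, simp)+
  have eqs: "AE \<omega> in M. \<forall>x. disc \<tau> \<phi> n x \<omega> = w x (Y \<omega>) \<and> X (\<tau> n) \<omega> = z (Y \<omega>) \<and> X (\<tau> (Suc n)) \<omega> = z (Y \<omega>) + incr n \<omega>"
    using telescope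
  proof eventually_elim
    case (elim \<omega>)
    then have "X (\<tau> k) \<omega> = (\<Sum>j<k. Y \<omega> j)" if "k \<le> n" for k using that by (simp add: Ysum)
    moreover have "X (\<tau> (Suc n)) \<omega> = (\<Sum>j<n. incr j \<omega>) + incr n \<omega>" using elim by simp
    ultimately show ?case
      by (auto simp: disc_def w_def z_def Ysum simp del: sum.lessThan_Suc intro!: prod.cong)
  qed
  have Ym: "Y \<in> measurable M N" using ind by (rule indep_var_rv1)
  have W1: "weight (\<lambda>x \<omega>. w x (Y \<omega>))"
    unfolding weight_def split_beta
    using measurable_compose[OF _ wm, of "\<lambda>p. (fst p, Y (snd p))" "lborel \<Otimes>\<^sub>M M"] w01 Ym
    by (auto simp: split_beta)
  have zYm: "(\<lambda>\<omega>. z (Y \<omega>)) \<in> borel_measurable M" using measurable_compose[OF Ym zm] .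
  have incn: "incr n \<in> borel_measurable M" by (rule incr_m) simp
  have W2: "weight (\<lambda>x \<omega>. w x (Y \<omega>) * \<phi> n (x + (z (Y \<omega>) + incr n \<omega>)))"
  proof -
    note [measurable] = zYm incn
    have [measurable]: "(\<lambda>p. w (fst p) (Y (snd p))) \<in> borel_measurable (lborel \<Otimes>\<^sub>M M)"
      using W1 by (simp add: weight_def split_beta')
    show ?thesis
      unfolding weight_def split_beta using w01 \<phi>
      by (auto intro!: mult_nonneg_nonneg mult_le_one)
  qed
  have "weighted_op (disc \<tau> \<phi> (Suc n)) (X (\<tau> (Suc n))) F
      = weighted_op (\<lambda>x \<omega>. w x (Y \<omega>) * \<phi> n (x + (z (Y \<omega>) + incr n \<omega>))) (\<lambda>\<omega>. z (Y \<omega>) + incr n \<omega>) F"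
  proof (rule weighted_op_cong[OF Wd(1) W2])
    show "X (\<tau> (Suc n)) \<in> borel_measurable M" by (rule measurable_X, rule \<tau>pos, simp)
    show "(\<lambda>\<omega>. z (Y \<omega>) + incr n \<omega>) \<in> borel_measurable M" by (rule borel_measurable_add[OF zYm incn])
    have "AE \<omega> in M. disc \<tau> \<phi> (Suc n) x \<omega> = w x (Y \<omega>) * \<phi> n (x + (z (Y \<omega>) + incr n \<omega>)) \<and> X (\<tau> (Suc n)) \<omega> = z (Y \<omega>) + incr n \<omega>" for x
      using eqs
    proof eventually_elim
      case (elim \<omega>)
      have "disc \<tau> \<phi> (Suc n) x \<omega> = disc \<tau> \<phi> n x \<omega> * \<phi> n (x + X (\<tau> (Suc n)) \<omega>)"
        by (simp add: disc_def)
      then show ?case using elim by simp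
    qed
    then show "AE x in lborel. AE \<omega> in M. disc \<tau> \<phi> (Suc n) x \<omega> = w x (Y \<omega>) * \<phi> n (x + (z (Y \<omega>) + incr n \<omega>)) \<and> X (\<tau> (Suc n)) \<omega> = z (Y \<omega>) + incr n \<omega>"
      by simp
  qed
  also have "\<dots> = weighted_op (disc \<tau> \<phi> n) (X (\<tau> n)) (shift_op (incr n) (mult_op (\<phi> n) F))"
    unfolding markov
  proof (rule weighted_op_cong[OF W1 Wd(2) zYm])
    show "X (\<tau> n) \<in> borel_measurable M" by (rule measurable_X, rule \<tau>pos, simp)
    have "AE \<omega> in M. w x (Y \<omega>) = disc \<tau> \<phi> n x \<omega> \<and> z (Y \<omega>) = X (\<tau> n) \<omega>" for x
      using eqs by eventually_elim simp
    then show "AE x in lborel. AE \<omega> in M. w x (Y \<omega>) = disc \<tau> \<phi> n x \<omega> \<and> z (Y \<omega>) = X (\<tau> n) \<omega>" by simp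
  qed
  also have "\<dots> = steps \<tau> \<phi> (Suc n) F"
    using Suc.IH Suc.prems by (simp add: shiftn)
  finally show ?case .
qed

end

end

text \<open>The sum is the integral of the step function that takes at u the value of q at the right
  end of the cell of u. This end lies strictly to the right of u and tends to u, so right continuity
  gives pointwise convergence, dominated by K.\<close>

lemma right_riemann_sum_limit:
  fixes q :: "real \<Rightarrow> real"
  assumes [measurable]: "q \<in> borel_measurable borel" and K: "\<And>u. \<bar>q u\<bar> \<le> K"
    and a: "0 \<le> a" and t: "0 < t"
    and rc: "\<And>u. a \<le> u \<Longrightarrow> (q \<longlongrightarrow> q u) (at_right u)"
  shows "(\<lambda>n. \<Sum>i<Suc n. t / real (Suc n) * q (a + real (Suc i) * (t / real (Suc n))))
     \<longlonglongrightarrow> (\<integral>u. indicator {a..<a + t} u * q u \<partial>lborel)"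
proof -
  define h where "h n = t / real (Suc n)" for n
  have h: "0 < h n" for n using t by (simp add: h_def del: of_nat_Suc)
  have nh: "real (Suc n) * h n = t" for n by (simp add: h_def del: of_nat_Suc)
  \<comment> \<open>The number of the cell that contains u; \<open>r n u\<close> is the right
    endpoint of this cell.\<close>
  define k where "k n u = nat \<lfloor>(u - a) / h n\<rfloor>" for n u
  define r where "r n u = a + real (Suc (k n u)) * h n" for n u
  have k: "real (k n u) * h n \<le> u - a" "u - a < real (Suc (k n u)) * h n" if "a \<le> u" for n u
  proof -
    have "0 \<le> (u - a) / h n" using that h[of n] by (intro divide_nonneg_pos) auto
    then have "real (k n u) = of_int \<lfloor>(u - a) / h n\<rfloor>" by (simp add: k_def)
    then have "real (k n u) \<le> (u - a) / h n" "(u - a) / h n < real (Suc (k n u))" by linarith+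
    then show "real (k n u) * h n \<le> u - a" "u - a < real (Suc (k n u)) * h n"
      using h[of n] by (simp_all only: pos_le_divide_eq pos_divide_less_eq)
  qed
  have hlim: "h \<longlonglongrightarrow> 0"
  proof -
    have "(\<lambda>n. t * inverse (real (Suc n))) \<longlonglongrightarrow> t * 0"
      by (intro tendsto_intros LIMSEQ_inverse_real_of_nat)
    then show ?thesis by (simp add: h_def[abs_def] divide_inverse)
  qed
  have rlim: "(\<lambda>n. q (r n u)) \<longlonglongrightarrow> q u" if u: "a \<le> u" for u
  proof -
    have ru: "u < r n u" "r n u \<le> u + h n" for n
      using k[OF u, of n] by (simp_all add: r_def algebra_simps)
    have "(\<lambda>n. r n u) \<longlonglongrightarrow> u"
    proof (rule tendsto_sandwich[of "\<lambda>_. u" _ sequentially "\<lambda>n. u + h n"])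
      show "(\<lambda>n. u + h n) \<longlonglongrightarrow> u"
        using tendsto_add[OF tendsto_const hlim, of u] by simp
    qed (use ru in \<open>auto intro!: always_eventually less_imp_le\<close>)
    then have "filterlim (\<lambda>n. r n u) (at_right u) sequentially"
      by (rule tendsto_imp_filterlim_at_right) (simp add: ru)
    from filterlim_compose[OF rc[OF u] this] show ?thesis .
  qed
  have step: "indicator {a..<a + t} u * q (r n u)
      = (\<Sum>i<Suc n. indicator {a + real i * h n..<a + real (Suc i) * h n} u * q (a + real (Suc i) * h n))" for n u
  proof (cases "u \<in> {a..<a + t}")
    case True
    then have au: "a \<le> u" by simp
    have "real (k n u) * h n < real (Suc n) * h n" using k(1)[OF au, of n] True nh[of n] by simp
    then have kn: "k n u < Suc n" using h[of n] by (simp only: mult_less_cancel_right_pos of_nat_less_iff)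
    have "u \<in> {a + real i * h n..<a + real (Suc i) * h n} \<longleftrightarrow> i = k n u" for i
    proof
      assume "u \<in> {a + real i * h n..<a + real (Suc i) * h n}"
      then have "real i * h n < real (Suc (k n u)) * h n" "real (k n u) * h n < real (Suc i) * h n"
        using k[OF au, of n] by simp_all
      then show "i = k n u" using h[of n] by (simp only: mult_less_cancel_right_pos of_nat_less_iff)
    qed (use k[OF au, of n] in simp)
    then have "(\<Sum>i<Suc n. indicator {a + real i * h n..<a + real (Suc i) * h n} u * q (a + real (Suc i) * h n))
        = (\<Sum>i<Suc n. if i = k n u then q (a + real (Suc i) * h n) else 0)"
      by (intro sum.cong refl) (simp add: indicator_def)
    also have "\<dots> = q (r n u)" using kn by (simp add: r_def del: sum.lessThan_Suc)
    finally show ?thesis using True by simp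
  next
    case False
    have nin: "u \<notin> {a + real i * h n..<a + real (Suc i) * h n}" if "i < Suc n" for i
    proof -
      have "0 \<le> real i * h n" using h[of n] by simp
      moreover have "real (Suc i) * h n \<le> real (Suc n) * h n"
        using that h[of n] by (intro mult_right_mono) auto
      ultimately show ?thesis using False nh[of n] by auto
    qed
    have "(\<Sum>i<Suc n. indicator {a + real i * h n..<a + real (Suc i) * h n} u * q (a + real (Suc i) * h n)) = 0"
    proof (rule sum.neutral, rule ballI)
      fix i assume "i \<in> {..<Suc n}"
      then have "u \<notin> {a + real i * h n..<a + real (Suc i) * h n}" by (intro nin) simp
      then show "indicator {a + real i * h n..<a + real (Suc i) * h n} u * q (a + real (Suc i) * h n) = 0"
        by (simp only: indicator_simps mult_zero_left not_False_eq_True)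
    qed
    then show ?thesis using False by simp
  qed
  have fin: "emeasure lborel {a + real i * h n..<a + real (Suc i) * h n} = ennreal (h n)" for i n
    using h[of n] by (simp add: algebra_simps)
  have "(\<integral>u. indicator {a..<a + t} u * q (r n u) \<partial>lborel) = (\<Sum>i<Suc n. h n * q (a + real (Suc i) * h n))" for n
  proof -
    have "(\<integral>u. indicator {a..<a + t} u * q (r n u) \<partial>lborel)
       = (\<Sum>i<Suc n. \<integral>u. indicator {a + real i * h n..<a + real (Suc i) * h n} u * q (a + real (Suc i) * h n) \<partial>lborel)"
      unfolding step by (intro Bochner_Integration.integral_sum integrable_mult_left integrable_real_indicator)
        (simp_all add: fin del: of_nat_Suc)
    also have "\<dots> = (\<Sum>i<Suc n. h n * q (a + real (Suc i) * h n))"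
    proof (intro sum.cong refl)
      fix i
      have "measure lborel {a + real i * h n..<a + real (Suc i) * h n} = h n"
        using fin[of i n] h[of n] by (simp add: measure_def)
      then show "(\<integral>u. indicator {a + real i * h n..<a + real (Suc i) * h n} u * q (a + real (Suc i) * h n) \<partial>lborel)
         = h n * q (a + real (Suc i) * h n)" by simp
    qed
    finally show ?thesis .
  qed
  moreover have "(\<lambda>n. \<integral>u. indicator {a..<a + t} u * q (r n u) \<partial>lborel) \<longlonglongrightarrow> (\<integral>u. indicator {a..<a + t} u * q u \<partial>lborel)"
  proof (rule integral_dominated_convergence[where w = "\<lambda>u. indicator {a..<a + t} u * K"])
    show "integrable lborel (\<lambda>u. indicator {a..<a + t} u * K)"
      using t by (intro integrable_mult_left integrable_real_indicator) simp_all
    show "AE u in lborel. (\<lambda>n. indicator {a..<a + t} u * q (r n u)) \<longlonglongrightarrow> indicator {a..<a + t} u * q u"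
      using rlim by (intro AE_I2) (auto simp: indicator_def)
    show "AE u in lborel. norm (indicator {a..<a + t} u * q (r n u)) \<le> indicator {a..<a + t} u * K" for n
      using K by (intro AE_I2) (auto simp: indicator_def)
  qed (auto simp: r_def k_def)
  ultimately show ?thesis by (simp only: h_def)
qed

lemma sum_lessThan_add:
  fixes f :: "nat \<Rightarrow> 'b::comm_monoid_add"
  shows "(\<Sum>i<m + n. f i) = (\<Sum>i<m. f i) + (\<Sum>i<n. f (m + i))"
  by (induction n) (simp_all add: add.assoc)

text \<open>Strong convergence passes to products because the operators are uniformly bounded:
  \<open>S n (u n)\<close> differs from \<open>S n l\<close> by at most the norm of
  \<open>u n - l\<close>.\<close>

lemma tendsto_operator_composition:
  fixes S :: "nat \<Rightarrow> 'h::real_normed_vector \<Rightarrow> 'h"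
  assumes diff: "\<And>n F G. S n (F - G) = S n F - S n G" and le: "\<And>n F. norm (S n F) \<le> norm F"
    and S: "\<And>F. (\<lambda>n. S n F) \<longlonglongrightarrow> S' F" and u: "u \<longlonglongrightarrow> l"
  shows "(\<lambda>n. S n (u n)) \<longlonglongrightarrow> S' l"
proof -
  have "(\<lambda>n. S n (u n) - S n l) \<longlonglongrightarrow> 0"
  proof (rule Lim_null_comparison)
    show "\<forall>\<^sub>F n in sequentially. norm (S n (u n) - S n l) \<le> norm (u n - l)"
      by (simp add: le flip: diff)
    show "(\<lambda>n. norm (u n - l)) \<longlonglongrightarrow> 0" using u by (intro tendsto_norm_zero LIM_zero)
  qed
  from tendsto_add[OF this S[of l]] show ?thesis by simp
qed

section \<open>Bounded continuous potentials: the semigroup law\<close>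

context cauchy_motion
begin

definition FK :: "('a \<Rightarrow> real) \<Rightarrow> real \<Rightarrow> 'a L2 \<Rightarrow> 'a L2" where
  "FK V t = weighted_op (occupation_weight V t) (X t)"

text \<open>Both properties are stable under strong limits of the operators; bundled, they travel
  from continuous potentials to bounded, nonnegative and finally all measurable ones.\<close>

definition semigroup_symmetric :: "('a \<Rightarrow> real) \<Rightarrow> bool" where
  "semigroup_symmetric V \<longleftrightarrow> (\<forall>s\<ge>0. \<forall>t\<ge>0. \<forall>F. FK V (s + t) F = FK V s (FK V t F)) \<and>
     (\<forall>t\<ge>0. \<forall>F G. cinner (FK V t F) G = cinner F (FK V t G))"

lemma FK_zero: "FK V 0 F = F"
proof -
  have "occupation_weight V 0 = (\<lambda>_ _. 1)"
  proof (intro ext)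
    fix x \<omega>
    have "occupation (\<lambda>x. ennreal (V x)) 0 x \<omega> = (\<integral>\<^sup>+ s. 0 \<partial>(lborel :: real measure))"
      unfolding occupation_def
    proof (rule nn_integral_cong_AE)
      show "AE s in lborel. ennreal (V (x + X (max 0 s) \<omega>)) * indicator {0..0} s = 0"
        using AE_lborel_singleton[of "0::real"] by eventually_elim (simp add: indicator_def)
    qed
    then show "occupation_weight V 0 x \<omega> = 1" by (simp add: occupation_weight_def wexp_def)
  qed
  then show ?thesis by (simp add: FK_def weighted_op_zero_time)
qed

context
  fixes V :: "'a \<Rightarrow> real" and K :: real
  assumes contV: "continuous_on UNIV V" and V0: "\<And>x. 0 \<le> V x" and VK: "\<And>x. V x \<le> K"
begin

lemma V_measurable [measurable]: "V \<in> borel_measurable borel"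
  by (rule borel_measurable_continuous_onI[OF contV])

lemma riemann_path:
  assumes \<omega>: "\<omega> \<in> space M" and a: "0 \<le> a" and t: "0 < t"
  shows "(\<lambda>n. \<Sum>i<Suc n. t / real (Suc n) * V (x + X (a + real (Suc i) * (t / real (Suc n))) \<omega>))
     \<longlonglongrightarrow> (\<integral>u. indicator {a..<a + t} u * V (x + X (max 0 u) \<omega>) \<partial>lborel)"
proof -
  define q where "q u = V (x + X (max 0 u) \<omega>)" for u
  note [measurable] = measurable_path[OF \<omega>]
  have lim: "(\<lambda>n. \<Sum>i<Suc n. t / real (Suc n) * q (a + real (Suc i) * (t / real (Suc n))))
     \<longlonglongrightarrow> (\<integral>u. indicator {a..<a + t} u * q u \<partial>lborel)"
  proof (rule right_riemann_sum_limit[OF _ _ a t])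
    show "q \<in> borel_measurable borel" unfolding q_def by measurable
    show "\<bar>q u\<bar> \<le> K" for u using V0 VK by (simp add: q_def)
    fix u assume u: "a \<le> u"
    then have u0: "0 \<le> u" using a by simp
    have "((\<lambda>s. x + X s \<omega>) \<longlongrightarrow> x + X u \<omega>) (at_right u)"
      by (intro tendsto_intros right_continuous[OF \<omega> u0])
    then have "((\<lambda>s. V (x + X s \<omega>)) \<longlongrightarrow> V (x + X u \<omega>)) (at_right u)"
      using contV by (intro isCont_tendsto_compose[of _ V]) (auto simp: continuous_on_eq_continuous_at)
    moreover have "eventually (\<lambda>s. V (x + X s \<omega>) = q s) (at_right u)"
      using u0 by (auto simp: eventually_at_filter q_def)
    ultimately have "(q \<longlongrightarrow> V (x + X u \<omega>)) (at_right u)" by (rule Lim_transform_eventually)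
    then show "(q \<longlongrightarrow> q u) (at_right u)" using u0 by (simp add: q_def max_absorb2)
  qed
  have qi: "q (a + real (Suc i) * (t / real (Suc n))) = V (x + X (a + real (Suc i) * (t / real (Suc n))) \<omega>)" for i n
  proof -
    have "0 \<le> a + real (Suc i) * (t / real (Suc n))" using a t by (intro add_nonneg_nonneg) auto
    then show ?thesis by (simp add: q_def max_absorb2)
  qed
  show ?thesis using lim unfolding qi by (simp only: q_def)
qed

text \<open>The half-open interval differs from the closed one by a null set, and consecutive
  half-open intervals partition their union, which makes the path integral additive in time.\<close>

lemma occupation_weight_bounded:
  assumes \<omega>: "\<omega> \<in> space M" and t: "0 \<le> t"
  shows "occupation_weight V t x \<omega> = exp (- (\<integral>u. indicator {0..<t} u * V (x + X (max 0 u) \<omega>) \<partial>lborel))"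
proof -
  note [measurable] = measurable_path[OF \<omega>]
  have int: "integrable lborel (\<lambda>u. indicator {0..<t} u * V (x + X (max 0 u) \<omega>))"
  proof (rule Bochner_Integration.integrable_bound)
    show "integrable lborel (\<lambda>u. indicator {0..<t} u * K)"
      using t by (intro integrable_mult_left integrable_real_indicator) simp_all
    show "AE u in lborel. norm (indicator {0..<t} u * V (x + X (max 0 u) \<omega>)) \<le> norm (indicator {0..<t} u * K)"
      using V0 VK by (intro AE_I2) (auto simp: indicator_def intro: order_trans[OF _ abs_ge_self])
  qed measurable
  have "occupation (\<lambda>x. ennreal (V x)) t x \<omega> = (\<integral>\<^sup>+ u. ennreal (indicator {0..<t} u * V (x + X (max 0 u) \<omega>)) \<partial>lborel)"
    unfolding occupation_def
  proof (rule nn_integral_cong_AE)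
    show "AE u in lborel. ennreal (V (x + X (max 0 u) \<omega>)) * indicator {0..t} u = ennreal (indicator {0..<t} u * V (x + X (max 0 u) \<omega>))"
      using AE_lborel_singleton[of t] by eventually_elim (auto simp: indicator_def)
  qed
  also have "\<dots> = ennreal (\<integral>u. indicator {0..<t} u * V (x + X (max 0 u) \<omega>) \<partial>lborel)"
    using V0 by (intro nn_integral_eq_integral int) auto
  finally show ?thesis
    using V0 by (simp add: occupation_weight_def wexp_ennreal integral_nonneg_AE)
qed

lemma path_integral_split:
  assumes \<omega>: "\<omega> \<in> space M" and s: "0 \<le> s" and t: "0 \<le> t"
  shows "(\<integral>u. indicator {0..<s + t} u * V (x + X (max 0 u) \<omega>) \<partial>lborel)
     = (\<integral>u. indicator {0..<s} u * V (x + X (max 0 u) \<omega>) \<partial>lborel)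
     + (\<integral>u. indicator {s..<s + t} u * V (x + X (max 0 u) \<omega>) \<partial>lborel)"
proof -
  note [measurable] = measurable_path[OF \<omega>]
  have int: "integrable lborel (\<lambda>u. indicator {a..<a + b} u * V (x + X (max 0 u) \<omega>))" if "0 \<le> b" for a b
  proof (rule Bochner_Integration.integrable_bound)
    show "integrable lborel (\<lambda>u. indicator {a..<a + b} u * K)"
      using that by (intro integrable_mult_left integrable_real_indicator) simp_all
    show "AE u in lborel. norm (indicator {a..<a + b} u * V (x + X (max 0 u) \<omega>)) \<le> norm (indicator {a..<a + b} u * K)"
      using V0 VK by (intro AE_I2) (auto simp: indicator_def intro: order_trans[OF _ abs_ge_self])
  qed measurable
  have "(\<integral>u. indicator {0..<s + t} u * V (x + X (max 0 u) \<omega>) \<partial>lborel)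
     = (\<integral>u. indicator {0..<s} u * V (x + X (max 0 u) \<omega>) + indicator {s..<s + t} u * V (x + X (max 0 u) \<omega>) \<partial>lborel)"
    using s t by (intro Bochner_Integration.integral_cong refl) (auto simp: indicator_def)
  also have "\<dots> = (\<integral>u. indicator {0..<s} u * V (x + X (max 0 u) \<omega>) \<partial>lborel)
     + (\<integral>u. indicator {s..<s + t} u * V (x + X (max 0 u) \<omega>) \<partial>lborel)"
    using int[OF s, of 0] int[OF t, of s] by (intro Bochner_Integration.integral_add) simp_all
  finally show ?thesis .
qed

lemma exp_V_bounds:
  assumes "0 \<le> h"
  shows "(\<lambda>x. exp (- h * V x)) \<in> borel_measurable borel" "0 \<le> exp (- h * V x)" "exp (- h * V x) \<le> 1"
  using assms V0 by (auto simp: mult_nonneg_nonneg)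

definition trotter_step :: "real \<Rightarrow> 'a L2 \<Rightarrow> 'a L2" where
  "trotter_step h F = shift_op (X h) (mult_op (\<lambda>x. exp (- h * V x)) F)"

lemma steps_uniform:
  assumes "\<And>i. i < k \<Longrightarrow> \<tau> (Suc i) - \<tau> i = h" "\<And>i. i < k \<Longrightarrow> \<phi> i = (\<lambda>x. exp (- h * V x))"
  shows "steps \<tau> \<phi> k F = (trotter_step h ^^ k) F"
  using assms
proof (induction k arbitrary: F)
  case (Suc k)
  have "steps \<tau> \<phi> (Suc k) F = steps \<tau> \<phi> k (trotter_step h F)"
    using Suc.prems(1)[of k] Suc.prems(2)[of k] by (simp add: trotter_step_def)
  then show ?case using Suc.IH Suc.prems by (simp add: funpow_swap1)
qed simp

lemma disc_exp:
  assumes "\<And>i. i < n \<Longrightarrow> \<phi> i = (\<lambda>x. exp (- h i * V x))"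
  shows "disc \<tau> \<phi> n x \<omega> = exp (- (\<Sum>i<n. h i * V (x + X (\<tau> (Suc i)) \<omega>)))"
  using assms by (simp add: disc_def exp_sum[symmetric] sum_negf[symmetric])

text \<open>The power is a weighted shift operator whose weight is a Riemann product: from this it
  inherits the contraction property and additivity, and its weight tends pathwise to the Feynman-Kac
  weight.\<close>

lemma FK_uniform_limit:
  assumes t: "0 < t"
  shows "(\<lambda>n. (trotter_step (t / real (Suc n)) ^^ Suc n) F) \<longlonglongrightarrow> FK V t F"
    and "norm ((trotter_step (t / real (Suc n)) ^^ Suc n) F) \<le> norm F"
    and "(trotter_step (t / real (Suc n)) ^^ Suc n) (F - G) = (trotter_step (t / real (Suc n)) ^^ Suc n) F - (trotter_step (t / real (Suc n)) ^^ Suc n) G"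
proof -
  define \<tau> where "\<tau> n i = real i * (t / real (Suc n))" for n i
  define \<phi> where "\<phi> n i = (\<lambda>x. exp (- (t / real (Suc n)) * V x))" for n and i :: nat
  have h: "0 < t / real (Suc n)" for n using t by (simp del: of_nat_Suc)
  have \<phi>: "\<phi> n i \<in> borel_measurable borel" "0 \<le> \<phi> n i x" "\<phi> n i x \<le> 1" for n i x
    unfolding \<phi>_def using exp_V_bounds[OF less_imp_le[OF h]] by auto
  have \<tau>0: "\<tau> n 0 = 0" for n by (simp add: \<tau>_def)
  have \<tau>s: "\<tau> n (Suc i) = \<tau> n i + t / real (Suc n)" for n i
    unfolding \<tau>_def by (simp only: of_nat_Suc[of i] distrib_right mult_1 add.commute)
  have \<tau>m: "\<tau> n i < \<tau> n (Suc i)" for n i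
    unfolding \<tau>s using h[of n] by simp
  have \<tau>p: "0 \<le> \<tau> n i" for n i
    unfolding \<tau>_def by (rule mult_nonneg_nonneg[OF of_nat_0_le_iff less_imp_le[OF h]])
  have \<tau>t: "\<tau> n (Suc n) = t" for n by (simp add: \<tau>_def del: of_nat_Suc)
  have eq: "(trotter_step (t / real (Suc n)) ^^ Suc n) F = weighted_op (disc (\<tau> n) (\<phi> n) (Suc n)) (X t) F" for n F
  proof -
    have "weighted_op (disc (\<tau> n) (\<phi> n) (Suc n)) (X (\<tau> n (Suc n))) F = steps (\<tau> n) (\<phi> n) (Suc n) F"
      by (rule weighted_op_disc[where \<phi> = "\<phi> n" and \<tau> = "\<tau> n", OF \<phi> \<tau>0 \<tau>m])
    also have "\<dots> = (trotter_step (t / real (Suc n)) ^^ Suc n) F"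
      by (rule steps_uniform) (simp_all only: \<tau>_def \<phi>_def of_nat_Suc distrib_right add_diff_cancel_right' mult_1)
    finally show ?thesis by (simp only: \<tau>t)
  qed
  have W: "weight (disc (\<tau> n) (\<phi> n) (Suc n))" for n by (rule weight_disc[where \<phi> = "\<phi> n" and \<tau> = "\<tau> n", OF \<phi> \<tau>0 \<tau>p])
  have Xt: "X t \<in> borel_measurable M" using t by (intro measurable_X) simp
  show "norm ((trotter_step (t / real (Suc n)) ^^ Suc n) F) \<le> norm F"
    unfolding eq by (rule norm_weighted_op_le[OF W Xt])
  show "(trotter_step (t / real (Suc n)) ^^ Suc n) (F - G) = (trotter_step (t / real (Suc n)) ^^ Suc n) F - (trotter_step (t / real (Suc n)) ^^ Suc n) G"
    unfolding eq by (rule weighted_op_diff[OF W Xt])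
  show "(\<lambda>n. (trotter_step (t / real (Suc n)) ^^ Suc n) F) \<longlonglongrightarrow> FK V t F"
    unfolding eq FK_def
  proof (rule weighted_op_tendsto[OF W weight_occupation_weight[OF V_measurable] Xt], intro AE_I2)
    fix x \<omega> assume \<omega>: "\<omega> \<in> space M"
    have "disc (\<tau> n) (\<phi> n) (Suc n) x \<omega> = exp (- (\<Sum>i<Suc n. t / real (Suc n) * V (x + X (0 + real (Suc i) * (t / real (Suc n))) \<omega>)))" for n
      by (subst disc_exp[of _ _ "\<lambda>_. t / real (Suc n)"]) (simp_all only: \<phi>_def \<tau>_def add_0)
    then show "(\<lambda>n. disc (\<tau> n) (\<phi> n) (Suc n) x \<omega>) \<longlonglongrightarrow> occupation_weight V t x \<omega>"
      unfolding occupation_weight_bounded[OF \<omega> less_imp_le[OF t]]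
      using riemann_path[OF \<omega> order_refl t, of x] by (simp only: add_0) (intro tendsto_intros)
  qed
qed

text \<open>Both sides are limits of the same products: composing the approximations for s and t
  gives the Riemann product of a partition of [0, s + t] in which s is a grid point.\<close>

lemma FK_add_continuous:
  assumes s: "0 < s" and t: "0 < t"
  shows "FK V (s + t) F = FK V s (FK V t F)"
proof (rule LIMSEQ_unique)
  let ?S = "\<lambda>n. trotter_step (s / real (Suc n)) ^^ Suc n" and ?U = "\<lambda>n. trotter_step (t / real (Suc n)) ^^ Suc n"
  show "(\<lambda>n. ?S n (?U n F)) \<longlonglongrightarrow> FK V s (FK V t F)"
    by (rule tendsto_operator_composition[OF FK_uniform_limit(3)[OF s] FK_uniform_limit(2)[OF s]
        FK_uniform_limit(1)[OF s] FK_uniform_limit(1)[OF t]])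
  \<comment> \<open>Mesh s/(n + 1) up to s, then mesh t/(n + 1). Two meshes are used because s and t
    may be incommensurable, while s must be grid point number n + 1.\<close>
  define \<tau> where "\<tau> n i = (if i \<le> Suc n then real i * (s / real (Suc n)) else s + real (i - Suc n) * (t / real (Suc n)))" for n i
  define c where "c n i = (if i < Suc n then s / real (Suc n) else t / real (Suc n))" for n i
  define \<phi> where "\<phi> n i = (\<lambda>x. exp (- c n i * V x))" for n i
  have hs: "0 < s / real (Suc n)" and ht: "0 < t / real (Suc n)" for n using s t by (simp_all del: of_nat_Suc)
  have ns: "real (Suc n) * (s / real (Suc n)) = s" "real (Suc n) * (t / real (Suc n)) = t" for n
    by (simp_all del: of_nat_Suc)
  have c: "0 \<le> c n i" for n i using hs[of n] ht[of n] by (simp add: c_def)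
  have \<phi>: "\<phi> n i \<in> borel_measurable borel" "0 \<le> \<phi> n i x" "\<phi> n i x \<le> 1" for n i x
    unfolding \<phi>_def using exp_V_bounds[OF c] by auto
  have \<tau>0: "\<tau> n 0 = 0" for n by (simp add: \<tau>_def)
  have \<tau>d: "\<tau> n (Suc i) - \<tau> n i = c n i" for n i
  proof (cases "i < Suc n")
    case True
    then show ?thesis by (simp only: \<tau>_def c_def Suc_le_eq less_imp_le if_True of_nat_Suc[of i] distrib_right)
  next
    case False
    then obtain j where j: "i = Suc n + j" using le_Suc_ex not_less by blast
    have "\<tau> n (Suc n + k) = s + real k * (t / real (Suc n))" for k
      using ns(1)[of n] by (cases k) (simp_all add: \<tau>_def del: of_nat_Suc)
    from this[of j] this[of "Suc j"]
    have "\<tau> n i = s + real j * (t / real (Suc n))" "\<tau> n (Suc i) = s + real (Suc j) * (t / real (Suc n))"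
      unfolding j by simp_all
    then show ?thesis using False by (simp only: c_def if_False of_nat_Suc[of j] distrib_right)
  qed
  have \<tau>m: "\<tau> n i < \<tau> n (Suc i)" for n i
    using \<tau>d[of n i] hs[of n] ht[of n] by (simp add: c_def split: if_splits)
  have \<tau>p: "0 \<le> \<tau> n i" for n i
  proof (cases "i \<le> Suc n")
    case True
    then show ?thesis
      unfolding \<tau>_def if_P[OF True] by (intro mult_nonneg_nonneg of_nat_0_le_iff less_imp_le[OF hs])
  next
    case False
    then show ?thesis
      unfolding \<tau>_def if_not_P[OF False]
      by (intro add_nonneg_nonneg mult_nonneg_nonneg of_nat_0_le_iff less_imp_le[OF ht] less_imp_le[OF s])
  qed
  have \<tau>t: "\<tau> n (Suc n + Suc n) = s + t" for n using ns(2)[of n] by (simp add: \<tau>_def)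
  have eq: "?S n (?U n F) = weighted_op (disc (\<tau> n) (\<phi> n) (Suc n + Suc n)) (X (s + t)) F" for n
  proof -
    have first: "steps (\<tau> n) (\<phi> n) (Suc n) G = ?S n G" for G
      by (rule steps_uniform) (simp_all add: \<tau>d c_def \<phi>_def del: of_nat_Suc)
    have "steps (\<tau> n) (\<phi> n) (Suc n + k) G = ?S n ((trotter_step (t / real (Suc n)) ^^ k) G)" for k G
    proof (induction k arbitrary: G)
      case 0
      show ?case using first[of G] by simp
    next
      case (Suc k)
      have "steps (\<tau> n) (\<phi> n) (Suc n + Suc k) G = steps (\<tau> n) (\<phi> n) (Suc n + k) (trotter_step (t / real (Suc n)) G)"
        using \<tau>d[of n "Suc n + k"] by (simp add: c_def \<phi>_def trotter_step_def del: of_nat_Suc)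
      then show ?case by (simp only: Suc.IH funpow_Suc_right comp_apply)
    qed
    moreover have "weighted_op (disc (\<tau> n) (\<phi> n) (Suc n + Suc n)) (X (\<tau> n (Suc n + Suc n))) F = steps (\<tau> n) (\<phi> n) (Suc n + Suc n) F"
      by (rule weighted_op_disc[where \<phi> = "\<phi> n" and \<tau> = "\<tau> n", OF \<phi> \<tau>0 \<tau>m])
    ultimately show ?thesis by (simp only: \<tau>t)
  qed
  have W: "weight (disc (\<tau> n) (\<phi> n) (Suc n + Suc n))" for n by (rule weight_disc[where \<phi> = "\<phi> n" and \<tau> = "\<tau> n", OF \<phi> \<tau>0 \<tau>p])
  have Xt: "X (s + t) \<in> borel_measurable M" using s t by (intro measurable_X) simp
  show "(\<lambda>n. ?S n (?U n F)) \<longlonglongrightarrow> FK V (s + t) F"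
    unfolding eq FK_def
  proof (rule weighted_op_tendsto[OF W weight_occupation_weight[OF V_measurable] Xt], intro AE_I2)
    fix x \<omega> assume \<omega>: "\<omega> \<in> space M"
    have "(\<Sum>i<Suc n + Suc n. c n i * V (x + X (\<tau> n (Suc i)) \<omega>))
        = (\<Sum>i<Suc n. s / real (Suc n) * V (x + X (0 + real (Suc i) * (s / real (Suc n))) \<omega>))
        + (\<Sum>i<Suc n. t / real (Suc n) * V (x + X (s + real (Suc i) * (t / real (Suc n))) \<omega>))" for n
    proof -
      have "(\<Sum>i<Suc n + Suc n. c n i * V (x + X (\<tau> n (Suc i)) \<omega>))
        = (\<Sum>i<Suc n. c n i * V (x + X (\<tau> n (Suc i)) \<omega>)) + (\<Sum>i<Suc n. c n (Suc n + i) * V (x + X (\<tau> n (Suc (Suc n + i))) \<omega>))"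
        by (rule sum_lessThan_add)
      also have "(\<Sum>i<Suc n. c n i * V (x + X (\<tau> n (Suc i)) \<omega>)) = (\<Sum>i<Suc n. s / real (Suc n) * V (x + X (0 + real (Suc i) * (s / real (Suc n))) \<omega>))"
        by (intro sum.cong refl) (simp add: c_def \<tau>_def del: of_nat_Suc)
      also have "(\<Sum>i<Suc n. c n (Suc n + i) * V (x + X (\<tau> n (Suc (Suc n + i))) \<omega>)) = (\<Sum>i<Suc n. t / real (Suc n) * V (x + X (s + real (Suc i) * (t / real (Suc n))) \<omega>))"
        by (intro sum.cong refl) (simp add: c_def \<tau>_def Suc_diff_le del: of_nat_Suc)
      finally show ?thesis .
    qed
    then have d: "disc (\<tau> n) (\<phi> n) (Suc n + Suc n) x \<omega> = exp (- ((\<Sum>i<Suc n. s / real (Suc n) * V (x + X (0 + real (Suc i) * (s / real (Suc n))) \<omega>))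
        + (\<Sum>i<Suc n. t / real (Suc n) * V (x + X (s + real (Suc i) * (t / real (Suc n))) \<omega>))))" for n
      by (subst disc_exp[of _ _ "c n"]) (simp_all only: \<phi>_def)
    have st: "0 \<le> s + t" using s t by simp
    show "(\<lambda>n. disc (\<tau> n) (\<phi> n) (Suc n + Suc n) x \<omega>) \<longlonglongrightarrow> occupation_weight V (s + t) x \<omega>"
      unfolding occupation_weight_bounded[OF \<omega> st] d path_integral_split[OF \<omega> less_imp_le[OF s] less_imp_le[OF t]]
    proof (intro tendsto_exp tendsto_minus tendsto_add riemann_path[OF \<omega> less_imp_le[OF s] t])
      show "(\<lambda>n. \<Sum>i<Suc n. s / real (Suc n) * V (x + X (0 + real (Suc i) * (s / real (Suc n))) \<omega>))
          \<longlonglongrightarrow> (\<integral>u. indicator {0..<s} u * V (x + X (max 0 u) \<omega>) \<partial>lborel)"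
        using riemann_path[OF \<omega> order_refl s, of x] by (simp only: add_0)
    qed
  qed
qed

end

end

section \<open>Bounded continuous potentials: symmetry\<close>

lemma tendsto_cinner:
  assumes "(u \<longlongrightarrow> F) net" "(v \<longlongrightarrow> G) net"
  shows "((\<lambda>n. cinner (u n) (v n)) \<longlongrightarrow> cinner F G) net"
  unfolding cinner_eq_Complex
  by (intro tendsto_Complex tendsto_minus tendsto_inner tendsto_scaleC assms)

lemma square_integrable_cong_AE:
  assumes g: "g \<in> borel_measurable borel" and h: "h \<in> square_integrable" and eq: "AE x in lborel. g x = h x"
  shows "g \<in> square_integrable"
proof -
  note [measurable] = g square_integrable_measurable[OF h]
  have "integrable lborel (\<lambda>x. (cmod (g x))\<^sup>2) \<longleftrightarrow> integrable lborel (\<lambda>x. (cmod (h x))\<^sup>2)"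
  proof (rule integrable_cong_AE)
    show "AE x in lborel. (cmod (g x))\<^sup>2 = (cmod (h x))\<^sup>2" using eq by eventually_elim simp
  qed measurable
  then show ?thesis using g h by (simp add: square_integrable_def)
qed

context cauchy_motion
begin

lemma cinner_shift_X:
  assumes t: "0 \<le> t"
  shows "cinner (shift_op (X t) F) G = cinner F (shift_op (X t) G)"
proof -
  have "shift_op (\<lambda>\<omega>. - X t \<omega>) = shift_op (X t)"
    using t by (intro weighted_op_one_distr_cong distr_uminus_X) auto
  then show ?thesis using cinner_shift_operator[OF measurable_X[OF t], of F G] by simp
qed

context
  fixes V :: "'a \<Rightarrow> real" and K :: real
  assumes contV: "continuous_on UNIV V" and V0: "\<And>x. 0 \<le> V x" and VK: "\<And>x. V x \<le> K"
begin

text \<open>Reading P M P ... M P backwards gives the same word. The outermost P M moves to the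
  other argument by symmetry of both factors, and there it reappears as the innermost step of a
  longer palindrome.\<close>

lemma cinner_palindrome:
  assumes h: "0 \<le> h"
  shows "cinner ((trotter_step V h ^^ n) (shift_op (X h) F)) G = cinner F ((trotter_step V h ^^ n) (shift_op (X h) G))"
proof (induction n arbitrary: F G)
  case 0
  show ?case by (simp add: cinner_shift_X[OF h])
next
  case (Suc n)
  let ?M = "mult_op (\<lambda>x. exp (- h * V x))"
  have "cinner ((trotter_step V h ^^ Suc n) (shift_op (X h) F)) G = cinner (shift_op (X h) (?M ((trotter_step V h ^^ n) (shift_op (X h) F)))) G"
    by (simp add: trotter_step_def[OF contV V0 VK])
  also have "\<dots> = cinner ((trotter_step V h ^^ n) (shift_op (X h) F)) (?M (shift_op (X h) G))"
    unfolding cinner_shift_X[OF h] by (rule cinner_mult_op[OF exp_V_bounds[OF contV V0 VK h]])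
  also have "\<dots> = cinner F ((trotter_step V h ^^ n) (shift_op (X h) (?M (shift_op (X h) G))))"
    by (rule Suc.IH)
  also have "shift_op (X h) (?M (shift_op (X h) G)) = trotter_step V h (shift_op (X h) G)"
    by (simp add: trotter_step_def[OF contV V0 VK])
  finally show ?case by (simp only: funpow_Suc_right comp_apply)
qed

text \<open>Omitting the weight at time \<open>t\<close> from the Riemann product does not change the limit, but makes the
  approximating operator symmetric.\<close>

lemma FK_palindrome_limit:
  assumes t: "0 < t"
  shows "(\<lambda>n. (trotter_step V (t / real (Suc n)) ^^ n) (shift_op (X (t / real (Suc n))) F)) \<longlonglongrightarrow> FK V t F"
proof -
  define h where "h n = t / real (Suc n)" for n
  define \<tau> where "\<tau> n i = real i * h n" for n i
  \<comment> \<open>The coefficient 0 at i = n omits the last weight, the one at time t; the other n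
    weights keep the coefficient \<open>h n\<close>.\<close>
  define c where "c n i = (if i < n then h n else 0)" for n i :: nat
  define \<phi> where "\<phi> n i = (\<lambda>x. exp (- c n i * V x))" for n i
  have h: "0 < h n" for n using t by (simp add: h_def del: of_nat_Suc)
  have nh: "real (Suc n) * h n = t" for n by (simp add: h_def del: of_nat_Suc)
  have c: "0 \<le> c n i" for n i using h[of n] by (simp add: c_def)
  have \<phi>: "\<phi> n i \<in> borel_measurable borel" "0 \<le> \<phi> n i x" "\<phi> n i x \<le> 1" for n i x
    unfolding \<phi>_def using exp_V_bounds[OF contV V0 VK c] by auto
  have \<tau>0: "\<tau> n 0 = 0" for n by (simp add: \<tau>_def)
  have \<tau>s: "\<tau> n (Suc i) - \<tau> n i = h n" for n i by (simp add: \<tau>_def algebra_simps)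
  have \<tau>m: "\<tau> n i < \<tau> n (Suc i)" for n i using \<tau>s[of n i] h[of n] by simp
  have \<tau>p: "0 \<le> \<tau> n i" for n i
    unfolding \<tau>_def by (rule mult_nonneg_nonneg[OF of_nat_0_le_iff less_imp_le[OF h]])
  have \<tau>t: "\<tau> n (Suc n) = t" for n unfolding \<tau>_def by (rule nh)
  have eq: "(trotter_step V (h n) ^^ n) (shift_op (X (h n)) F) = weighted_op (disc (\<tau> n) (\<phi> n) (Suc n)) (X t) F" for n
  proof -
    have "weighted_op (disc (\<tau> n) (\<phi> n) (Suc n)) (X (\<tau> n (Suc n))) F = steps (\<tau> n) (\<phi> n) (Suc n) F"
      by (rule weighted_op_disc[where \<phi> = "\<phi> n" and \<tau> = "\<tau> n", OF \<phi> \<tau>0 \<tau>m])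
    also have "\<dots> = steps (\<tau> n) (\<phi> n) n (shift_op (X (h n)) F)"
    proof -
      have "\<phi> n n = (\<lambda>_. 1)" by (simp add: \<phi>_def c_def)
      then show ?thesis by (simp add: \<tau>s mult_op_one)
    qed
    also have "\<dots> = (trotter_step V (h n) ^^ n) (shift_op (X (h n)) F)"
      by (rule steps_uniform[OF contV V0 VK]) (simp_all add: \<tau>s \<phi>_def c_def)
    finally show ?thesis by (simp only: \<tau>t)
  qed
  have W: "weight (disc (\<tau> n) (\<phi> n) (Suc n))" for n
    by (rule weight_disc[where \<phi> = "\<phi> n" and \<tau> = "\<tau> n", OF \<phi> \<tau>0 \<tau>p])
  have Xt: "X t \<in> borel_measurable M" using t by (intro measurable_X) simp
  have "(\<lambda>n. weighted_op (disc (\<tau> n) (\<phi> n) (Suc n)) (X t) F) \<longlonglongrightarrow> FK V t F"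
    unfolding FK_def
  proof (rule weighted_op_tendsto[OF W weight_occupation_weight[OF V_measurable[OF contV V0 VK]] Xt], intro AE_I2)
    fix x \<omega> assume \<omega>: "\<omega> \<in> space M"
    define S where "S n = (\<Sum>i<Suc n. h n * V (x + X (0 + real (Suc i) * h n) \<omega>))" for n
    have "(\<Sum>i<Suc n. c n i * V (x + X (\<tau> n (Suc i)) \<omega>)) = S n - h n * V (x + X t \<omega>)" for n
    proof -
      have "(\<Sum>i<n. c n i * V (x + X (\<tau> n (Suc i)) \<omega>)) = (\<Sum>i<n. h n * V (x + X (0 + real (Suc i) * h n) \<omega>))"
        by (intro sum.cong refl) (simp add: c_def \<tau>_def del: of_nat_Suc)
      moreover have "S n = (\<Sum>i<n. h n * V (x + X (0 + real (Suc i) * h n) \<omega>)) + h n * V (x + X t \<omega>)"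
        using nh[of n] by (simp add: S_def del: of_nat_Suc)
      ultimately show ?thesis by (simp add: c_def)
    qed
    then have d: "disc (\<tau> n) (\<phi> n) (Suc n) x \<omega> = exp (- (S n - h n * V (x + X t \<omega>)))" for n
      by (subst disc_exp[OF contV V0 VK, of _ _ "c n"]) (simp_all only: \<phi>_def)
    have "S \<longlonglongrightarrow> (\<integral>u. indicator {0..<t} u * V (x + X (max 0 u) \<omega>) \<partial>lborel)"
      using riemann_path[OF contV V0 VK \<omega> order_refl t, of x]
      unfolding S_def h_def by (simp only: add_0)
    moreover have "h \<longlonglongrightarrow> 0"
    proof -
      have "(\<lambda>n. t * inverse (real (Suc n))) \<longlonglongrightarrow> t * 0"
        by (intro tendsto_intros LIMSEQ_inverse_real_of_nat)
      then show ?thesis by (simp add: h_def[abs_def] divide_inverse)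
    qed
    ultimately have "(\<lambda>n. exp (- (S n - h n * V (x + X t \<omega>)))) \<longlonglongrightarrow>
        exp (- ((\<integral>u. indicator {0..<t} u * V (x + X (max 0 u) \<omega>) \<partial>lborel) - 0 * V (x + X t \<omega>)))"
      by (intro tendsto_intros)
    then show "(\<lambda>n. disc (\<tau> n) (\<phi> n) (Suc n) x \<omega>) \<longlonglongrightarrow> occupation_weight V t x \<omega>"
      unfolding d occupation_weight_bounded[OF contV V0 VK \<omega> less_imp_le[OF t]] by simp
  qed
  then show ?thesis unfolding eq[symmetric] by (simp only: h_def)
qed

lemma semigroup_symmetric_continuous: "semigroup_symmetric V"
  unfolding semigroup_symmetric_def
proof (intro conjI allI impI)
  fix s t :: real and F assume "0 \<le> s" "0 \<le> t"
  then show "FK V (s + t) F = FK V s (FK V t F)"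
    using FK_add_continuous[OF contV V0 VK, of s t F]
    by (cases "s = 0"; cases "t = 0") (simp_all add: FK_zero)
next
  fix t :: real and F G assume t: "0 \<le> t"
  show "cinner (FK V t F) G = cinner F (FK V t G)"
  proof (cases "t = 0")
    case False
    then have t: "0 < t" using t by simp
    have h: "0 \<le> t / real (Suc n)" for n using t by simp
    show ?thesis
    proof (rule LIMSEQ_unique)
      show "(\<lambda>n. cinner ((trotter_step V (t / real (Suc n)) ^^ n) (shift_op (X (t / real (Suc n))) F)) G) \<longlonglongrightarrow> cinner (FK V t F) G"
        by (intro tendsto_cinner FK_palindrome_limit t tendsto_const)
      show "(\<lambda>n. cinner ((trotter_step V (t / real (Suc n)) ^^ n) (shift_op (X (t / real (Suc n))) F)) G) \<longlonglongrightarrow> cinner F (FK V t G)"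
        unfolding cinner_palindrome[OF h]
        by (intro tendsto_cinner FK_palindrome_limit t tendsto_const)
    qed
  qed (simp add: FK_zero)
qed

end

section \<open>From continuous to measurable potentials\<close>

lemma norm_FK_le: "V \<in> borel_measurable borel \<Longrightarrow> 0 \<le> t \<Longrightarrow> norm (FK V t F) \<le> norm F"
  unfolding FK_def by (rule norm_weighted_op_le[OF weight_occupation_weight measurable_X])

lemma FK_diff: "V \<in> borel_measurable borel \<Longrightarrow> 0 \<le> t \<Longrightarrow> FK V t (F - G) = FK V t F - FK V t G"
  unfolding FK_def by (rule weighted_op_diff[OF weight_occupation_weight measurable_X])

lemma FK_tendsto:
  assumes "\<And>n. Vn n \<in> borel_measurable borel" "V \<in> borel_measurable borel" "0 \<le> t"
    and "AE x in lborel. AE \<omega> in M. (\<lambda>n. occupation (\<lambda>x. ennreal (Vn n x)) t x \<omega>) \<longlonglongrightarrow> occupation (\<lambda>x. ennreal (V x)) t x \<omega>"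
  shows "(\<lambda>n. FK (Vn n) t F) \<longlonglongrightarrow> FK V t F"
  unfolding FK_def
proof (rule weighted_op_tendsto[OF weight_occupation_weight[OF assms(1)] weight_occupation_weight[OF assms(2)] measurable_X[OF assms(3)]])
  from assms(4) show "AE x in lborel. AE \<omega> in M. (\<lambda>n. occupation_weight (Vn n) t x \<omega>) \<longlonglongrightarrow> occupation_weight V t x \<omega>"
  proof eventually_elim
    case (elim x)
    then show ?case unfolding occupation_weight_def by eventually_elim (rule tendsto_wexp)
  qed
qed

lemma semigroup_symmetric_limit:
  assumes Vn: "\<And>n. Vn n \<in> borel_measurable borel" and sg: "\<And>n. semigroup_symmetric (Vn n)"
    and lim: "\<And>t F. 0 \<le> t \<Longrightarrow> (\<lambda>n. FK (Vn n) t F) \<longlonglongrightarrow> FK V t F"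
  shows "semigroup_symmetric V"
  unfolding semigroup_symmetric_def
proof (intro conjI allI impI)
  fix s t :: real and F assume s: "0 \<le> s" and t: "0 \<le> t"
  show "FK V (s + t) F = FK V s (FK V t F)"
  proof (rule LIMSEQ_unique)
    show "(\<lambda>n. FK (Vn n) (s + t) F) \<longlonglongrightarrow> FK V (s + t) F" using s t by (intro lim) simp
    have "(\<lambda>n. FK (Vn n) s (FK (Vn n) t F)) \<longlonglongrightarrow> FK V s (FK V t F)"
      by (rule tendsto_operator_composition[OF FK_diff[OF Vn s] norm_FK_le[OF Vn s] lim[OF s] lim[OF t]])
    then show "(\<lambda>n. FK (Vn n) (s + t) F) \<longlonglongrightarrow> FK V s (FK V t F)"
      using sg s t by (simp add: semigroup_symmetric_def)
  qed
next
  fix t :: real and F G assume t: "0 \<le> t"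
  show "cinner (FK V t F) G = cinner F (FK V t G)"
  proof (rule LIMSEQ_unique)
    show "(\<lambda>n. cinner (FK (Vn n) t F) G) \<longlonglongrightarrow> cinner (FK V t F) G"
      by (intro tendsto_cinner lim t tendsto_const)
    have "(\<lambda>n. cinner F (FK (Vn n) t G)) \<longlonglongrightarrow> cinner F (FK V t G)"
      by (intro tendsto_cinner lim t tendsto_const)
    then show "(\<lambda>n. cinner (FK (Vn n) t F) G) \<longlonglongrightarrow> cinner F (FK V t G)"
      using sg t by (simp add: semigroup_symmetric_def)
  qed
qed

text \<open>Continuous potentials that converge to V almost everywhere in space converge at almost
  all times along the path. Clamping them to [0, K] keeps them bounded and supplies the majorant for
  the time integral.\<close>

lemma semigroup_symmetric_bounded:
  assumes V: "V \<in> borel_measurable borel" and V0: "\<And>x. 0 \<le> V x" and VK: "\<And>x. V x \<le> K"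
  shows "semigroup_symmetric V"
proof -
  obtain g where g: "\<And>n. continuous_on UNIV (g n)" and glim: "AE x in lborel. (\<lambda>n. g n x) \<longlonglongrightarrow> V x"
    using AE_limit_of_continuous[OF V] by blast
  define Vn where "Vn n x = max 0 (min K (g n x))" for n x
  have K0: "0 \<le> K" using V0 VK order_trans by blast
  have c: "continuous_on UNIV (Vn n)" and b: "0 \<le> Vn n x" "Vn n x \<le> K" for n x
    unfolding Vn_def using g K0 by (auto intro!: continuous_intros)
  have m: "Vn n \<in> borel_measurable borel" for n by (rule borel_measurable_continuous_onI[OF c])
  have Vlim: "AE x in lborel. (\<lambda>n. Vn n x) \<longlonglongrightarrow> V x"
    using glim
  proof eventually_elim
    case (elim x)
    have "(\<lambda>n. Vn n x) \<longlonglongrightarrow> max 0 (min K (V x))"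
      unfolding Vn_def by (intro tendsto_intros elim)
    then show ?case using V0[of x] VK[of x] by (simp add: min_absorb2 max_absorb2)
  qed
  show ?thesis
  proof (rule semigroup_symmetric_limit[OF m semigroup_symmetric_continuous[OF c b]])
    fix t :: real and F assume t: "0 \<le> t"
    show "(\<lambda>n. FK (Vn n) t F) \<longlonglongrightarrow> FK V t F"
    proof (rule FK_tendsto[OF m V t])
      from AE_path[OF Vlim t]
      show "AE x in lborel. AE \<omega> in M. (\<lambda>n. occupation (\<lambda>x. ennreal (Vn n x)) t x \<omega>) \<longlonglongrightarrow> occupation (\<lambda>x. ennreal (V x)) t x \<omega>"
      proof eventually_elim
        case (elim x)
        have "AE \<omega> in M. \<omega> \<in> space M" by (rule AE_space)
        with elim show ?case
        proof eventually_elim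
          case (elim \<omega>)
          note [measurable] = measurable_path[OF elim(2)] m V
          show ?case
            unfolding occupation_def
          proof (rule nn_integral_dominated_convergence[where w = "\<lambda>s. ennreal K * indicator {0..t} s"])
            show "(\<integral>\<^sup>+ s. ennreal K * indicator {0..t} s \<partial>lborel) < \<infinity>"
              using t by (simp add: nn_integral_cmult ennreal_mult_less_top)
            show "AE s in lborel. ennreal (Vn n (x + X (max 0 s) \<omega>)) * indicator {0..t} s \<le> ennreal K * indicator {0..t} s" for n
              by (intro AE_I2 mult_right_mono ennreal_leI b) simp
            from elim(1) show "AE s in lborel. (\<lambda>n. ennreal (Vn n (x + X (max 0 s) \<omega>)) * indicator {0..t} s) \<longlonglongrightarrow> ennreal (V (x + X (max 0 s) \<omega>)) * indicator {0..t} s"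
            proof eventually_elim
              case (elim s)
              then show ?case
                by (cases "s \<in> {0..t}") (auto simp: max_absorb2 intro!: tendsto_ennrealI)
            qed
          qed measurable
        qed
      qed
    qed
  qed
qed

text \<open>The truncations increase to V, so the occupation integrals converge by monotone
  convergence, possibly to \<infinity>, where the weight is still continuous.\<close>

lemma semigroup_symmetric_nonneg:
  assumes V: "V \<in> borel_measurable borel" and V0: "\<And>x. 0 \<le> V x"
  shows "semigroup_symmetric V"
proof -
  define Vn where "Vn n x = min (V x) (real n)" for n x
  have m: "Vn n \<in> borel_measurable borel" for n using V unfolding Vn_def[abs_def] by measurable
  have b: "0 \<le> Vn n x" "Vn n x \<le> real n" for n x using V0 by (auto simp: Vn_def)
  show ?thesis
  proof (rule semigroup_symmetric_limit[OF m semigroup_symmetric_bounded[OF m b]])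
    fix t :: real and F assume t: "0 \<le> t"
    show "(\<lambda>n. FK (Vn n) t F) \<longlonglongrightarrow> FK V t F"
    proof (rule FK_tendsto[OF m V t], intro AE_I2)
      fix x \<omega> assume \<omega>: "\<omega> \<in> space M"
      note [measurable] = measurable_path[OF \<omega>] m V
      show "(\<lambda>n. occupation (\<lambda>x. ennreal (Vn n x)) t x \<omega>) \<longlonglongrightarrow> occupation (\<lambda>x. ennreal (V x)) t x \<omega>"
        unfolding occupation_def
      proof (rule nn_integral_LIMSEQ)
        show "incseq (\<lambda>n s. ennreal (Vn n (x + X (max 0 s) \<omega>)) * indicator {0..t} s)"
          by (auto simp: incseq_def le_fun_def Vn_def intro!: mult_right_mono ennreal_leI)
        fix s :: real
        obtain N where N: "V (x + X (max 0 s) \<omega>) \<le> real N" using real_arch_simple by blast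
        have "Vn n (x + X (max 0 s) \<omega>) = V (x + X (max 0 s) \<omega>)" if "N \<le> n" for n
          using N that by (simp add: Vn_def)
        then show "(\<lambda>n. ennreal (Vn n (x + X (max 0 s) \<omega>)) * indicator {0..t} s) \<longlonglongrightarrow> ennreal (V (x + X (max 0 s) \<omega>)) * indicator {0..t} s"
          by (intro tendsto_eventually) (auto simp: eventually_sequentially intro!: exI[of _ N])
      qed measurable
    qed
  qed
qed

lemma semigroup_symmetric_measurable:
  assumes V: "V \<in> borel_measurable borel"
  shows "semigroup_symmetric V"
proof -
  have "ennreal (max 0 r) = ennreal r" for r by (simp add: max_def ennreal_neg)
  then have "FK V = FK (\<lambda>x. max 0 (V x))"
    by (simp add: FK_def[abs_def] occupation_weight_def[abs_def])
  moreover have "semigroup_symmetric (\<lambda>x. max 0 (V x))" using V by (intro semigroup_symmetric_nonneg) auto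
  ultimately show ?thesis by (simp add: semigroup_symmetric_def)
qed

end

section \<open>Strong continuity\<close>

context cauchy_motion
begin

text \<open>V restricted to a ball is integrable, so its occupation integral up to time 1 has finite
  mean for almost every x. Right continuity keeps the path within distance 1 of x for a short time,
  during which it sees V only inside a ball. The balls have integer radii, so countably many null
  sets are discarded.\<close>

lemma occupation_short_time_finite:
  assumes V: "V \<in> borel_measurable borel"
    and loc: "\<And>R. (\<integral>\<^sup>+ x. ennreal (V x) * indicator (cball 0 R) x \<partial>lborel) < \<infinity>"
  shows "AE x in lborel. AE \<omega> in M. \<exists>\<delta>>0. occupation (\<lambda>x. ennreal (V x)) \<delta> x \<omega> < \<infinity>"
proof -
  define f where "f R x = ennreal (V x) * indicator (cball 0 (real R)) x" for R :: nat and x :: 'a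
  have [measurable]: "cball 0 r \<in> sets (borel :: 'a measure)" for r by simp
  have f [measurable]: "f R \<in> borel_measurable borel" for R using V unfolding f_def[abs_def] by measurable
  have [measurable]: "occupation (f R) 1 x \<in> borel_measurable M" for R x
    using measurable_Pair2[OF measurable_occupation[OF f[of R], of 1], of x] by simp
  have "AE x in lborel. AE \<omega> in M. occupation (f R) 1 x \<omega> \<noteq> \<infinity>" for R
  proof -
    have "(\<integral>\<^sup>+ x. \<integral>\<^sup>+ \<omega>. occupation (f R) 1 x \<omega> \<partial>M \<partial>lborel) \<noteq> \<infinity>"
      using loc[of "real R"] by (simp add: nn_integral_occupation[OF f] f_def[symmetric] top.not_eq_extremum)
    moreover have "(\<lambda>x. \<integral>\<^sup>+ \<omega>. occupation (f R) 1 x \<omega> \<partial>M) \<in> borel_measurable lborel"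
      by (rule borel_measurable_nn_integral[OF measurable_occupation[OF f]])
    ultimately have "AE x in lborel. (\<integral>\<^sup>+ \<omega>. occupation (f R) 1 x \<omega> \<partial>M) \<noteq> \<infinity>"
      by (rule nn_integral_PInf_AE[rotated])
    then show ?thesis
    proof eventually_elim
      case (elim x)
      then show ?case by (intro nn_integral_PInf_AE) auto
    qed
  qed
  then have "AE x in lborel. \<forall>R. AE \<omega> in M. occupation (f R) 1 x \<omega> \<noteq> \<infinity>"
    by (simp only: AE_all_countable simp_thms)
  then show ?thesis
  proof eventually_elim
    case (elim x)
    then have fin: "AE \<omega> in M. \<forall>R. occupation (f R) 1 x \<omega> \<noteq> \<infinity>" unfolding AE_all_countable .
    have "AE \<omega> in M. \<omega> \<in> space M" by (rule AE_space)
    with fin X_0 show ?case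
    proof eventually_elim
      case (elim \<omega>)
      have "((\<lambda>s. X s \<omega>) \<longlongrightarrow> 0) (at_right 0)"
        using right_continuous[OF elim(3), of 0] elim(2) by simp
      then have "eventually (\<lambda>s. norm (X s \<omega>) < 1) (at_right 0)"
        using order_tendstoD(2)[OF tendsto_norm, of "\<lambda>s. X s \<omega>" 0 "at_right 0" 1] by simp
      then obtain b where b: "0 < b" "\<And>s. 0 < s \<Longrightarrow> s < b \<Longrightarrow> norm (X s \<omega>) < 1"
        unfolding eventually_at_right_field by auto
      \<comment> \<open>Half of b keeps the closed time interval below b; the cap 1 is the time up
        to which the occupation of the ball is known to be finite.\<close>
      define \<delta> where "\<delta> = min 1 (b / 2)"
      obtain R :: nat where R: "norm x + 1 \<le> real R" using real_arch_simple by blast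
      have "occupation (\<lambda>x. ennreal (V x)) \<delta> x \<omega> \<le> occupation (f R) 1 x \<omega>"
        unfolding occupation_def
      proof (rule nn_integral_mono)
        fix s
        show "ennreal (V (x + X (max 0 s) \<omega>)) * indicator {0..\<delta>} s \<le> f R (x + X (max 0 s) \<omega>) * indicator {0..1} s"
        proof (cases "s \<in> {0..\<delta>}")
          case True
          have "norm (X s \<omega>) \<le> 1"
          proof (cases "s = 0")
            case False
            then show ?thesis using True b by (intro less_imp_le b(2)) (auto simp: \<delta>_def)
          qed (simp add: elim(2))
          then have "norm (x + X s \<omega>) \<le> real R" using norm_triangle_ineq[of x "X s \<omega>"] R by linarith
          then show ?thesis using True by (simp add: f_def max_absorb2 indicator_def \<delta>_def)
        qed simp
      qed
      moreover have "0 < \<delta>" using b(1) by (simp add: \<delta>_def)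
      ultimately show ?case using elim(1) by (auto simp: top.not_eq_extremum intro: le_less_trans)
    qed
  qed
qed

lemma occupation_tendsto_0:
  assumes V: "V \<in> borel_measurable borel" and \<omega>: "\<omega> \<in> space M"
    and \<delta>: "0 < \<delta>" "occupation (\<lambda>x. ennreal (V x)) \<delta> x \<omega> < \<infinity>" and u: "u \<longlonglongrightarrow> 0"
  shows "(\<lambda>n. occupation (\<lambda>x. ennreal (V x)) (u n) x \<omega>) \<longlonglongrightarrow> 0"
proof -
  note [measurable] = measurable_path[OF \<omega>] V
  let ?g = "\<lambda>s. ennreal (V (x + X (max 0 s) \<omega>))"
  \<comment> \<open>Capping the times at \<delta> gives one integrable majorant for all n;
    eventually the cap has no effect.\<close>
  have "(\<lambda>n. \<integral>\<^sup>+ s. ?g s * indicator {0..min (u n) \<delta>} s \<partial>lborel) \<longlonglongrightarrow> (\<integral>\<^sup>+ s. 0 \<partial>(lborel :: real measure))"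
  proof (rule nn_integral_dominated_convergence[where w = "\<lambda>s. ?g s * indicator {0..\<delta>} s"])
    show "(\<integral>\<^sup>+ s. ?g s * indicator {0..\<delta>} s \<partial>lborel) < \<infinity>" using \<delta>(2) by (simp add: occupation_def)
    show "AE s in lborel. ?g s * indicator {0..min (u n) \<delta>} s \<le> ?g s * indicator {0..\<delta>} s" for n
      by (intro AE_I2 mult_left_mono) (auto simp: indicator_def)
    show "AE s in lborel. (\<lambda>n. ?g s * indicator {0..min (u n) \<delta>} s) \<longlonglongrightarrow> 0"
      using AE_lborel_singleton[of "0::real"]
    proof eventually_elim
      case (elim s)
      have "eventually (\<lambda>n. s \<notin> {0..min (u n) \<delta>}) sequentially"
      proof (cases "0 < s")
        case True
        show ?thesis using order_tendstoD(2)[OF u True] by eventually_elim auto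
      qed (use elim in \<open>auto intro!: always_eventually\<close>)
      then have "eventually (\<lambda>n. ?g s * indicator {0..min (u n) \<delta>} s = 0) sequentially"
        by eventually_elim simp
      then show ?case by (rule tendsto_eventually)
    qed
  qed measurable
  then have "(\<lambda>n. occupation (\<lambda>x. ennreal (V x)) (min (u n) \<delta>) x \<omega>) \<longlonglongrightarrow> 0"
    by (simp add: occupation_def)
  moreover have "eventually (\<lambda>n. occupation (\<lambda>x. ennreal (V x)) (min (u n) \<delta>) x \<omega> = occupation (\<lambda>x. ennreal (V x)) (u n) x \<omega>) sequentially"
    using order_tendstoD(2)[OF u \<delta>(1)] by eventually_elim (simp add: min_absorb1)
  ultimately show ?thesis by (rule Lim_transform_eventually)
qed

context
  fixes V :: "'a \<Rightarrow> real"
  assumes V: "V \<in> borel_measurable borel"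
    and loc: "\<And>R. (\<integral>\<^sup>+ x. ennreal (V x) * indicator (cball 0 R) x \<partial>lborel) < \<infinity>"
begin

lemma occupation_weight_tendsto_1:
  assumes u: "u \<longlonglongrightarrow> 0"
  shows "AE x in lborel. AE \<omega> in M. (\<lambda>n. occupation_weight V (u n) x \<omega>) \<longlonglongrightarrow> 1"
  using occupation_short_time_finite[OF V loc]
proof eventually_elim
  case (elim x)
  have "AE \<omega> in M. \<omega> \<in> space M" by (rule AE_space)
  with elim show ?case
  proof eventually_elim
    case (elim \<omega>)
    then obtain \<delta> where "0 < \<delta>" "occupation (\<lambda>x. ennreal (V x)) \<delta> x \<omega> < \<infinity>" by blast
    from tendsto_wexp[OF occupation_tendsto_0[OF V elim(2) this u]]
    show ?case by (simp add: occupation_weight_def wexp_def[of 0])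
  qed
qed

text \<open>Only the quadratic form is treated: the factor f from the left argument has bounded
  support, so the uniform bound B on the averages is enough for dominated convergence in x.
  Pointwise convergence combines weights tending to 1 with right continuity of the path at
  0.\<close>

lemma cinner_FK_test_function:
  assumes f: "test_function f" and u: "u \<longlonglongrightarrow> 0" and u0: "\<And>n. 0 < u n"
  shows "(\<lambda>n. cinner (L2_class f) (FK V (u n) (L2_class f))) \<longlonglongrightarrow> cinner (L2_class f) (L2_class f)"
proof -
  have fs: "f \<in> square_integrable" by (rule test_function_square_integrable[OF f])
  have cf: "continuous_on UNIV f" using f by (simp add: test_function_def)
  obtain B where B: "\<And>x. cmod (f x) \<le> B" using f by (auto simp: test_function_def)
  obtain R where R: "\<And>x. R < norm x \<Longrightarrow> f x = 0" using f by (auto simp: test_function_def)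
  have B0: "0 \<le> B" using B norm_ge_zero order_trans by blast
  have [measurable]: "f \<in> borel_measurable borel" by (rule square_integrable_measurable[OF fs])
  have [measurable]: "cnj \<in> borel_measurable borel"
    by (intro borel_measurable_continuous_onI continuous_intros)
  have Xm: "X (u n) \<in> borel_measurable M" for n by (rule measurable_X) (use u0[of n] in simp)
  note [measurable] = Xm
  have Wm: "occupation_weight V (u n) x \<in> borel_measurable M" for n x
    using weight_section[OF weight_occupation_weight[OF V]] .
  note [measurable] = Wm
  define g where "g n x = (\<integral>\<omega>. complex_of_real (occupation_weight V (u n) x \<omega>) * f (x + X (u n) \<omega>) \<partial>M)" for n x
  have gs: "g n \<in> square_integrable" for n
    unfolding g_def by (rule weighted_average(2)[OF weight_occupation_weight[OF V] Xm fs])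
  have [measurable]: "g n \<in> borel_measurable borel" for n by (rule square_integrable_measurable[OF gs])
  have bound: "cmod (complex_of_real (occupation_weight V (u n) x \<omega>) * f (x + X (u n) \<omega>)) \<le> B" for n x \<omega>
  proof -
    have "cmod (complex_of_real (occupation_weight V (u n) x \<omega>) * f (x + X (u n) \<omega>)) \<le> 1 * B"
      unfolding norm_mult norm_of_real using wexp_bounds B by (intro mult_mono) (auto simp: occupation_weight_def)
    then show ?thesis by simp
  qed
  have gB: "cmod (g n x) \<le> B" for n x
  proof -
    have "cmod (g n x) \<le> (\<integral>\<omega>. cmod (complex_of_real (occupation_weight V (u n) x \<omega>) * f (x + X (u n) \<omega>)) \<partial>M)"
      unfolding g_def by (rule integral_norm_bound)
    also have "\<dots> \<le> (\<integral>\<omega>. B \<partial>M)"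
    proof (rule integral_mono)
      show "integrable M (\<lambda>\<omega>. cmod (complex_of_real (occupation_weight V (u n) x \<omega>) * f (x + X (u n) \<omega>)))"
        by (rule integrable_const_bound[of _ B]) (use bound in auto)
    qed (use bound in auto)
    finally show ?thesis by (simp add: prob_space)
  qed
  have glim: "AE x in lborel. (\<lambda>n. g n x) \<longlonglongrightarrow> f x"
    using occupation_weight_tendsto_1[OF u]
  proof eventually_elim
    case (elim x)
    have "(\<lambda>n. g n x) \<longlonglongrightarrow> (\<integral>\<omega>. f x \<partial>M)"
      unfolding g_def
    proof (rule integral_dominated_convergence[where w = "\<lambda>_. B"])
      have "AE \<omega> in M. \<omega> \<in> space M" by (rule AE_space)
      with elim X_0 show "AE \<omega> in M. (\<lambda>n. complex_of_real (occupation_weight V (u n) x \<omega>) * f (x + X (u n) \<omega>)) \<longlonglongrightarrow> f x"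
      proof eventually_elim
        case (elim \<omega>)
        have "filterlim u (at_right 0) sequentially"
          using u by (rule tendsto_imp_filterlim_at_right) (simp add: u0)
        from filterlim_compose[OF right_continuous[OF elim(3) order_refl] this]
        have "(\<lambda>n. x + X (u n) \<omega>) \<longlonglongrightarrow> x + X 0 \<omega>" by (intro tendsto_intros)
        then have "(\<lambda>n. f (x + X (u n) \<omega>)) \<longlonglongrightarrow> f x"
          using continuous_on_tendsto_compose[OF cf, of _ "x + X 0 \<omega>"] elim(2) by simp
        then have "(\<lambda>n. complex_of_real (occupation_weight V (u n) x \<omega>) * f (x + X (u n) \<omega>)) \<longlonglongrightarrow> complex_of_real 1 * f x"
          by (intro tendsto_intros elim(1))
        then show ?case by simp
      qed
      show "AE \<omega> in M. norm (complex_of_real (occupation_weight V (u n) x \<omega>) * f (x + X (u n) \<omega>)) \<le> B" for n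
        by (intro AE_I2 bound)
    qed auto
    then show ?case by (simp add: prob_space)
  qed
  have "(\<lambda>n. \<integral>x. cnj (f x) * g n x \<partial>lborel) \<longlonglongrightarrow> (\<integral>x. cnj (f x) * f x \<partial>lborel)"
  proof (rule integral_dominated_convergence[where w = "\<lambda>x. cmod (f x) * B"])
    show "integrable lborel (\<lambda>x. cmod (f x) * B)"
      by (intro integrable_mult_left integrable_norm bounded_cball_support_integrable[OF _ B R]) auto
    show "AE x in lborel. (\<lambda>n. cnj (f x) * g n x) \<longlonglongrightarrow> cnj (f x) * f x"
      using glim by eventually_elim (intro tendsto_intros)
    show "AE x in lborel. norm (cnj (f x) * g n x) \<le> cmod (f x) * B" for n
      using gB by (intro AE_I2) (simp add: norm_mult mult_left_mono)
  qed measurable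
  then show ?thesis
    unfolding FK_def weighted_op_L2_class[OF weight_occupation_weight[OF V] Xm fs] cinner_L2_class[OF fs fs] g_def[symmetric]
    by (simp only: cinner_L2_class[OF fs gs])
qed

lemma FK_tendsto_id_seq:
  assumes u: "u \<longlonglongrightarrow> 0" and u0: "\<And>n. 0 < u n"
  shows "(\<lambda>n. FK V (u n) F) \<longlonglongrightarrow> F"
proof -
  have test: "(\<lambda>n. FK V (u n) (L2_class f)) \<longlonglongrightarrow> L2_class f" if f: "test_function f" for f
  proof -
    let ?F = "L2_class f"
    have "(\<lambda>n. Re (cinner ?F (FK V (u n) ?F))) \<longlonglongrightarrow> Re (cinner ?F ?F)"
      by (intro tendsto_Re cinner_FK_test_function f u u0)
    then have "(\<lambda>n. inner ?F (FK V (u n) ?F)) \<longlonglongrightarrow> (norm ?F)\<^sup>2"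
      by (simp only: Re_cinner power2_norm_eq_inner)
    from tendsto_diff[OF tendsto_const[of "2 * (norm ?F)\<^sup>2"] tendsto_mult[OF tendsto_const[of 2] this]]
    have inn: "(\<lambda>n. 2 * (norm ?F)\<^sup>2 - 2 * inner ?F (FK V (u n) ?F)) \<longlonglongrightarrow> 0" by simp
    \<comment> \<open>For contractions, convergence of the quadratic form to \<open>\<parallel>F\<parallel>\<^sup>2\<close> implies strong convergence; the
      \<open>L2\<close> norm of \<open>FK V (u n) ?F - ?F\<close> itself has no integrable majorant at hand.\<close>
    have le: "(norm (FK V (u n) ?F - ?F))\<^sup>2 \<le> 2 * (norm ?F)\<^sup>2 - 2 * inner ?F (FK V (u n) ?F)" for n
    proof -
      have "(norm (FK V (u n) ?F - ?F))\<^sup>2 = (norm (FK V (u n) ?F))\<^sup>2 - 2 * inner ?F (FK V (u n) ?F) + (norm ?F)\<^sup>2"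
        by (simp add: power2_norm_eq_inner inner_diff_left inner_diff_right inner_commute)
      moreover have "(norm (FK V (u n) ?F))\<^sup>2 \<le> (norm ?F)\<^sup>2"
        using norm_FK_le[OF V less_imp_le[OF u0]] by (intro power_mono) auto
      ultimately show ?thesis by simp
    qed
    have "(\<lambda>n. (norm (FK V (u n) ?F - ?F))\<^sup>2) \<longlonglongrightarrow> 0"
      by (rule Lim_null_comparison[OF _ inn]) (simp add: le)
    from tendsto_real_sqrt[OF this] have "(\<lambda>n. norm (FK V (u n) ?F - ?F)) \<longlonglongrightarrow> 0" by simp
    then show ?thesis by (simp add: LIM_zero_iff tendsto_norm_zero_iff)
  qed
  show ?thesis
  proof (rule metric_LIMSEQ_I)
    fix e :: real assume e: "0 < e"
    then have "0 < e / 3" by simp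
    then obtain f where f: "test_function f" "norm (F - L2_class f) < e / 3"
      by (rule test_functions_dense)
    obtain N where N: "\<And>n. N \<le> n \<Longrightarrow> dist (FK V (u n) (L2_class f)) (L2_class f) < e / 3"
      using test[OF f(1)] \<open>0 < e / 3\<close> unfolding lim_sequentially by blast
    have "dist (FK V (u n) F) F < e" if "N \<le> n" for n
    proof -
      have "norm (FK V (u n) F - FK V (u n) (L2_class f)) \<le> norm (F - L2_class f)"
        unfolding FK_diff[OF V less_imp_le[OF u0], symmetric] by (rule norm_FK_le[OF V less_imp_le[OF u0]])
      then have "dist (FK V (u n) F) (FK V (u n) (L2_class f)) < e / 3" using f(2) by (simp add: dist_norm)
      moreover have "dist (L2_class f) F < e / 3" using f(2) by (simp add: dist_norm norm_minus_commute)
      ultimately show ?thesis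
        using N[OF that] dist_triangle[of "FK V (u n) F" F "FK V (u n) (L2_class f)"]
          dist_triangle[of "FK V (u n) (L2_class f)" F "L2_class f"] by linarith
    qed
    then show "\<exists>no. \<forall>n\<ge>no. dist (FK V (u n) F) F < e" by blast
  qed
qed

text \<open>By the semigroup law and the contraction property the distance between the values at a <
  b is at most the distance between the value at b - a and F. Right continuity at 0 therefore gives
  continuity from both sides everywhere.\<close>

lemma FK_continuous: "continuous_on {0..} (\<lambda>t. FK V t F)"
proof -
  have sg: "FK V (s + t) G = FK V s (FK V t G)" if "0 \<le> s" "0 \<le> t" for s t G
    using semigroup_symmetric_measurable[OF V] that by (simp add: semigroup_symmetric_def)
  have right: "((\<lambda>t. FK V t F) \<longlongrightarrow> F) (at_right 0)"
    unfolding tendsto_at_iff_sequentially comp_def using FK_tendsto_id_seq by auto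
  show ?thesis
    unfolding continuous_on_iff
  proof (intro ballI allI impI)
    fix t e :: real assume t: "t \<in> {0..}" and e: "0 < e"
    have "eventually (\<lambda>h. dist (FK V h F) F < e) (at_right 0)" by (rule tendstoD[OF right e])
    then obtain d where d: "0 < d" "\<And>h. 0 < h \<Longrightarrow> h < d \<Longrightarrow> dist (FK V h F) F < e"
      unfolding eventually_at_right_field by auto
    have *: "dist (FK V b F) (FK V a F) < e" if "0 \<le> a" "a < b" "b - a < d" for a b
    proof -
      have "FK V b F - FK V a F = FK V a (FK V (b - a) F - F)"
        using sg[of a "b - a" F] that by (simp add: FK_diff[OF V])
      then have "dist (FK V b F) (FK V a F) \<le> dist (FK V (b - a) F) F"
        using norm_FK_le[OF V that(1)] by (simp add: dist_norm)
      also have "\<dots> < e" using that by (intro d) auto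
      finally show ?thesis .
    qed
    show "\<exists>d>0. \<forall>s\<in>{0..}. dist s t < d \<longrightarrow> dist (FK V s F) (FK V t F) < e"
    proof (intro exI[of _ d] conjI ballI impI d(1))
      fix s assume s: "s \<in> {0..}" "dist s t < d"
      consider "s = t" | "s < t" | "t < s" by linarith
      then show "dist (FK V s F) (FK V t F) < e"
      proof cases
        case 2
        then show ?thesis using *[of s t] s t by (simp add: dist_commute dist_real_def)
      next
        case 3
        then show ?thesis using *[of t s] s t by (simp add: dist_real_def)
      qed (use e in simp)
    qed
  qed
qed

lemma FK_semigroup: "symmetric_contraction_semigroup (FK V)"
proof
  fix s t :: real and f :: "'a L2"
  show "continuous_on {0..} (\<lambda>t. FK V t f)" by (rule FK_continuous)
  show "FK V 0 f = f" by (rule FK_zero)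
  show "FK V s (FK V t f) = FK V (s + t) f" if "0 \<le> s" "0 \<le> t"
    using semigroup_symmetric_measurable[OF V] that by (simp add: semigroup_symmetric_def)
  show "norm (FK V t f) \<le> norm f" if "0 \<le> t" by (rule norm_FK_le[OF V that])
  show "sym_op (FK V t)" if "0 \<le> t"
  proof -
    have "inner (FK V t F) G = inner F (FK V t G)" for F G
      using semigroup_symmetric_measurable[OF V] that by (simp add: semigroup_symmetric_def flip: Re_cinner)
    then show ?thesis
      unfolding sym_op_def using weighted_op_add[OF weight_occupation_weight[OF V] measurable_X[OF that]] weighted_op_scaleC[OF weight_occupation_weight[OF V] measurable_X[OF that]]
      by (simp add: FK_def)
  qed
qed

end

text \<open>The potential may be negative on a null set, so the weight in its original form is
  expressed through the occupation integral of |V|, which decides integrability, and the signed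
  Bochner integral; both are jointly measurable.\<close>

lemma measurable_feynman_kac_weight:
  assumes V: "V \<in> borel_measurable borel"
  shows "(\<lambda>(x, \<omega>). feynman_kac_weight V t (\<lambda>s. x + X s \<omega>)) \<in> borel_measurable (lborel \<Otimes>\<^sub>M M)"
proof -
  have Va: "(\<lambda>x. ennreal \<bar>V x\<bar>) \<in> borel_measurable borel" using V by measurable
  have J [measurable]: "(\<lambda>p. occupation (\<lambda>x. ennreal \<bar>V x\<bar>) t (fst p) (snd p)) \<in> borel_measurable (lborel \<Otimes>\<^sub>M M)"
    using measurable_occupation[OF Va, of t] by (simp add: split_beta')
  have [measurable]: "(\<lambda>q. V (fst (fst q) + X (max 0 (snd q)) (snd (fst q)))) \<in> borel_measurable ((lborel \<Otimes>\<^sub>M M) \<Otimes>\<^sub>M lborel)"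
    using measurable_path_triple[OF V] by (simp add: split_beta')
  have L [measurable]: "(\<lambda>p. \<integral>s. indicator {0..t} s * V (fst p + X (max 0 s) (snd p)) \<partial>lborel) \<in> borel_measurable (lborel \<Otimes>\<^sub>M M)"
    by (rule lborel.borel_measurable_lebesgue_integral) (simp add: split_beta')
  have "feynman_kac_weight V t (\<lambda>s. fst p + X s (snd p)) = (if occupation (\<lambda>x. ennreal \<bar>V x\<bar>) t (fst p) (snd p) < \<infinity>
       then exp (- (\<integral>s. indicator {0..t} s * V (fst p + X (max 0 s) (snd p)) \<partial>lborel)) else 0)"
    if "p \<in> space (lborel \<Otimes>\<^sub>M M)" for p
  proof -
    have \<omega>: "snd p \<in> space M" using that by (auto simp: space_pair_measure)
    note [measurable] = measurable_path[OF \<omega>] V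
    have eq: "indicator {0..t} s *\<^sub>R V (fst p + X s (snd p)) = indicator {0..t} s * V (fst p + X (max 0 s) (snd p))" for s
      by (auto simp: indicator_def max_absorb2)
    have "occupation (\<lambda>x. ennreal \<bar>V x\<bar>) t (fst p) (snd p) = (\<integral>\<^sup>+ s. ennreal (norm (indicator {0..t} s * V (fst p + X (max 0 s) (snd p)))) \<partial>lborel)"
      unfolding occupation_def by (intro nn_integral_cong) (auto simp: indicator_def)
    then show ?thesis
      unfolding feynman_kac_weight_def set_integrable_def set_lebesgue_integral_def eq
      by (simp add: integrable_iff_bounded)
  qed
  then show ?thesis
    unfolding split_beta' by (subst measurable_cong) auto
qed

text \<open>For almost every x the path almost surely meets V \<ge> 0 at almost all times, so the
  prescribed integrand agrees with the one built from the occupation weight. The expectations then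
  agree almost everywhere in x, and integrability and square integrability are transferred.\<close>

lemma feynman_kac_operators_FK:
  assumes V: "V \<in> borel_measurable borel" and pos: "AE x in lborel. 0 \<le> V x"
  shows "feynman_kac_operators M X V (FK V)"
  unfolding feynman_kac_operators_def
proof (intro allI impI ballI)
  fix t :: real and f :: "'a \<Rightarrow> complex" assume t: "0 \<le> t" and f: "f \<in> square_integrable"
  let ?H = "feynman_kac_integrand X V t f"
  let ?W = "\<lambda>x \<omega>. complex_of_real (occupation_weight V t x \<omega>) * f (x + X t \<omega>)"
  note [measurable] = measurable_X[OF t] square_integrable_measurable[OF f]
  have [measurable]: "(\<lambda>p. feynman_kac_weight V t (\<lambda>s. fst p + X s (snd p))) \<in> borel_measurable (lborel \<Otimes>\<^sub>M M)"
    using measurable_feynman_kac_weight[OF V, of t] by (simp add: split_beta')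
  have Hm: "(\<lambda>(x, \<omega>). ?H x \<omega>) \<in> borel_measurable (lborel \<Otimes>\<^sub>M M)"
    unfolding feynman_kac_integrand_def split_beta' by measurable
  have Hx: "?H x \<in> borel_measurable M" for x using measurable_Pair2[OF Hm, of x] by simp
  have [measurable]: "occupation_weight V t x \<in> borel_measurable M" for x by (rule weight_section[OF weight_occupation_weight[OF V]])
  note avg = weighted_average[OF weight_occupation_weight[OF V] measurable_X[OF t] f]
  have eq: "AE x in lborel. AE \<omega> in M. ?H x \<omega> = ?W x \<omega>"
    using AE_path[OF pos t]
  proof eventually_elim
    case (elim x)
    have "AE \<omega> in M. \<omega> \<in> space M" by (rule AE_space)
    with elim show ?case
      by eventually_elim (simp add: feynman_kac_integrand_def feynman_kac_weight_eq_occupation_weight[OF V])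
  qed
  have int_eq: "AE x in lborel. (\<integral>\<omega>. ?H x \<omega> \<partial>M) = (\<integral>\<omega>. ?W x \<omega> \<partial>M)"
    using eq by eventually_elim (rule integral_cong_AE, use Hx in measurable)
  have Hsq: "(\<lambda>x. \<integral>\<omega>. ?H x \<omega> \<partial>M) \<in> square_integrable"
  proof (rule square_integrable_cong_AE[OF _ avg(2) int_eq])
    have "(\<lambda>x. \<integral>\<omega>. ?H x \<omega> \<partial>M) \<in> borel_measurable lborel"
      by (rule borel_measurable_lebesgue_integral[OF Hm])
    then show "(\<lambda>x. \<integral>\<omega>. ?H x \<omega> \<partial>M) \<in> borel_measurable borel" by simp
  qed
  show "(AE x in lborel. integrable M (?H x)) \<and> (\<lambda>x. \<integral>\<omega>. ?H x \<omega> \<partial>M) \<in> square_integrable \<and>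
      FK V t (L2_class f) = L2_class (\<lambda>x. \<integral>\<omega>. ?H x \<omega> \<partial>M)"
  proof (intro conjI Hsq)
    show "AE x in lborel. integrable M (?H x)"
    proof -
      have "integrable M (?H x)" if "AE \<omega> in M. ?H x \<omega> = ?W x \<omega>" "integrable M (?W x)" for x
        using that Hx[of x] by (subst integrable_cong_AE[of _ _ "?W x"]) auto
      note imp = this
      from eq avg(1) show ?thesis by eventually_elim (rule imp)
    qed
    show "FK V t (L2_class f) = L2_class (\<lambda>x. \<integral>\<omega>. ?H x \<omega> \<partial>M)"
      unfolding FK_def weighted_op_L2_class[OF weight_occupation_weight[OF V] measurable_X[OF t] f]
      using int_eq by (subst L2_class_eq_iff[OF avg(2) Hsq]) (auto elim: AE_mp)
  qed
qed

end

theorem theorem2p2: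
  fixes V :: "real ^ 'd \<Rightarrow> real"
    and M :: "'w measure"
    and X :: "real \<Rightarrow> 'w \<Rightarrow> real ^ 'd"
  assumes "V \<in> locally_integrable"
    and "AE x in lborel. 0 \<le> V x"
    and "cauchy_process M X"
  shows "\<exists>T :: real \<Rightarrow> (real ^ 'd) L2 \<Rightarrow> (real ^ 'd) L2.
    feynman_kac_operators M X V T \<and>
    strongly_continuous_semigroup T \<and>
    symmetric_family T \<and>
    (\<exists>D K. self_adjoint_on D K \<and> bounded_from_below_on D K \<and>
       (\<forall>t\<ge>0. is_function_of_operator (\<lambda>x. exp (- t * x)) D K UNIV (T t)))"
proof -
  have "prob_space M" using assms(3) by (simp add: cauchy_process_def levy_process_def)
  then interpret cauchy_motion M X
    using assms(3) by (simp add: cauchy_motion_def cauchy_motion_axioms_def)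
  have V: "V \<in> borel_measurable borel" using assms(1) by (simp add: locally_integrable_def)
  have loc: "(\<integral>\<^sup>+ x. ennreal (V x) * indicator (cball 0 R) x \<partial>lborel) < \<infinity>" for R
  proof -
    have "set_integrable lborel (cball 0 R) V" using assms(1) by (simp add: locally_integrable_def)
    then have "(\<integral>\<^sup>+ x. ennreal (norm (indicator (cball 0 R) x *\<^sub>R V x)) \<partial>lborel) < \<infinity>"
      unfolding set_integrable_def by (simp add: integrable_iff_bounded)
    moreover have "(\<integral>\<^sup>+ x. ennreal (V x) * indicator (cball 0 R) x \<partial>lborel)
        \<le> (\<integral>\<^sup>+ x. ennreal (norm (indicator (cball 0 R) x *\<^sub>R V x)) \<partial>lborel)"
      by (intro nn_integral_mono) (auto simp: indicator_def intro!: ennreal_leI)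
    ultimately show ?thesis by (rule le_less_trans[rotated])
  qed
  interpret S: symmetric_contraction_semigroup "FK V" by (rule FK_semigroup[OF V loc])
  have bc: "bounded_clinear (FK V t)" if "0 \<le> t" for t
    by (rule sym_op_bounded_clinear[OF S.sym[OF that] S.contr[OF that]])
  have "strongly_continuous_semigroup (FK V)"
    unfolding strongly_continuous_semigroup_def
    using bc S.cont S.T_add by (auto simp: FK_zero fun_eq_iff)
  moreover have "symmetric_family (FK V)"
    unfolding symmetric_family_def using bc S.sym sym_op_adjoint_graph by blast
  ultimately show ?thesis
    using feynman_kac_operators_FK[OF V assms(2)] S.generator_exists by blast
qed

end
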